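(* Let $\mathfrak{C}$ be an $(\!(n,k)\!)$ code with isometric encoding channel $\mathcal E$, let $d\ge1$, $\delta\ge0$, and let $\mathsf g$ be the complete graph on the $n$ qubits. Suppose either $$H_2\big(\varepsilon_{\mathsf g}(\mathfrak{C},d)/2+\delta/2\big)<k/n,$$ or $$H_2\big(2\max_{\mathcal N}\tilde\varepsilon(\mathcal N,\mathcal E)+\delta/2\big)<k/n,$$ where the maximum is over all replacement channels $\mathcal N$ acting on any $d$ qubits, and where the arguments of $H_2$ are less than $1/2$. Then every code state $|\psi\rangle\in\mathfrak{C}$ satisfies $\mathscr{C}^{\delta}(\psi)>\log d$.
   Context: An $(\!(n,k)\!)$ code is a $2^k$-dimensional subspace $\mathfrak{C}\subseteq(\mathbb{C}^2)^{\otimes n}$, $k<n$; $\Gamma=\Pi/2^k$. $\varepsilon_{\mathsf g}(\mathfrak{C},d)=\max\{\|\psi_S-\Gamma_S\|_1:|\psi\rangle\in\mathfrak{C}, |S|\le d\}$. A replacement channel on a set $S$ of qubits is $\sigma\mapsto(\mathrm{Tr}_S\sigma)\otimes\gamma$ for fixed $\gamma$ (identity elsewhere). QEC inaccuracy $\tilde\varepsilon(\mathcal N,\mathcal E)=\min_{\mathcal R}P(\mathcal R\circ\mathcal N\circ\mathcal E,\mathrm{id}_L)$, where $P(\mathcal M_1,\mathcal M_2)=\sqrt{1-F^2}$, $F=\min_\rho f((\mathcal M_1\otimes\mathrm{id})(\rho),(\mathcal M_2\otimes\mathrm{id})(\rho))$, $f(\rho,\sigma)=\|\sqrt\rho\sqrt\sigma\|_1$.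 $\mathscr{C}^\delta(\psi)$ is the minimum over pure $\psi'$ with $\|\psi'-\psi\|_1\le\delta$ of the minimum depth of a circuit of layers of disjoint arbitrary 2-qubit gates preparing $|\psi'\rangle$ from $|0\rangle^{\otimes n}$. Logs base 2; $H_2$ binary entropy. *)

theory Defs
  imports Complex_Main "Jordan_Normal_Form.Matrix"
begin

(* Qubit q of an n-qubit system corresponds to bit q of a basis index a < 2^n. *)

type_synonym cmat = "complex mat"

definition adj :: "cmat \<Rightarrow> cmat" where
  "adj A = mat (dim_col A) (dim_row A) (\<lambda>(i,j). cnj (A $$ (j,i)))"

definition mtrace :: "cmat \<Rightarrow> complex" where
  "mtrace A = (\<Sum>i<dim_row A. A $$ (i,i))"

definition psd :: "cmat \<Rightarrow> bool" where
  "psd A \<longleftrightarrow> A \<in> carrier_mat (dim_row A) (dim_row A) \<and>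
     (\<forall>v \<in> carrier_vec (dim_row A). (A *\<^sub>v v) \<bullet>c v \<in> \<real> \<and> 0 \<le> Re ((A *\<^sub>v v) \<bullet>c v))"

definition unitary :: "nat \<Rightarrow> cmat \<Rightarrow> bool" where
  "unitary D U \<longleftrightarrow> U \<in> carrier_mat D D \<and> adj U * U = 1\<^sub>m D"

definition msqrt :: "cmat \<Rightarrow> cmat" where
  "msqrt A = (THE B. psd B \<and> dim_row B = dim_row A \<and> B * B = A)"

definition trace_norm :: "cmat \<Rightarrow> real" where
  "trace_norm A = Re (mtrace (msqrt (adj A * A)))"

definition density :: "nat \<Rightarrow> cmat \<Rightarrow> bool" where
  "density D \<rho> \<longleftrightarrow> \<rho> \<in> carrier_mat D D \<and> psd \<rho> \<and> mtrace \<rho> = 1"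

definition fidelity :: "cmat \<Rightarrow> cmat \<Rightarrow> real" where
  "fidelity \<rho> \<sigma> = trace_norm (msqrt \<rho> * msqrt \<sigma>)"

definition outer :: "complex vec \<Rightarrow> cmat" where
  "outer v = mat (dim_vec v) (dim_vec v) (\<lambda>(i,j). v $ i * cnj (v $ j))"

definition bitq :: "nat \<Rightarrow> nat \<Rightarrow> nat" where
  "bitq a q = a div 2 ^ q mod 2"

text \<open>Index in 2^|S| formed by the bits of a at the positions of S (in increasing order).\<close>
definition sub_idx :: "nat set \<Rightarrow> nat \<Rightarrow> nat" where
  "sub_idx S a = (\<Sum>q\<in>S. bitq a q * 2 ^ card {p\<in>S. p < q})"

definition ptrace_keep :: "nat \<Rightarrow> nat set \<Rightarrow> cmat \<Rightarrow> cmat" where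
  "ptrace_keep n S \<rho> = mat (2 ^ card S) (2 ^ card S) (\<lambda>(x,y).
     \<Sum>a<2^n. \<Sum>b<2^n.
       if sub_idx S a = x \<and> sub_idx S b = y \<and> sub_idx ({0..<n} - S) a = sub_idx ({0..<n} - S) b
       then \<rho> $$ (a,b) else 0)"

definition replacement :: "nat \<Rightarrow> nat set \<Rightarrow> cmat \<Rightarrow> cmat \<Rightarrow> cmat" where
  "replacement n S \<gamma> \<sigma> = (let T = {0..<n} - S; \<tau> = ptrace_keep n T \<sigma> in
     mat (2^n) (2^n) (\<lambda>(a,b). \<tau> $$ (sub_idx T a, sub_idx T b) * \<gamma> $$ (sub_idx S a, sub_idx S b)))"

definition kraus_channel :: "nat \<Rightarrow> nat \<Rightarrow> (cmat \<Rightarrow> cmat) \<Rightarrow> bool" where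
  "kraus_channel din dout \<Phi> \<longleftrightarrow> (\<exists>Ks. set Ks \<subseteq> carrier_mat dout din \<and>
     foldr (+) (map (\<lambda>K. adj K * K) Ks) (0\<^sub>m din din) = 1\<^sub>m din \<and>
     (\<forall>\<rho> \<in> carrier_mat din din. \<Phi> \<rho> = foldr (+) (map (\<lambda>K. K * \<rho> * adj K) Ks) (0\<^sub>m dout dout)))"

text \<open>(Phi tensor id_m)(rho) for rho on (din-system) tensor (m-reference), system index major.\<close>
definition tensor_id :: "nat \<Rightarrow> nat \<Rightarrow> nat \<Rightarrow> (cmat \<Rightarrow> cmat) \<Rightarrow> cmat \<Rightarrow> cmat" where
  "tensor_id din dout m \<Phi> \<rho> = (let blk = (\<lambda>r r'. mat din din (\<lambda>(s,t). \<rho> $$ (s*m+r, t*m+r'))) in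
     mat (dout*m) (dout*m) (\<lambda>(i,j). \<Phi> (blk (i mod m) (j mod m)) $$ (i div m, j div m)))"

definition chan_fid :: "nat \<Rightarrow> nat \<Rightarrow> (cmat \<Rightarrow> cmat) \<Rightarrow> (cmat \<Rightarrow> cmat) \<Rightarrow> real" where
  "chan_fid din dout M1 M2 = Inf {fidelity (tensor_id din dout m M1 \<rho>) (tensor_id din dout m M2 \<rho>) | m \<rho>.
      1 \<le> m \<and> density (din * m) \<rho>}"

definition purified_dist :: "nat \<Rightarrow> nat \<Rightarrow> (cmat \<Rightarrow> cmat) \<Rightarrow> (cmat \<Rightarrow> cmat) \<Rightarrow> real" where
  "purified_dist din dout M1 M2 = sqrt (1 - (chan_fid din dout M1 M2)\<^sup>2)"

definition encoding :: "cmat \<Rightarrow> cmat \<Rightarrow> cmat" where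
  "encoding V \<rho> = V * \<rho> * adj V"

definition qec_inacc :: "nat \<Rightarrow> nat \<Rightarrow> (cmat \<Rightarrow> cmat) \<Rightarrow> (cmat \<Rightarrow> cmat) \<Rightarrow> real" where
  "qec_inacc n k N E = Inf {purified_dist (2^k) (2^k) (R \<circ> N \<circ> E) id | R. kraus_channel (2^n) (2^k) R}"

definition code_space :: "nat \<Rightarrow> nat \<Rightarrow> cmat \<Rightarrow> complex vec set" where
  "code_space n k V = {V *\<^sub>v \<phi> | \<phi>. \<phi> \<in> carrier_vec (2^k)}"

definition code_Gamma :: "nat \<Rightarrow> cmat \<Rightarrow> cmat" where
  "code_Gamma k V = (1 / 2^k) \<cdot>\<^sub>m (V * adj V)"

text \<open>epsilon_g(C,d) for the complete graph g: all sets of at most d qubits.\<close>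
definition eps_g_complete :: "nat \<Rightarrow> nat \<Rightarrow> cmat \<Rightarrow> nat \<Rightarrow> real" where
  "eps_g_complete n k V d = Sup {trace_norm (ptrace_keep n S (outer \<psi>) - ptrace_keep n S (code_Gamma k V)) | \<psi> S.
      \<psi> \<in> code_space n k V \<and> \<psi> \<bullet>c \<psi> = 1 \<and> S \<subseteq> {0..<n} \<and> card S \<le> d}"

definition max_repl_inacc :: "nat \<Rightarrow> nat \<Rightarrow> cmat \<Rightarrow> nat \<Rightarrow> real" where
  "max_repl_inacc n k V d = Sup {qec_inacc n k (replacement n S \<gamma>) (encoding V) | S \<gamma>.
      S \<subseteq> {0..<n} \<and> card S \<le> d \<and> density (2 ^ card S) \<gamma>}"

definition gate_on :: "nat \<Rightarrow> nat \<Rightarrow> nat \<Rightarrow> cmat \<Rightarrow> cmat" where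
  "gate_on n i j U = mat (2^n) (2^n) (\<lambda>(a,b).
     if (\<forall>q<n. q \<noteq> i \<and> q \<noteq> j \<longrightarrow> bitq a q = bitq b q)
     then U $$ (2 * bitq a i + bitq a j, 2 * bitq b i + bitq b j) else 0)"

definition layer :: "nat \<Rightarrow> cmat \<Rightarrow> bool" where
  "layer n L \<longleftrightarrow> (\<exists>gs :: (nat \<times> nat \<times> cmat) list.
     (\<forall>(i,j,U) \<in> set gs. i < n \<and> j < n \<and> i \<noteq> j \<and> unitary 4 U) \<and>
     (\<forall>p<length gs. \<forall>q<length gs. p \<noteq> q \<longrightarrow>
        {fst (gs!p), fst (snd (gs!p))} \<inter> {fst (gs!q), fst (snd (gs!q))} = {}) \<and>
     L = foldr (\<lambda>(i,j,U) M. gate_on n i j U * M) gs (1\<^sub>m (2^n)))"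

definition circ_complexity :: "nat \<Rightarrow> real \<Rightarrow> complex vec \<Rightarrow> nat" where
  "circ_complexity n \<delta> \<psi> = (LEAST D. \<exists>\<psi>' Ls. \<psi>' \<in> carrier_vec (2^n) \<and> \<psi>' \<bullet>c \<psi>' = 1 \<and>
      trace_norm (outer \<psi>' - outer \<psi>) \<le> \<delta> \<and> length Ls = D \<and> (\<forall>L\<in>set Ls. layer n L) \<and>
      outer (foldr (*) Ls (1\<^sub>m (2^n)) *\<^sub>v unit_vec (2^n) 0) = outer \<psi>')"

definition H2 :: "real \<Rightarrow> real" where
  "H2 p = (if p \<le> 0 \<or> 1 \<le> p then 0 else - p * log 2 p - (1 - p) * log 2 (1 - p))"

end

theory Submission
  imports Defs "Jordan_Normal_Form.Schur_Decomposition" "HOL-Analysis.L2_Norm"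
begin

text \<open>Suppose a circuit \<open>U\<close> of depth \<open>D \<le> log d\<close> prepares a state within \<open>\<delta>\<close> of a code state. Each
  observable \<open>U Z\<^sub>i U\<^sup>\<dagger>\<close> has expectation \<open>1\<close> in the prepared state and, by the light cone of \<open>U\<close>, acts on
  at most \<open>2\<^sup>D \<le> d\<close> qubits. Code states are nearly indistinguishable from the maximally mixed code state
  \<open>\<Gamma>\<close> on \<open>d\<close> qubits: directly by the first hypothesis; under the second one because a recovery after
  the loss of these qubits leaves no information about the logical state in them. Hence measuring
  \<open>U\<^sup>\<dagger> \<Gamma> U\<close> in the computational basis gives bits that are each \<open>1\<close> with probability at most \<open>t\<close>, the
  argument of \<open>H2\<close>, while every outcome has probability at most \<open>2\<^sup>-\<^sup>k\<close>. Gibbs' inequality then gives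
  \<open>k \<le> n H2(t)\<close>.

  The complexity is a least element, so it carries information only if some circuit prepares the state:
  two-qubit gates generate all multiply controlled rotations, which clear the amplitudes of a given
  state one after another.\<close>

section \<open>Hermitian matrices\<close>

text \<open>Where the constants come from: a bit is 1 with probability \<open>(1 - z) / 2\<close>,
  \<open>z\<close> being the expectation of its Pauli observable, so expectation errors
  \<open>e\<close> and \<open>\<delta>\<close> give \<open>t = e / 2 + \<delta> / 2\<close>. Under
  the second hypothesis \<open>e\<close> is four times the maximal inaccuracy: two code states are
  superposed with the two states of a reference qubit, the sign of the reference times the lost
  observable has as expectation half the difference of the two code expectations, and this is at
  most \<open>2 * sqrt (1 - a)\<close>, with \<open>a\<close> the squared fidelity of the recovered
  state. The ideal output of this test is pure, so the only fidelity ever evaluated is one with a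
  pure state. Two obstacles lie in the definitions. \<open>msqrt\<close> is a definite description,
  so trace norm and fidelity say nothing before positive roots are known to exist and to be unique;
  this is the purpose of the spectral theorem. Real \<open>Sup\<close> and \<open>Inf\<close> bound
  their members only on suitably bounded sets, and bounds for them need nonempty sets; hence the
  crude norm estimates and the explicit recovery channel.\<close>

lemma mat_mult_sum:
  assumes "A \<in> carrier_mat r m" "B \<in> carrier_mat m c" "i < r" "j < c"
  shows "(A * B) $$ (i,j) = (\<Sum>k<m. A $$ (i,k) * B $$ (k,j))"
  using assms by (auto simp: scalar_prod_def lessThan_atLeast0 intro!: sum.cong)

lemma mat_vec_sum:
  assumes "A \<in> carrier_mat r m" "v \<in> carrier_vec m" "i < r"
  shows "(A *\<^sub>v v) $ i = (\<Sum>k<m. A $$ (i,k) * v $ k)"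
  using assms by (auto simp: scalar_prod_def lessThan_atLeast0 intro!: sum.cong)

lemma cscalar_prod_sum:
  fixes v w :: "complex vec"
  assumes "w \<in> carrier_vec m"
  shows "v \<bullet>c w = (\<Sum>k<m. v $ k * cnj (w $ k))"
  using assms by (auto simp: scalar_prod_def lessThan_atLeast0 intro!: sum.cong)

lemma adj_dims [simp]: "dim_row (adj A) = dim_col A" "dim_col (adj A) = dim_row A"
  by (auto simp: adj_def)

lemma adj_carrier [simp]: "A \<in> carrier_mat r c \<Longrightarrow> adj A \<in> carrier_mat c r"
  by (auto simp: adj_def)

lemma adj_index [simp]: "i < dim_col A \<Longrightarrow> j < dim_row A \<Longrightarrow> adj A $$ (i,j) = cnj (A $$ (j,i))"
  by (auto simp: adj_def)

lemma adj_adj [simp]: "adj (adj A) = A"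
  by (rule eq_matI) auto

lemma adj_one [simp]: "adj (1\<^sub>m n) = 1\<^sub>m n"
  by (rule eq_matI) auto

lemma adj_mult:
  assumes "A \<in> carrier_mat r m" "B \<in> carrier_mat m c"
  shows "adj (A * B) = adj B * adj A"
proof (rule eq_matI)
  fix i j assume "i < dim_row (adj B * adj A)" "j < dim_col (adj B * adj A)"
  then have ij: "i < c" "j < r" using assms by auto
  have "adj (A * B) $$ (i,j) = cnj (\<Sum>k<m. A $$ (j,k) * B $$ (k,i))"
    using ij assms mat_mult_sum[OF assms ij(2,1)] by auto
  also have "\<dots> = (\<Sum>k<m. adj B $$ (i,k) * adj A $$ (k,j))"
    using ij assms by (auto simp: cnj_sum mult.commute intro!: sum.cong)
  also have "\<dots> = (adj B * adj A) $$ (i,j)"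
    using mat_mult_sum[of "adj B" c m "adj A" r i j] ij assms by auto
  finally show "adj (A * B) $$ (i,j) = (adj B * adj A) $$ (i,j)" .
qed (use assms in auto)

lemma mtrace_sum: "A \<in> carrier_mat D D \<Longrightarrow> mtrace A = (\<Sum>i<D. A $$ (i,i))"
  by (auto simp: mtrace_def)

lemma mtrace_mult:
  assumes "A \<in> carrier_mat r c" "B \<in> carrier_mat c r"
  shows "mtrace (A * B) = (\<Sum>i<r. \<Sum>j<c. A $$ (i,j) * B $$ (j,i))"
  using assms mat_mult_sum[OF assms]
  by (auto simp: mtrace_def simp del: index_mult_mat(1) intro!: sum.cong)

lemma mtrace_comm:
  assumes "A \<in> carrier_mat r c" "B \<in> carrier_mat c r"
  shows "mtrace (A * B) = mtrace (B * A)"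
  unfolding mtrace_mult[OF assms] mtrace_mult[OF assms(2,1)]
  by (subst sum.swap) (simp add: mult.commute)

section \<open>Spectral decomposition of Hermitian matrices\<close>

definition orthonormal :: "nat \<Rightarrow> nat \<Rightarrow> (nat \<Rightarrow> nat \<Rightarrow> complex) \<Rightarrow> bool" where
  "orthonormal D m u \<longleftrightarrow>
     (\<forall>i<m. \<forall>j<m. (\<Sum>a<D. u i a * cnj (u j a)) = (if i = j then 1 else 0))"

text \<open>The decomposition found in \<open>hermitian_spec_mat\<close> collects eigenvectors of
  nonzero eigenvalues only, so \<open>m\<close> may be smaller than \<open>D\<close>; on the
  orthogonal complement the operator is zero.\<close>

definition spec_mat :: "nat \<Rightarrow> nat \<Rightarrow> (nat \<Rightarrow> real) \<Rightarrow> (nat \<Rightarrow> nat \<Rightarrow> complex) \<Rightarrow> cmat" where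
  "spec_mat D m l u = mat D D (\<lambda>(a,b). \<Sum>i<m. of_real (l i) * u i a * cnj (u i b))"

lemma spec_mat_carrier [simp]: "spec_mat D m l u \<in> carrier_mat D D"
  "dim_row (spec_mat D m l u) = D" "dim_col (spec_mat D m l u) = D"
  by (auto simp: spec_mat_def)

lemma spec_mat_index: "a < D \<Longrightarrow> b < D \<Longrightarrow>
    spec_mat D m l u $$ (a,b) = (\<Sum>i<m. of_real (l i) * u i a * cnj (u i b))"
  by (auto simp: spec_mat_def)

lemma spec_mat_adj [simp]: "adj (spec_mat D m l u) = spec_mat D m l u"
  by (rule eq_matI) (auto simp: spec_mat_index cnj_sum intro!: sum.cong)

lemma orthonormal_spec_apply:
  assumes "orthonormal D m u" "i < m" "a < D"
  shows "(\<Sum>b<D. spec_mat D m l u $$ (a,b) * u i b) = of_real (l i) * u i a"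
proof -
  have "(\<Sum>b<D. spec_mat D m l u $$ (a,b) * u i b)
      = (\<Sum>b<D. \<Sum>j<m. of_real (l j) * u j a * (u i b * cnj (u j b)))"
    using assms by (auto simp: spec_mat_index sum_distrib_left sum_distrib_right mult_ac intro!: sum.cong)
  also have "\<dots> = (\<Sum>j<m. of_real (l j) * u j a * (\<Sum>b<D. u i b * cnj (u j b)))"
    by (subst sum.swap) (simp add: sum_distrib_left)
  also have "\<dots> = (\<Sum>j<m. if j = i then of_real (l j) * u j a else 0)"
    using assms unfolding orthonormal_def by (intro sum.cong) auto
  finally show ?thesis using assms by simp
qed

text \<open>Cross terms cancel by orthonormality and eigenvalues multiply pointwise. This is the
  functional calculus behind the roots and absolute values below.\<close>

lemma spec_mat_mult:
  assumes "orthonormal D m u"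
  shows "spec_mat D m l u * spec_mat D m l' u = spec_mat D m (\<lambda>i. l i * l' i) u"
proof (rule eq_matI)
  fix a b assume "a < dim_row (spec_mat D m (\<lambda>i. l i * l' i) u)" "b < dim_col (spec_mat D m (\<lambda>i. l i * l' i) u)"
  then have ab: "a < D" "b < D" by auto
  have "(spec_mat D m l u * spec_mat D m l' u) $$ (a,b)
      = (\<Sum>c<D. \<Sum>i<m. spec_mat D m l u $$ (a,c) * u i c * (of_real (l' i) * cnj (u i b)))"
    using ab mat_mult_sum[of "spec_mat D m l u" D D "spec_mat D m l' u" D a b]
    by (auto simp: spec_mat_index[of _ D b] sum_distrib_left mult_ac intro!: sum.cong)
  also have "\<dots> = (\<Sum>i<m. (\<Sum>c<D. spec_mat D m l u $$ (a,c) * u i c) * (of_real (l' i) * cnj (u i b)))"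
    by (subst sum.swap) (simp add: sum_distrib_right)
  also have "\<dots> = (\<Sum>i<m. of_real (l i * l' i) * u i a * cnj (u i b))"
    using ab orthonormal_spec_apply[OF assms] by (auto simp: mult_ac intro!: sum.cong)
  finally show "(spec_mat D m l u * spec_mat D m l' u) $$ (a,b) = spec_mat D m (\<lambda>i. l i * l' i) u $$ (a,b)"
    using ab by (simp add: spec_mat_index)
qed auto

lemma spec_mat_trace:
  assumes "orthonormal D m u"
  shows "mtrace (spec_mat D m l u) = (\<Sum>i<m. of_real (l i))"
proof -
  have "mtrace (spec_mat D m l u) = (\<Sum>i<m. of_real (l i) * (\<Sum>a<D. u i a * cnj (u i a)))"
    unfolding mtrace_def sum_distrib_left
    by (subst sum.swap) (auto simp: spec_mat_index mult_ac intro!: sum.cong)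
  then show ?thesis using assms by (auto simp: orthonormal_def)
qed

text \<open>\<open>P\<close> is an orthogonal projection, so its diagonal entry \<open>s\<close>
  equals the squared norm of row \<open>a\<close>, which is at least \<open>s\<close>
  squared.\<close>

lemma orthonormal_Bessel:
  assumes "orthonormal D m u" "a < D"
  shows "(\<Sum>i<m. (cmod (u i a))\<^sup>2) \<le> 1"
proof -
  define P where "P = spec_mat D m (\<lambda>_. 1) u"
  define s where "s = (\<Sum>i<m. (cmod (u i a))\<^sup>2)"
  have P: "P \<in> carrier_mat D D" "adj P = P" "P * P = P"
    using spec_mat_mult[OF assms(1), of "\<lambda>_. 1" "\<lambda>_. 1"] by (auto simp: P_def)
  have sym: "P $$ (b,a) = cnj (P $$ (a,b))" if "b < D" for b
    using adj_index[of b P a] P assms(2) that by (metis carrier_matD)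
  have Ps: "P $$ (a,a) = of_real s"
    using assms by (simp add: P_def spec_mat_index s_def complex_norm_square[symmetric] del: of_real_power)
  have "P $$ (a,a) = (\<Sum>b<D. P $$ (a,b) * P $$ (b,a))"
    using mat_mult_sum[OF P(1,1) assms(2,2)] P(3) by simp
  also have "\<dots> = of_real (\<Sum>b<D. (cmod (P $$ (a,b)))\<^sup>2)"
    using sym by (auto simp: complex_norm_square[symmetric] simp del: of_real_power intro!: sum.cong)
  finally have "s = (\<Sum>b<D. (cmod (P $$ (a,b)))\<^sup>2)"
    unfolding Ps of_real_eq_iff .
  also have "\<dots> \<ge> (cmod (P $$ (a,a)))\<^sup>2"
    using assms(2) by (intro member_le_sum) auto
  finally have "s\<^sup>2 \<le> s" using Ps by simp
  then have "s * s \<le> s * 1" by (simp add: power2_eq_square)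
  then show ?thesis unfolding s_def[symmetric]
    by (cases "s \<le> 0") (auto simp: mult_le_cancel_left)
qed

lemma orthonormal_entry_le:
  assumes "orthonormal D m u" "i < m" "a < D"
  shows "cmod (u i a) \<le> 1"
proof -
  have "(cmod (u i a))\<^sup>2 \<le> (\<Sum>i<m. (cmod (u i a))\<^sup>2)"
    using assms by (intro member_le_sum) auto
  then have "(cmod (u i a))\<^sup>2 \<le> 1\<^sup>2" using orthonormal_Bessel[OF assms(1,3)] by simp
  then show ?thesis by (rule power2_le_imp_le) simp
qed

text \<open>Double counting of the squared moduli: summed by vectors they give \<open>m\<close>,
  summed by coordinates at most \<open>D\<close> by Bessel.\<close>

lemma orthonormal_card:
  assumes "orthonormal D m u" shows "m \<le> D"
proof -
  have one: "(\<Sum>a<D. (cmod (u i a))\<^sup>2) = 1" if "i < m" for i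
  proof -
    have "complex_of_real (\<Sum>a<D. (cmod (u i a))\<^sup>2) = 1"
      using assms that by (simp add: orthonormal_def complex_norm_square del: of_real_power)
    then show ?thesis by (simp only: of_real_eq_1_iff)
  qed
  have "real m = (\<Sum>i<m. \<Sum>a<D. (cmod (u i a))\<^sup>2)" using one by simp
  also have "\<dots> = (\<Sum>a<D. \<Sum>i<m. (cmod (u i a))\<^sup>2)" by (rule sum.swap)
  also have "\<dots> \<le> (\<Sum>a<D. 1)" using orthonormal_Bessel[OF assms] by (intro sum_mono) auto
  finally show ?thesis by simp
qed

text \<open>If every eigenvalue vanished, the Schur form would be strictly upper triangular, so the trace
  of the square, which is the sum of the squared moduli of the entries, would vanish.\<close>
lemma hermitian_nonzero_eigenvalue:
  assumes A: "A \<in> carrier_mat D D" "adj A = A" and nz: "A \<noteq> 0\<^sub>m D D"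
  obtains e v where "e \<noteq> 0" "v \<in> carrier_vec D" "v \<noteq> 0\<^sub>v D" "A *\<^sub>v v = e \<cdot>\<^sub>v v"
proof -
  obtain es where es: "char_poly A = (\<Prod>a\<leftarrow>es. [:- a, 1:])"
    using char_poly_factorized[OF A(1)] by blast
  obtain B where B: "B \<in> carrier_mat D D" "upper_triangular B" "similar_mat A B"
    using schur_decomposition_exists[OF A(1) es] by blast
  obtain P Q where PQ: "P \<in> carrier_mat D D" "Q \<in> carrier_mat D D" "Q * P = 1\<^sub>m D" "A = P * B * Q"
  proof -
    obtain n P Q where n: "{A,B,P,Q} \<subseteq> carrier_mat n n" "Q * P = 1\<^sub>m n" "A = P * B * Q"
      using similar_matD[OF B(3)] by blast
    have "n = D" using n(1) A(1) unfolding carrier_mat_def by blast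
    with n show thesis by (intro that[of P Q]) simp_all
  qed
  have "\<exists>i<D. B $$ (i,i) \<noteq> 0"
  proof (rule ccontr)
    assume "\<not> ?thesis"
    then have z: "B $$ (i,i) = 0" if "i < D" for i using that by auto
    have "A * A = P * B * (Q * (P * (B * Q)))"
      unfolding PQ(4) using PQ B by (simp add: assoc_mult_mat[of _ D D _ D _ D])
    also have "Q * (P * (B * Q)) = B * Q"
      using PQ B by (simp add: assoc_mult_mat[of Q D D P D "B * Q" D, symmetric])
    finally have "mtrace (A * A) = mtrace ((P * B) * (B * Q))" by simp
    also have "\<dots> = mtrace ((B * Q) * (P * B))" using PQ B by (intro mtrace_comm[of _ D D]) auto
    also have "(B * Q) * (P * B) = B * (Q * P * B)"
      using PQ(1,2) B by (simp add: assoc_mult_mat[of _ D D _ D _ D])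
    also have "\<dots> = B * B" using PQ B by simp
    also have "mtrace (B * B) = (\<Sum>i<D. \<Sum>j<D. B $$ (i,j) * B $$ (j,i))"
      using B by (intro mtrace_mult)
    also have "\<dots> = 0"
    proof (intro sum.neutral ballI)
      fix i j assume "i \<in> {..<D}" "j \<in> {..<D}"
      then show "B $$ (i,j) * B $$ (j,i) = 0"
        using z B(1) upper_triangularD[OF B(2), of i j] upper_triangularD[OF B(2), of j i]
        by (cases i j rule: linorder_cases) auto
    qed
    finally have "(\<Sum>i<D. \<Sum>j<D. A $$ (i,j) * A $$ (j,i)) = 0"
      using mtrace_mult[OF A(1,1)] by simp
    moreover have "A $$ (i,j) * A $$ (j,i) = of_real ((cmod (A $$ (i,j)))\<^sup>2)" if "i < D" "j < D" for i j
    proof -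
      have "A $$ (j,i) = cnj (A $$ (i,j))"
        using adj_index[of j A i] A that by (metis carrier_matD)
      then show ?thesis by (simp only: complex_norm_square)
    qed
    ultimately have "complex_of_real (\<Sum>i<D. \<Sum>j<D. (cmod (A $$ (i,j)))\<^sup>2) = 0"
      by (simp del: of_real_power)
    then have "(\<Sum>i<D. \<Sum>j<D. (cmod (A $$ (i,j)))\<^sup>2) = 0"
      by (simp only: of_real_eq_0_iff)
    then have "\<forall>i<D. \<forall>j<D. (cmod (A $$ (i,j)))\<^sup>2 = 0"
      by (subst (asm) sum_nonneg_eq_0_iff) (auto simp: sum_nonneg sum_nonneg_eq_0_iff)
    then have "A = 0\<^sub>m D D" using A(1) by (intro eq_matI) auto
    then show False using nz by simp
  qed
  then obtain i where i: "i < D" "B $$ (i,i) \<noteq> 0" by blast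
  have "poly (char_poly A) (B $$ (i,i)) = 0"
    unfolding char_poly_similar[OF B(3)] char_poly_upper_triangular[OF B(1,2)]
    using i B(1) by (auto simp: poly_prod_list prod_list_zero_iff diag_mat_def o_def intro!: image_eqI[of _ _ i])
  then have "eigenvalue A (B $$ (i,i))" using eigenvalue_root_char_poly[OF A(1)] by blast
  then show ?thesis using that i A(1) unfolding eigenvalue_def eigenvector_def by auto
qed

lemma hermitian_index: "adj A = A \<Longrightarrow> A \<in> carrier_mat D D \<Longrightarrow> a < D \<Longrightarrow> b < D \<Longrightarrow> A $$ (b,a) = cnj (A $$ (a,b))"
  using adj_index[of b A a] by (metis carrier_matD)

text \<open>The eigenvalue is real because the quadratic form at the eigenvector,
  \<open>e * N\<close> with \<open>N > 0\<close>, is its own conjugate.\<close>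

lemma hermitian_unit_eigenvector:
  assumes A: "A \<in> carrier_mat D D" "adj A = A" and nz: "A \<noteq> 0\<^sub>m D D"
  obtains e :: real and v where "e \<noteq> 0" "(\<Sum>a<D. v a * cnj (v a)) = 1"
    "\<And>a. a < D \<Longrightarrow> (\<Sum>b<D. A $$ (a,b) * v b) = of_real e * v a"
proof -
  obtain e w where w: "e \<noteq> 0" "w \<in> carrier_vec D" "w \<noteq> 0\<^sub>v D" "A *\<^sub>v w = e \<cdot>\<^sub>v w"
    using hermitian_nonzero_eigenvalue[OF assms] by blast
  define N where "N = (\<Sum>a<D. (cmod (w $ a))\<^sup>2)"
  have "N \<noteq> 0"
  proof
    assume "N = 0"
    then have "\<forall>a<D. (cmod (w $ a))\<^sup>2 = 0" unfolding N_def by (subst (asm) sum_nonneg_eq_0_iff) auto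
    then have "w = 0\<^sub>v D" using w(2) by (intro eq_vecI) auto
    then show False using w by simp
  qed
  moreover have "N \<ge> 0" unfolding N_def by (simp add: sum_nonneg)
  ultimately have N: "N > 0" by simp
  have ev: "(\<Sum>b<D. A $$ (a,b) * w $ b) = e * w $ a" if "a < D" for a
    using mat_vec_sum[OF A(1) w(2) that] w that by simp
  have q: "(\<Sum>a<D. cnj (w $ a) * (\<Sum>b<D. A $$ (a,b) * w $ b)) = e * of_real N"
    using ev by (simp add: N_def complex_norm_square sum_distrib_left mult_ac del: of_real_power)
  let ?f = "\<lambda>a b. cnj (w $ a) * (A $$ (a,b) * w $ b)"
  have q': "(\<Sum>a<D. \<Sum>b<D. ?f a b) = e * of_real N"
    using q by (simp only: sum_distrib_left)
  have sym: "cnj (?f a b) = ?f b a" if "a < D" "b < D" for a b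
  proof -
    have "A $$ (b,a) = cnj (A $$ (a,b))" using that by (intro hermitian_index[OF A(2,1)])
    then show ?thesis by (simp only: complex_cnj_mult complex_cnj_cnj mult_ac)
  qed
  have "cnj (e * of_real N) = (\<Sum>a<D. \<Sum>b<D. cnj (?f a b))"
    unfolding q'[symmetric] by (simp only: cnj_sum)
  also have "\<dots> = (\<Sum>a<D. \<Sum>b<D. ?f b a)"
    by (intro sum.cong refl) (use sym in simp)
  also have "\<dots> = (\<Sum>b<D. \<Sum>a<D. ?f b a)" by (rule sum.swap)
  also have "\<dots> = e * of_real N" by (rule q')
  finally have "cnj e = e" using N by simp
  then have e: "of_real (Re e) = e" by (simp add: complex_eq_iff)
  show ?thesis
  proof (rule that[of "Re e" "\<lambda>a. w $ a / of_real (sqrt N)"])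
    show "Re e \<noteq> 0" using w(1) e by (metis of_real_0)
    have sq: "complex_of_real (sqrt N) * complex_of_real (sqrt N) = of_real N"
      using N by (simp only: of_real_mult[symmetric] real_sqrt_mult_self abs_of_pos)
    have wN: "(\<Sum>a<D. w $ a * cnj (w $ a)) = of_real N"
      by (simp only: N_def of_real_sum complex_norm_square)
    have "(\<Sum>a<D. (w $ a / of_real (sqrt N)) * cnj (w $ a / of_real (sqrt N)))
        = (\<Sum>a<D. (w $ a * cnj (w $ a)) / of_real N)"
      by (simp only: complex_cnj_divide complex_cnj_complex_of_real times_divide_times_eq sq)
    also have "\<dots> = of_real N / of_real N" by (simp only: sum_divide_distrib[symmetric] wN)
    finally show "(\<Sum>a<D. (w $ a / of_real (sqrt N)) * cnj (w $ a / of_real (sqrt N))) = 1" using N by simp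
    show "(\<Sum>b<D. A $$ (a,b) * (w $ b / of_real (sqrt N))) = of_real (Re e) * (w $ a / of_real (sqrt N))" if "a < D" for a
      using ev[OF that] e by (simp add: sum_divide_distrib[symmetric])
  qed
qed

lemma hermitian_spec_mat:
  assumes A: "A \<in> carrier_mat D D" "adj A = A"
  obtains m l u where "orthonormal D m u" "A = spec_mat D m l u"
proof -
  text \<open>Deflation: split off one rank-one eigenprojection at a time.\<close>
  have "\<exists>m l u. orthonormal D m u \<and> A = spec_mat D m l u"
    if "orthonormal D m u" "\<And>i a. i < m \<Longrightarrow> a < D \<Longrightarrow> (\<Sum>b<D. (A - spec_mat D m l u) $$ (a,b) * u i b) = 0" for m l u
    using that
  proof (induction "D - m" arbitrary: m l u rule: less_induct)
    case less
    define B where "B = A - spec_mat D m l u"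
    have B: "B \<in> carrier_mat D D" using A by (auto simp: B_def)
    have hB: "adj B = B"
    proof (rule eq_matI)
      fix i j assume "i < dim_row B" "j < dim_col B"
      then have ij: "i < D" "j < D" using B by auto
      have "cnj (A $$ (j,i)) = A $$ (i,j)" using hermitian_index[OF A(2,1) ij(2,1)] by simp
      moreover have "cnj (spec_mat D m l u $$ (j,i)) = spec_mat D m l u $$ (i,j)"
        using hermitian_index[OF spec_mat_adj spec_mat_carrier(1) ij(2,1), of m l u] by simp
      ultimately show "adj B $$ (i,j) = B $$ (i,j)" using ij A B by (simp add: B_def)
    qed (use B in auto)
    have Bz: "(\<Sum>b<D. B $$ (a,b) * u i b) = 0" if "i < m" "a < D" for i a
      using less(3) that by (simp add: B_def)
    show ?case
    proof (cases "B = 0\<^sub>m D D")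
      case True
      have "A = spec_mat D m l u"
      proof (rule eq_matI)
        fix i j assume "i < dim_row (spec_mat D m l u)" "j < dim_col (spec_mat D m l u)"
        then have ij: "i < D" "j < D" by auto
        have "B $$ (i,j) = 0" using True ij by simp
        then show "A $$ (i,j) = spec_mat D m l u $$ (i,j)" using ij A by (simp add: B_def)
      qed (use A in auto)
      then show ?thesis using less(2) by blast
    next
      case False
      obtain e v where ev: "e \<noteq> 0" "(\<Sum>a<D. v a * cnj (v a)) = 1"
        "\<And>a. a < D \<Longrightarrow> (\<Sum>b<D. B $$ (a,b) * v b) = of_real e * v a"
        using hermitian_unit_eigenvector[OF B hB False] by blast
      \<comment> \<open>The residual \<open>B\<close> is Hermitian and kills the earlier vectors, so
        moving it across the inner product gives \<open>e\<close> times the overlap equal to 0, and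
        \<open>e\<close> is nonzero.\<close>
      have orth: "(\<Sum>a<D. v a * cnj (u i a)) = 0" if i: "i < m" for i
      proof -
        have "of_real e * (\<Sum>a<D. v a * cnj (u i a)) = (\<Sum>a<D. (\<Sum>b<D. B $$ (a,b) * v b) * cnj (u i a))"
          using ev(3) by (simp add: sum_distrib_left mult.assoc)
        also have "\<dots> = (\<Sum>a<D. \<Sum>b<D. B $$ (a,b) * v b * cnj (u i a))" by (simp add: sum_distrib_right)
        also have "\<dots> = (\<Sum>b<D. \<Sum>a<D. B $$ (a,b) * v b * cnj (u i a))" by (rule sum.swap)
        also have "\<dots> = (\<Sum>b<D. v b * cnj (\<Sum>a<D. B $$ (b,a) * u i a))"
          unfolding cnj_sum sum_distrib_left
        proof (intro sum.cong refl)
          fix a b assume "a \<in> {..<D}" "b \<in> {..<D}"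
          then have "B $$ (a,b) = cnj (B $$ (b,a))" by (intro hermitian_index[OF hB B]) auto
          then show "B $$ (a,b) * v b * cnj (u i a) = v b * cnj (B $$ (b,a) * u i a)" by simp
        qed
        also have "\<dots> = 0" using Bz[OF i] by simp
        finally show ?thesis using ev(1) by simp
      qed
      have orth': "(\<Sum>a<D. u i a * cnj (v a)) = 0" if i: "i < m" for i
      proof -
        have "(\<Sum>a<D. u i a * cnj (v a)) = cnj (\<Sum>a<D. v a * cnj (u i a))" by (simp add: mult.commute)
        then show ?thesis using orth[OF i] by simp
      qed
      define u' where "u' = u(m := v)"
      define l' where "l' = l(m := e)"
      have on: "orthonormal D (Suc m) u'"
        using less(2) orth orth' ev(2) unfolding orthonormal_def u'_def
        by (auto simp: less_Suc_eq)
      have idx: "(A - spec_mat D (Suc m) l' u') $$ (a,b) = B $$ (a,b) - of_real e * v a * cnj (v b)"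
        if "a < D" "b < D" for a b
      proof -
        have "(\<Sum>i<m. of_real (l' i) * u' i a * cnj (u' i b)) = (\<Sum>i<m. of_real (l i) * u i a * cnj (u i b))"
          by (intro sum.cong) (auto simp: l'_def u'_def)
        then show ?thesis using that A by (simp add: B_def spec_mat_index) (simp add: l'_def u'_def)
      qed
      show ?thesis
      proof (rule less(1)[OF _ on])
        \<comment> \<open>Deflation terminates because an orthonormal family has at most
          \<open>D\<close> members.\<close>
        show "D - Suc m < D - m" using orthonormal_card[OF on] by simp
        fix i a assume i: "i < Suc m" and a: "a < D"
        have "(\<Sum>b<D. (A - spec_mat D (Suc m) l' u') $$ (a,b) * u' i b)
            = (\<Sum>b<D. B $$ (a,b) * u' i b - of_real e * v a * (u' i b * cnj (v b)))"
          by (intro sum.cong refl, subst idx) (use a in \<open>simp_all add: algebra_simps\<close>)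
        also have "\<dots> = (\<Sum>b<D. B $$ (a,b) * u' i b) - of_real e * v a * (\<Sum>b<D. u' i b * cnj (v b))"
          by (simp add: sum_subtractf sum_distrib_left)
        also have "\<dots> = 0"
          using i a ev Bz orth' by (cases "i = m") (auto simp: u'_def)
        finally show "(\<Sum>b<D. (A - spec_mat D (Suc m) l' u') $$ (a,b) * u' i b) = 0" .
      qed
    qed
  qed
  from this[of 0 "\<lambda>_ _. 0" "\<lambda>_. 0"] show ?thesis using that by (auto simp: orthonormal_def)
qed

section \<open>Square roots, trace norm and fidelity\<close>

lemma Cauchy_Schwarz_complex_sum:
  fixes f g :: "'a \<Rightarrow> complex"
  shows "cmod (\<Sum>x\<in>I. f x * g x) \<le> sqrt (\<Sum>x\<in>I. (cmod (f x))\<^sup>2) * sqrt (\<Sum>x\<in>I. (cmod (g x))\<^sup>2)"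
proof -
  have "cmod (\<Sum>x\<in>I. f x * g x) \<le> (\<Sum>x\<in>I. \<bar>cmod (f x)\<bar> * \<bar>cmod (g x)\<bar>)"
    by (rule order_trans[OF norm_sum]) (simp add: norm_mult)
  also have "\<dots> \<le> L2_set (\<lambda>x. cmod (f x)) I * L2_set (\<lambda>x. cmod (g x)) I" by (rule L2_set_mult_ineq)
  finally show ?thesis by (simp add: L2_set_def)
qed

lemma sum_rotate: "(\<Sum>a\<in>A. \<Sum>b\<in>B. \<Sum>c\<in>C. f a b c) = (\<Sum>c\<in>C. \<Sum>a\<in>A. \<Sum>b\<in>B. f a b c)"
proof -
  have "(\<Sum>a\<in>A. \<Sum>b\<in>B. \<Sum>c\<in>C. f a b c) = (\<Sum>a\<in>A. \<Sum>c\<in>C. \<Sum>b\<in>B. f a b c)"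
    by (rule sum.cong[OF refl], rule sum.swap)
  also have "\<dots> = (\<Sum>c\<in>C. \<Sum>a\<in>A. \<Sum>b\<in>B. f a b c)" by (rule sum.swap)
  finally show ?thesis .
qed

section \<open>Quadratic forms and positive semidefinite matrices\<close>

definition quad_form :: "nat \<Rightarrow> cmat \<Rightarrow> (nat \<Rightarrow> complex) \<Rightarrow> complex" where
  "quad_form D A f = (\<Sum>a<D. \<Sum>b<D. cnj (f a) * A $$ (a,b) * f b)"

lemma quad_form_vec:
  assumes "A \<in> carrier_mat D D" "v \<in> carrier_vec D"
  shows "(A *\<^sub>v v) \<bullet>c v = quad_form D A (\<lambda>a. v $ a)"
proof -
  have "(A *\<^sub>v v) \<bullet>c v = (\<Sum>a<D. (\<Sum>b<D. A $$ (a,b) * v $ b) * cnj (v $ a))"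
    using mat_vec_sum[OF assms] cscalar_prod_sum[OF assms(2)] by simp
  then show ?thesis unfolding quad_form_def by (simp add: sum_distrib_right sum_distrib_left mult_ac)
qed

lemma psd_iff:
  assumes "A \<in> carrier_mat D D"
  shows "psd A \<longleftrightarrow> (\<forall>f. quad_form D A f \<in> \<real> \<and> 0 \<le> Re (quad_form D A f))"
proof -
  have "quad_form D A f = quad_form D A (\<lambda>a. vec D f $ a)" for f
    by (simp add: quad_form_def)
  moreover have "dim_row A = D" using assms by auto
  ultimately show ?thesis unfolding psd_def using assms quad_form_vec[OF assms] vec_carrier[of D]
    by metis
qed

lemma psd_quad_form:
  assumes "psd A" "A \<in> carrier_mat D D"
  shows "quad_form D A f = of_real (Re (quad_form D A f))" "0 \<le> Re (quad_form D A f)"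
  using assms psd_iff[OF assms(2)] by (auto simp: complex_is_Real_iff complex_eq_iff)

text \<open>Polarization: the form is real at \<open>e_a + c * e_b\<close>, and the choices
  \<open>c = 0\<close>, \<open>c = 1\<close>, \<open>c = \<i>\<close> together with the vector
  \<open>e_b\<close> determine how the two off-diagonal entries are related.\<close>

lemma psd_hermitian:
  assumes "psd A" "A \<in> carrier_mat D D"
  shows "adj A = A"
proof (rule eq_matI)
  fix a b assume "a < dim_row A" "b < dim_col A"
  then have ab: "a < D" "b < D" using assms by auto
  have q: "A $$ (a,a) + c * A $$ (a,b) + cnj c * (A $$ (b,a) + c * A $$ (b,b)) \<in> \<real>" for c
  proof -
    let ?f = "\<lambda>i. (if i = a then 1 else 0) + c * (if i = b then 1 else 0)"
    have in': "(\<Sum>j<D. x * A $$ (i,j) * ?f j) = x * (A $$ (i,a) + c * A $$ (i,b))" for i x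
      using ab by (simp add: algebra_simps sum.distrib if_distrib[of "\<lambda>x. _ * x"] cong: if_cong)
    have "quad_form D A ?f = (\<Sum>i<D. cnj (?f i) * (A $$ (i,a) + c * A $$ (i,b)))"
      unfolding quad_form_def by (simp only: in')
    also have "\<dots> = A $$ (a,a) + c * A $$ (a,b) + cnj c * (A $$ (b,a) + c * A $$ (b,b))"
      using ab by (simp add: if_distrib[of cnj] ring_distribs sum.distrib if_distrib[of "\<lambda>x. x * _"]
        if_distrib[of "\<lambda>x. _ * x"] cong: if_cong)
    finally have "quad_form D A ?f = A $$ (a,a) + c * A $$ (a,b) + cnj c * (A $$ (b,a) + c * A $$ (b,b))" .
    moreover have "quad_form D A ?f \<in> \<real>" using psd_iff[OF assms(2)] assms(1) by blast
    ultimately show ?thesis by (simp only:)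
  qed
  have "Im (A $$ (a,a)) = 0" using q[of 0] by (simp add: complex_is_Real_iff)
  moreover have "Im (A $$ (b,b)) = 0"
  proof -
    have "quad_form D A (\<lambda>i. if i = b then 1 else 0) = A $$ (b,b)"
      using ab unfolding quad_form_def by (simp add: if_distrib[of "\<lambda>x. _ * x"] if_distrib[of cnj] cong: if_cong)
        (simp add: if_distrib[of "\<lambda>x. x * _"] cong: if_cong)
    moreover have "quad_form D A (\<lambda>i. if i = b then 1 else 0) \<in> \<real>" using psd_iff[OF assms(2)] assms(1) by blast
    ultimately show ?thesis by (simp add: complex_is_Real_iff)
  qed
  ultimately have "Im (A $$ (b,a)) = - Im (A $$ (a,b))" "Re (A $$ (b,a)) = Re (A $$ (a,b))"
    using q[of 1] q[of \<i>] by (simp_all add: complex_is_Real_iff)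
  then show "adj A $$ (a,b) = A $$ (a,b)" using ab assms by (simp add: complex_eq_iff)
qed (use assms in auto)

text \<open>For a sum of unnormalised pure states the form becomes a sum of squared overlaps.
  Positivity, the fidelity of a recovered state with a pure one and the outcome probabilities of
  \<open>code_Gamma\<close> are all read off from this.\<close>

lemma quad_form_gram:
  assumes "\<And>a b. a < D \<Longrightarrow> b < D \<Longrightarrow> A $$ (a,b) = (\<Sum>c\<in>I. g c a * cnj (g c b))"
  shows "quad_form D A f = of_real (\<Sum>c\<in>I. (cmod (\<Sum>a<D. cnj (f a) * g c a))\<^sup>2)"
proof -
  have "quad_form D A f = (\<Sum>a<D. \<Sum>b<D. \<Sum>c\<in>I. (cnj (f a) * g c a) * cnj (cnj (f b) * g c b))"
    unfolding quad_form_def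
    by (intro sum.cong refl) (auto simp: assms sum_distrib_left sum_distrib_right mult_ac)
  also have "\<dots> = (\<Sum>c\<in>I. \<Sum>a<D. \<Sum>b<D. (cnj (f a) * g c a) * cnj (cnj (f b) * g c b))"
    by (rule sum_rotate)
  also have "\<dots> = (\<Sum>c\<in>I. (\<Sum>a<D. cnj (f a) * g c a) * cnj (\<Sum>b<D. cnj (f b) * g c b))"
    by (simp only: cnj_sum sum_product)
  also have "\<dots> = of_real (\<Sum>c\<in>I. (cmod (\<Sum>a<D. cnj (f a) * g c a))\<^sup>2)"
    by (simp only: of_real_sum complex_norm_square)
  finally show ?thesis .
qed

lemma psd_gram:
  assumes "A \<in> carrier_mat D D"
    and "\<And>a b. a < D \<Longrightarrow> b < D \<Longrightarrow> A $$ (a,b) = (\<Sum>c\<in>I. g c a * cnj (g c b))"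
  shows "psd A"
  unfolding psd_iff[OF assms(1)] using quad_form_gram[where A=A and D=D and I=I and g=g, OF assms(2)]
  by (simp add: sum_nonneg)

lemma psd_spec_mat:
  assumes "\<And>i. i < m \<Longrightarrow> 0 \<le> l i"
  shows "psd (spec_mat D m l u)"
proof (rule psd_gram[where D=D and I="{..<m}" and g="\<lambda>i a. of_real (sqrt (l i)) * u i a"])
  fix a b assume ab: "a < D" "b < D"
  show "spec_mat D m l u $$ (a,b) = (\<Sum>c<m. of_real (sqrt (l c)) * u c a * cnj (of_real (sqrt (l c)) * u c b))"
    unfolding spec_mat_index[OF ab]
  proof (intro sum.cong refl)
    fix i assume "i \<in> {..<m}"
    then have "complex_of_real (l i) = of_real (sqrt (l i)) * of_real (sqrt (l i))"
      using assms by (simp flip: of_real_mult)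
    then show "of_real (l i) * u i a * cnj (u i b) = of_real (sqrt (l i)) * u i a * cnj (of_real (sqrt (l i)) * u i b)"
      by simp
  qed
qed simp

lemma quad_form_spec_mat:
  assumes "orthonormal D m u" "i < m"
  shows "quad_form D (spec_mat D m l u) (u i) = of_real (l i)"
proof -
  have "quad_form D (spec_mat D m l u) (u i) = (\<Sum>a<D. cnj (u i a) * (\<Sum>b<D. spec_mat D m l u $$ (a,b) * u i b))"
    unfolding quad_form_def by (simp add: sum_distrib_left mult_ac)
  also have "\<dots> = (\<Sum>a<D. of_real (l i) * (u i a * cnj (u i a)))"
    using orthonormal_spec_apply[OF assms] by (auto simp: mult_ac intro!: sum.cong)
  also have "\<dots> = of_real (l i)" using assms unfolding sum_distrib_left[symmetric] orthonormal_def by simp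
  finally show ?thesis .
qed

lemma psd_sqrt_exists:
  assumes "psd A" "A \<in> carrier_mat D D"
  shows "\<exists>B. psd B \<and> B \<in> carrier_mat D D \<and> B * B = A"
proof -
  obtain m l u where s: "orthonormal D m u" "A = spec_mat D m l u"
    using hermitian_spec_mat[OF assms(2) psd_hermitian[OF assms]] by blast
  have l: "0 \<le> l i" if "i < m" for i
    using psd_quad_form(2)[OF assms, of "u i"] quad_form_spec_mat[OF s(1) that] s(2) by simp
  have "spec_mat D m (\<lambda>i. sqrt (l i)) u * spec_mat D m (\<lambda>i. sqrt (l i)) u = A"
    unfolding spec_mat_mult[OF s(1)] s(2) using l by (auto simp: spec_mat_def intro!: sum.cong)
  moreover have "psd (spec_mat D m (\<lambda>i. sqrt (l i)) u)" using l by (intro psd_spec_mat) simp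
  ultimately show ?thesis using spec_mat_carrier(1) by blast
qed

text \<open>Let \<open>v\<close> be an eigenvector of \<open>B - C\<close> with eigenvalue
  \<open>l\<close>. Equal squares make \<open>B v\<close> and \<open>C v\<close> equally long;
  expanding \<open>B v = C v + l v\<close> then shows that, unless \<open>l = 0\<close>, the forms
  of \<open>B\<close> and \<open>C\<close> at \<open>v\<close> add up to 0. Both are nonnegative, so
  both vanish, although they differ by \<open>l\<close>.\<close>

lemma psd_sqrt_unique:
  assumes B: "psd B" "B \<in> carrier_mat D D" and C: "psd C" "C \<in> carrier_mat D D" and eq: "B * B = C * C"
  shows "B = C"
proof -
  have hB: "adj B = B" and hC: "adj C = C" using psd_hermitian B C by auto
  have "adj (B - C) = adj B - adj C" using B C by (intro eq_matI) auto
  then have h: "adj (B - C) = B - C" using hB hC by simp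
  have BC: "B - C \<in> carrier_mat D D" using B C by auto
  obtain m l u where s: "orthonormal D m u" "B - C = spec_mat D m l u"
    using hermitian_spec_mat[OF BC h] by blast
  have "l i = 0" if i: "i < m" for i
  proof (rule ccontr)
    assume nz: "l i \<noteq> 0"
    define v where "v = vec D (u i)"
    have v: "v \<in> carrier_vec D" by (simp add: v_def)
    have ev: "B *\<^sub>v v - C *\<^sub>v v = of_real (l i) \<cdot>\<^sub>v v"
    proof -
      have "(B - C) *\<^sub>v v = of_real (l i) \<cdot>\<^sub>v v"
      proof (rule eq_vecI)
        fix a assume "a < dim_vec (complex_of_real (l i) \<cdot>\<^sub>v v)"
        then have a: "a < D" by (simp add: v_def)
        show "((B - C) *\<^sub>v v) $ a = (of_real (l i) \<cdot>\<^sub>v v) $ a"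
          unfolding mat_vec_sum[OF BC v a]
          using orthonormal_spec_apply[OF s(1) i a, of l] a by (simp add: s(2)[symmetric] v_def)
      qed (use BC v in auto)
      then show ?thesis using minus_mult_distrib_mat_vec[OF B(2) C(2) v] by simp
    qed
    define qB where "qB = quad_form D B (u i)"
    define qC where "qC = quad_form D C (u i)"
    have qv: "quad_form D X (u i) = (X *\<^sub>v v) \<bullet>c v" if "X \<in> carrier_mat D D" for X
      unfolding quad_form_vec[OF that v] by (simp add: quad_form_def v_def)
    have mv: "((X * Y) *\<^sub>v v) \<bullet>c v = (Y *\<^sub>v v) \<bullet>c (X *\<^sub>v v)"
      if X: "X \<in> carrier_mat D D" "adj X = X" and Y: "Y \<in> carrier_mat D D" for X Y
    proof -
      have "((X * Y) *\<^sub>v v) \<bullet>c v = (X *\<^sub>v (Y *\<^sub>v v)) \<bullet>c v" using X Y v by simp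
      also have "\<dots> = (\<Sum>a<D. (\<Sum>b<D. X $$ (a,b) * (Y *\<^sub>v v) $ b) * cnj (v $ a))"
        using mat_vec_sum[OF X(1), of "Y *\<^sub>v v"] cscalar_prod_sum[OF v] Y v by simp
      also have "\<dots> = (\<Sum>a<D. \<Sum>b<D. (Y *\<^sub>v v) $ b * (X $$ (a,b) * cnj (v $ a)))"
        unfolding sum_distrib_right by (simp add: mult_ac)
      also have "\<dots> = (\<Sum>b<D. \<Sum>a<D. (Y *\<^sub>v v) $ b * (X $$ (a,b) * cnj (v $ a)))" by (rule sum.swap)
      also have "\<dots> = (\<Sum>b<D. (Y *\<^sub>v v) $ b * cnj (\<Sum>a<D. X $$ (b,a) * v $ a))"
        unfolding cnj_sum sum_distrib_left
      proof (intro sum.cong refl)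
        fix a b assume "a \<in> {..<D}" "b \<in> {..<D}"
        then have "X $$ (a,b) = cnj (X $$ (b,a))" by (intro hermitian_index[OF X(2,1)]) auto
        then show "(Y *\<^sub>v v) $ b * (X $$ (a,b) * cnj (v $ a)) = (Y *\<^sub>v v) $ b * cnj (X $$ (b,a) * v $ a)" by simp
      qed
      also have "\<dots> = (Y *\<^sub>v v) \<bullet>c (X *\<^sub>v v)"
        using mat_vec_sum[OF X(1) v] cscalar_prod_sum[of "X *\<^sub>v v" D] X v by simp
      finally show ?thesis .
    qed
    define w where "w = B *\<^sub>v v"
    define z where "z = C *\<^sub>v v"
    have wz: "w \<in> carrier_vec D" "z \<in> carrier_vec D" using B C v by (auto simp: w_def z_def)
    have e1: "w \<bullet>c w = z \<bullet>c z"
      using mv[OF B(2) hB B(2)] mv[OF C(2) hC C(2)] eq by (simp add: w_def z_def)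
    have wzv: "w = z + of_real (l i) \<cdot>\<^sub>v v"
    proof (rule eq_vecI)
      fix a assume "a < dim_vec (z + complex_of_real (l i) \<cdot>\<^sub>v v)"
      then have a: "a < D" using wz v by simp
      have "(w - z) $ a = (complex_of_real (l i) \<cdot>\<^sub>v v) $ a" using ev by (simp add: w_def z_def)
      then show "w $ a = (z + complex_of_real (l i) \<cdot>\<^sub>v v) $ a" using a wz v by (simp add: algebra_simps)
    qed (use wz v in auto)
    have qB': "qB = w \<bullet>c v" "qC = z \<bullet>c v" unfolding qB_def qC_def using qv B C by (auto simp: w_def z_def)
    have r: "qB = of_real (Re qB)" "0 \<le> Re qB" "qC = of_real (Re qC)" "0 \<le> Re qC"
      unfolding qB_def qC_def using psd_quad_form[OF B] psd_quad_form[OF C] by auto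
    have vv: "v \<bullet>c v = 1" using s(1) i cscalar_prod_sum[OF v, of v] by (simp add: orthonormal_def v_def)
    have d: "qB = qC + of_real (l i)"
      unfolding qB' wzv using wz v vv by (simp add: add_scalar_prod_distrib[of _ D])
    have vz: "v \<bullet>c z = cnj (z \<bullet>c v)"
      using cscalar_prod_sum[OF v] cscalar_prod_sum[OF wz(2)] by (simp add: mult.commute)
    have "w \<bullet>c w = z \<bullet>c z + of_real (l i) * (z \<bullet>c v) + of_real (l i) * (v \<bullet>c z) + of_real (l i) * of_real (l i) * (v \<bullet>c v)"
      unfolding wzv using wz v
      by (simp add: cscalar_prod_sum[of _ D] sum.distrib sum_distrib_left algebra_simps)
    then have "of_real (l i) * (qC + cnj qC + of_real (l i)) = 0"
      unfolding e1 vz vv qB'(2) by (simp add: algebra_simps)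
    then have "qC + cnj qC + of_real (l i) = 0" using nz by simp
    moreover have "Re qB = Re qC + l i" using d by simp
    ultimately have "Re qC + Re qB = 0" by (simp add: complex_eq_iff)
    then have "Re qC = 0" "Re qB = 0" using r by auto
    then show False using nz \<open>Re qB = Re qC + l i\<close> by simp
  qed
  then have "B - C = 0\<^sub>m D D" unfolding s(2) by (intro eq_matI) (auto simp: spec_mat_index)
  then have z: "(B - C) $$ (i,j) = 0" if "i < D" "j < D" for i j using that by simp
  show ?thesis using B C z by (intro eq_matI) auto
qed

lemma msqrt_eqI:
  assumes "psd B" "B \<in> carrier_mat D D" "B * B = A"
  shows "msqrt A = B"
proof -
  have A: "A \<in> carrier_mat D D" using assms by auto
  show ?thesis unfolding msqrt_def
  proof (rule the_equality)
    fix C assume C: "psd C \<and> dim_row C = dim_row A \<and> C * C = A"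
    then have "C \<in> carrier_mat D D" using A unfolding psd_def by auto
    then show "C = B" using psd_sqrt_unique C assms by metis
  qed (use assms A in auto)
qed

lemma msqrt_psd:
  assumes "psd A" "A \<in> carrier_mat D D"
  shows "psd (msqrt A)" "msqrt A \<in> carrier_mat D D" "msqrt A * msqrt A = A"
  using psd_sqrt_exists[OF assms] msqrt_eqI by metis+

lemma psd_adj_mult: "psd (adj A * A)"
proof -
  have c: "adj A \<in> carrier_mat (dim_col A) (dim_row A)" "A \<in> carrier_mat (dim_row A) (dim_col A)"
    by (rule carrier_matI; simp)+
  have "(adj A * A) $$ (a,b) = (\<Sum>c<dim_row A. cnj (A $$ (c,a)) * cnj (cnj (A $$ (c,b))))"
    if ab: "a < dim_col A" "b < dim_col A" for a b
    unfolding mat_mult_sum[OF c ab] using ab by (intro sum.cong refl) simp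
  with mult_carrier_mat[OF c] show ?thesis by (rule psd_gram)
qed

lemma psd_trace_nonneg:
  assumes "psd A" "A \<in> carrier_mat D D"
  shows "0 \<le> Re (mtrace A)"
proof -
  have "0 \<le> Re (A $$ (i,i))" if "i < D" for i
  proof -
    have "quad_form D A (\<lambda>j. if j = i then 1 else 0) = A $$ (i,i)"
      using that unfolding quad_form_def by (simp add: if_distrib[of "\<lambda>x. _ * x"] if_distrib[of cnj] cong: if_cong)
        (simp add: if_distrib[of "\<lambda>x. x * _"] cong: if_cong)
    then show ?thesis using psd_quad_form(2)[OF assms] by metis
  qed
  then show ?thesis unfolding mtrace_sum[OF assms(2)] by (auto intro!: sum_nonneg)
qed

section \<open>Trace norm of Hermitian matrices\<close>

lemma trace_norm_nonneg: "0 \<le> trace_norm A"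
proof -
  have c: "adj A * A \<in> carrier_mat (dim_col A) (dim_col A)" by (rule carrier_matI; simp)
  show ?thesis unfolding trace_norm_def
    using psd_trace_nonneg[OF msqrt_psd(1,2)[OF psd_adj_mult c]] .
qed

lemma trace_norm_spec_mat:
  assumes "orthonormal D m u"
  shows "trace_norm (spec_mat D m l u) = (\<Sum>i<m. \<bar>l i\<bar>)"
proof -
  have "msqrt (adj (spec_mat D m l u) * spec_mat D m l u) = spec_mat D m (\<lambda>i. \<bar>l i\<bar>) u"
    by (rule msqrt_eqI) (auto simp: psd_spec_mat spec_mat_mult[OF assms])
  then show ?thesis unfolding trace_norm_def by (simp add: spec_mat_trace[OF assms] flip: of_real_sum)
qed

text \<open>Each eigenvalue is the form at a vector whose entries have modulus at most 1, and there
  are at most \<open>D\<close> of them. The crude bound serves to make suprema of trace norms finite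
  and to evaluate the norm of the zero matrix.\<close>

lemma trace_norm_le_entries:
  assumes A: "A \<in> carrier_mat D D" "adj A = A"
  shows "trace_norm A \<le> real D * (\<Sum>a<D. \<Sum>b<D. cmod (A $$ (a,b)))"
proof -
  obtain m l u where s: "orthonormal D m u" "A = spec_mat D m l u"
    using hermitian_spec_mat[OF A] by blast
  define N where "N = (\<Sum>a<D. \<Sum>b<D. cmod (A $$ (a,b)))"
  have N0: "0 \<le> N" by (simp add: N_def sum_nonneg)
  have "\<bar>l i\<bar> \<le> N" if i: "i < m" for i
  proof -
    have "\<bar>l i\<bar> = cmod (quad_form D A (u i))" using quad_form_spec_mat[OF s(1) i] s(2) by simp
    also have "\<dots> \<le> (\<Sum>a<D. \<Sum>b<D. cmod (cnj (u i a) * A $$ (a,b) * u i b))"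
      unfolding quad_form_def by (intro order_trans[OF norm_sum] sum_mono order_refl)
    also have "\<dots> \<le> N" unfolding N_def
    proof (intro sum_mono)
      fix a b assume ab: "a \<in> {..<D}" "b \<in> {..<D}"
      have "cmod (u i a) * cmod (u i b) \<le> 1"
        using orthonormal_entry_le[OF s(1) i] ab by (intro mult_le_one) auto
      then have "cmod (A $$ (a,b)) * (cmod (u i a) * cmod (u i b)) \<le> cmod (A $$ (a,b)) * 1"
        by (intro mult_left_mono) auto
      then show "cmod (cnj (u i a) * A $$ (a,b) * u i b) \<le> cmod (A $$ (a,b))"
        by (simp add: norm_mult mult_ac)
    qed
    finally show ?thesis .
  qed
  then have "trace_norm A \<le> (\<Sum>i<m. N)"
    unfolding s(2) trace_norm_spec_mat[OF s(1)] by (intro sum_mono) auto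
  also have "\<dots> \<le> real D * N" using orthonormal_card[OF s(1)] N0 by (simp add: mult_right_mono)
  finally show ?thesis unfolding N_def .
qed

lemma unitary_norm_preserving:
  assumes "unitary D U"
  shows "(\<Sum>a<D. (cmod (\<Sum>b<D. U $$ (a,b) * f b))\<^sup>2) = (\<Sum>b<D. (cmod (f b))\<^sup>2)"
proof -
  have U: "U \<in> carrier_mat D D" "adj U * U = 1\<^sub>m D" using assms by (auto simp: unitary_def)
  have "complex_of_real (\<Sum>a<D. (cmod (\<Sum>b<D. U $$ (a,b) * f b))\<^sup>2)
      = (\<Sum>a<D. (\<Sum>b<D. U $$ (a,b) * f b) * cnj (\<Sum>c<D. U $$ (a,c) * f c))"
    by (simp only: of_real_sum complex_norm_square)
  also have "\<dots> = (\<Sum>a<D. \<Sum>b<D. \<Sum>c<D. f b * cnj (f c) * (adj U $$ (c,a) * U $$ (a,b)))"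
    unfolding cnj_sum sum_product using U by (intro sum.cong refl) (auto simp: mult_ac)
  also have "\<dots> = (\<Sum>b<D. \<Sum>c<D. \<Sum>a<D. f b * cnj (f c) * (adj U $$ (c,a) * U $$ (a,b)))"
    by (rule sum_rotate[symmetric])
  also have "\<dots> = (\<Sum>b<D. \<Sum>c<D. f b * cnj (f c) * (1\<^sub>m D $$ (c,b)))"
    unfolding U(2)[symmetric] sum_distrib_left[symmetric]
    using mat_mult_sum[of "adj U" D D U D] U by (intro sum.cong refl) auto
  also have "\<dots> = (\<Sum>b<D. f b * cnj (f b))"
    by (intro sum.cong refl) (simp add: if_distrib[of "\<lambda>x. _ * x"] cong: if_cong)
  also have "\<dots> = of_real (\<Sum>b<D. (cmod (f b))\<^sup>2)" by (simp only: of_real_sum complex_norm_square)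
  finally show ?thesis by (simp only: of_real_eq_iff)
qed

text \<open>One half of trace-norm duality: in an eigenbasis the trace is the sum of eigenvalues
  times overlaps of \<open>u i\<close> with \<open>G (u i)\<close>, each of modulus at most 1 by
  Cauchy-Schwarz. Closeness of states thus bounds differences of expectations.\<close>

lemma trace_mult_unitary_le:
  assumes A: "A \<in> carrier_mat D D" "adj A = A" and G: "unitary D G"
  shows "cmod (mtrace (A * G)) \<le> trace_norm A"
proof -
  have Gc: "G \<in> carrier_mat D D" using G by (auto simp: unitary_def)
  obtain m l u where s: "orthonormal D m u" "A = spec_mat D m l u"
    using hermitian_spec_mat[OF A] by blast
  have "mtrace (A * G) = (\<Sum>a<D. \<Sum>b<D. \<Sum>i<m. of_real (l i) * (cnj (u i b) * G $$ (b,a) * u i a))"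
    unfolding mtrace_mult[OF A(1) Gc] unfolding s(2)
    by (intro sum.cong refl) (auto simp: spec_mat_index sum_distrib_left sum_distrib_right mult_ac)
  also have "\<dots> = (\<Sum>i<m. \<Sum>a<D. \<Sum>b<D. of_real (l i) * (cnj (u i b) * G $$ (b,a) * u i a))"
    by (rule sum_rotate)
  also have "\<dots> = (\<Sum>i<m. of_real (l i) * quad_form D G (u i))"
    unfolding quad_form_def sum_distrib_left by (rule sum.cong[OF refl], rule sum.swap)
  finally have "cmod (mtrace (A * G)) \<le> (\<Sum>i<m. cmod (of_real (l i) * quad_form D G (u i)))"
    by (simp only: norm_sum)
  also have "\<dots> \<le> (\<Sum>i<m. \<bar>l i\<bar>)"
  proof (intro sum_mono)
    fix i assume "i \<in> {..<m}"
    then have i: "i < m" by simp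
    have "complex_of_real (\<Sum>a<D. (cmod (u i a))\<^sup>2) = 1"
      using s(1) i unfolding of_real_sum complex_norm_square orthonormal_def by simp
    then have one: "(\<Sum>a<D. (cmod (u i a))\<^sup>2) = 1" by (simp only: of_real_eq_1_iff)
    have "cmod (quad_form D G (u i)) = cmod (\<Sum>a<D. cnj (u i a) * (\<Sum>b<D. G $$ (a,b) * u i b))"
      unfolding quad_form_def by (simp add: sum_distrib_left mult_ac)
    also have "\<dots> \<le> sqrt (\<Sum>a<D. (cmod (cnj (u i a)))\<^sup>2) * sqrt (\<Sum>a<D. (cmod (\<Sum>b<D. G $$ (a,b) * u i b))\<^sup>2)"
      by (rule Cauchy_Schwarz_complex_sum)
    also have "\<dots> = 1" unfolding unitary_norm_preserving[OF G] by (simp add: one)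
    finally have "\<bar>l i\<bar> * cmod (quad_form D G (u i)) \<le> \<bar>l i\<bar> * 1" by (intro mult_left_mono) auto
    then show "cmod (of_real (l i) * quad_form D G (u i)) \<le> \<bar>l i\<bar>" by (simp add: norm_mult)
  qed
  finally show ?thesis unfolding s(2) trace_norm_spec_mat[OF s(1)] .
qed

section \<open>Rank-one projections and the fidelity with a pure state\<close>

lemma outer_carrier [simp]: "v \<in> carrier_vec D \<Longrightarrow> outer v \<in> carrier_mat D D"
  by (auto simp: outer_def)

lemma outer_index [simp]: "a < dim_vec v \<Longrightarrow> b < dim_vec v \<Longrightarrow> outer v $$ (a,b) = v $ a * cnj (v $ b)"
  by (auto simp: outer_def)

lemma outer_hermitian [simp]: "adj (outer v) = outer v"
  by (rule eq_matI) (auto simp: outer_def)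

lemma psd_outer: "psd (outer v)"
  by (rule psd_gram[where D="dim_vec v" and I="{()}" and g="\<lambda>_ a. v $ a"]) (auto simp: outer_def)

text \<open>A projection \<open>P = outer v\<close> is its own root, so the trace norm is the trace
  of the root of \<open>P * S * P\<close>. That product is \<open>q\<close> times \<open>P\<close>,
  with root \<open>sqrt q\<close> times \<open>P\<close>.\<close>

lemma fidelity_pure:
  assumes S: "psd S" "S \<in> carrier_mat D D" and v: "v \<in> carrier_vec D" "v \<bullet>c v = 1"
  shows "fidelity S (outer v) = sqrt (Re (quad_form D S (\<lambda>a. v $ a)))"
proof -
  define q where "q = Re (quad_form D S (\<lambda>a. v $ a))"
  have q: "quad_form D S (\<lambda>a. v $ a) = of_real q" "0 \<le> q"
    using psd_quad_form[OF S] by (auto simp: q_def)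
  have vv: "(\<Sum>a<D. v $ a * cnj (v $ a)) = 1" using v cscalar_prod_sum[OF v(1)] by simp
  define P where "P = outer v"
  have P: "P \<in> carrier_mat D D" "adj P = P" "psd P" using v psd_outer by (auto simp: P_def)
  have Pi: "P $$ (a,b) = v $ a * cnj (v $ b)" if "a < D" "b < D" for a b
    using that v by (auto simp: P_def)
  have PP: "P * P = P"
  proof (rule eq_matI)
    fix a b assume "a < dim_row P" "b < dim_col P"
    then have ab: "a < D" "b < D" using P by auto
    have "(P * P) $$ (a,b) = (\<Sum>c<D. (v $ a * cnj (v $ b)) * (v $ c * cnj (v $ c)))"
      unfolding mat_mult_sum[OF P(1,1) ab] using ab by (intro sum.cong refl) (auto simp: Pi)
    then show "(P * P) $$ (a,b) = P $$ (a,b)" unfolding sum_distrib_left[symmetric] vv using ab Pi by simp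
  qed (use P in auto)
  have sP: "msqrt P = P" using msqrt_eqI[OF P(3,1) PP] .
  note R = msqrt_psd[OF S]
  have hR: "adj (msqrt S) = msqrt S" using psd_hermitian[OF R(1,2)] .
  have PSP: "P * S * P = of_real q \<cdot>\<^sub>m P"
  proof (rule eq_matI)
    fix a b assume "a < dim_row (complex_of_real q \<cdot>\<^sub>m P)" "b < dim_col (complex_of_real q \<cdot>\<^sub>m P)"
    then have ab: "a < D" "b < D" using P by auto
    have PS: "P * S \<in> carrier_mat D D" using P S by auto
    have "(P * S * P) $$ (a,b) = (\<Sum>d<D. (\<Sum>c<D. P $$ (a,c) * S $$ (c,d)) * P $$ (d,b))"
      unfolding mat_mult_sum[OF PS P(1) ab] using ab mat_mult_sum[OF P(1) S(2)]
      by (intro sum.cong refl) auto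
    also have "\<dots> = (\<Sum>d<D. \<Sum>c<D. (v $ a * cnj (v $ b)) * (cnj (v $ c) * S $$ (c,d) * v $ d))"
      unfolding sum_distrib_right using ab by (intro sum.cong refl) (auto simp: Pi mult_ac)
    also have "\<dots> = (v $ a * cnj (v $ b)) * quad_form D S (\<lambda>a. v $ a)"
      unfolding quad_form_def sum_distrib_left by (rule sum.swap)
    finally show "(P * S * P) $$ (a,b) = (of_real q \<cdot>\<^sub>m P) $$ (a,b)"
      using q(1) ab Pi P by simp
  qed (use P S in auto)
  define X where "X = msqrt S * P"
  have "adj X * X = P * msqrt S * (msqrt S * P)" unfolding X_def
    using adj_mult[OF R(2) P(1)] hR P(2) by simp
  also have "\<dots> = P * (msqrt S * msqrt S) * P" using P R(2) by (simp add: assoc_mult_mat[of _ D D _ D _ D])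
  finally have XX: "adj X * X = of_real q \<cdot>\<^sub>m P" using R(3) PSP by simp
  have "msqrt (adj X * X) = of_real (sqrt q) \<cdot>\<^sub>m P"
  proof (rule msqrt_eqI[of _ D])
    show "complex_of_real (sqrt q) \<cdot>\<^sub>m P \<in> carrier_mat D D" using P by auto
    have "complex_of_real (sqrt q) * complex_of_real (sqrt q) = of_real q"
      using q(2) by (simp flip: of_real_mult)
    then show "complex_of_real (sqrt q) \<cdot>\<^sub>m P * (complex_of_real (sqrt q) \<cdot>\<^sub>m P) = adj X * X"
      unfolding XX using P PP
      by (simp add: mult_smult_assoc_mat[of _ D D _ D] mult_smult_distrib[of _ D D _ D])
        (intro eq_matI, auto simp: mult.assoc[symmetric])
    \<comment> \<open>The fourth root of \<open>q\<close> appears because the claimed root is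
      written as the rank-one Gram matrix of a rescaled \<open>v\<close>.\<close>
    show "psd (complex_of_real (sqrt q) \<cdot>\<^sub>m P)"
    proof (rule psd_gram[where D=D and I="{()}" and g="\<lambda>_ a. of_real (sqrt (sqrt q)) * v $ a"])
      fix a b assume ab: "a < D" "b < D"
      have "complex_of_real (sqrt q) = of_real (sqrt (sqrt q)) * of_real (sqrt (sqrt q))"
        using q(2) by (simp flip: of_real_mult)
      then show "(complex_of_real (sqrt q) \<cdot>\<^sub>m P) $$ (a,b)
        = (\<Sum>c\<in>{()}. of_real (sqrt (sqrt q)) * v $ a * cnj (of_real (sqrt (sqrt q)) * v $ b))"
        using ab P Pi by simp
    qed (use P in auto)
  qed
  moreover have "mtrace (complex_of_real (sqrt q) \<cdot>\<^sub>m P) = of_real (sqrt q)"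
  proof -
    have "mtrace (complex_of_real (sqrt q) \<cdot>\<^sub>m P) = (\<Sum>a<D. of_real (sqrt q) * (v $ a * cnj (v $ a)))"
      unfolding mtrace_def using P Pi by (intro sum.cong) auto
    then show ?thesis unfolding sum_distrib_left[symmetric] vv by simp
  qed
  ultimately show ?thesis unfolding fidelity_def trace_norm_def P_def[symmetric] sP X_def[symmetric] q_def[symmetric]
    by simp
qed

section \<open>Bits of basis indices and two-qubit gates\<close>

lemma bitq_bit: "bitq a q = of_bool (bit a q)"
  by (simp add: bitq_def bit_iff_odd mod_2_eq_odd)

lemma bitq_eq_iff: "bitq a q = bitq b p \<longleftrightarrow> bit a q = bit b p"
  by (simp add: bitq_bit of_bool_eq_iff)

lemma less_two_power_iff: "a < 2 ^ n \<longleftrightarrow> (\<forall>q\<ge>n. \<not> bit a q)" for a :: nat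
proof -
  have "a < 2 ^ n \<longleftrightarrow> take_bit n a = a" by (rule take_bit_nat_eq_self_iff[symmetric])
  also have "\<dots> \<longleftrightarrow> (\<forall>q\<ge>n. \<not> bit a q)"
  proof
    assume "take_bit n a = a"
    then show "\<forall>q\<ge>n. \<not> bit a q" using bit_take_bit_iff[of n a] by (metis not_le)
  next
    assume "\<forall>q\<ge>n. \<not> bit a q"
    then show "take_bit n a = a" by (intro bit_eqI) (metis bit_take_bit_iff not_le)
  qed
  finally show ?thesis .
qed

lemma nat_eq_bitsI: "a < 2 ^ n \<Longrightarrow> b < 2 ^ n \<Longrightarrow> (\<And>q. q < n \<Longrightarrow> bit a q = bit b q) \<Longrightarrow> a = b" for a b :: nat
  unfolding less_two_power_iff by (rule bit_eqI) (metis not_le)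

lemma bit_flip_nat [simp]: "bit (flip_bit q a) p \<longleftrightarrow> (if p = q then \<not> bit a p else bit a p)" for a :: nat
  by (auto simp: bit_flip_bit_iff)

lemma flip_less: "q < n \<Longrightarrow> a < 2 ^ n \<Longrightarrow> flip_bit q a < 2 ^ n" for a :: nat
  unfolding less_two_power_iff by auto

lemma flip_flip [simp]: "flip_bit q (flip_bit q a) = a" for a :: nat
  by (rule bit_eqI) auto

lemma sum_flip:
  assumes "q < n"
  shows "(\<Sum>a<2^n. f (flip_bit q a)) = (\<Sum>a<(2::nat)^n. f a)"
  by (rule sum.reindex_bij_witness[of _ "flip_bit q" "flip_bit q"]) (use flip_less[OF assms] in auto)

text \<open>The weight of a position counts the smaller positions in the set, so adding a largest
  one leaves the other weights alone. This is why the inductions below insert maxima.\<close>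

lemma sub_idx_insert_max:
  assumes "finite A" "\<And>q. q \<in> A \<Longrightarrow> q < b"
  shows "sub_idx (insert b A) a = sub_idx A a + of_bool (bit a b) * 2 ^ card A"
proof -
  have b: "b \<notin> A" using assms(2) by blast
  have "{p \<in> insert b A. p < b} = A" using assms(2) by auto
  moreover have "{p \<in> insert b A. p < q} = {p \<in> A. p < q}" if "q \<in> A" for q using assms(2)[OF that] by auto
  ultimately show ?thesis unfolding sub_idx_def using assms(1) b
    by (simp add: bitq_bit)
qed

lemma sub_idx_less:
  assumes "finite S" shows "sub_idx S a < 2 ^ card S"
  using assms
proof (induction rule: finite_linorder_max_induct)
  case empty
  then show ?case by (simp add: sub_idx_def)
next
  case (insert b A)
  moreover from this have "b \<notin> A" by blast
  ultimately show ?case by (simp add: sub_idx_insert_max)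
qed

lemma sub_idx_eq_iff:
  assumes "finite S"
  shows "sub_idx S a = sub_idx S a' \<longleftrightarrow> (\<forall>q\<in>S. bit a q = bit a' q)"
  using assms
proof (induction rule: finite_linorder_max_induct)
  case empty
  then show ?case by (simp add: sub_idx_def)
next
  case (insert b A)
  have "sub_idx A a < 2 ^ card A" "sub_idx A a' < 2 ^ card A" using sub_idx_less[OF insert(1)] by auto
  then have "sub_idx A a + of_bool (bit a b) * 2 ^ card A = sub_idx A a' + of_bool (bit a' b) * 2 ^ card A
      \<longleftrightarrow> sub_idx A a = sub_idx A a' \<and> bit a b = bit a' b"
    by (cases "bit a b"; cases "bit a' b") auto
  then show ?case using insert by (auto simp: sub_idx_insert_max)
qed

text \<open>The tensor splitting of the basis into the register on \<open>S\<close> and the rest: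
  bits on both sides determine the index, and the counts agree.\<close>

lemma sub_idx_bij:
  assumes S: "S \<subseteq> {0..<n}"
  shows "bij_betw (\<lambda>a. (sub_idx S a, sub_idx ({0..<n} - S) a)) {..<2^n}
     ({..<2 ^ card S} \<times> {..<2 ^ card ({0..<n} - S)})"
proof -
  let ?T = "{0..<n} - S" and ?h = "\<lambda>a. (sub_idx S a, sub_idx ({0..<n} - S) a)"
  have f: "finite S" "finite ?T" using S finite_subset by auto
  have inj: "inj_on ?h {..<2^n}"
  proof (rule inj_onI)
    fix a b :: nat assume ab: "a \<in> {..<2^n}" "b \<in> {..<2^n}" "?h a = ?h b"
    then have "bit a q = bit b q" if "q < n" for q
      using sub_idx_eq_iff[OF f(1), of a b] sub_idx_eq_iff[OF f(2), of a b] that by auto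
    with ab show "a = b" by (intro nat_eq_bitsI[of a n b]) auto
  qed
  have "card S + card ?T = n"
    using card_Diff_subset[OF f(1) S] card_mono[OF _ S] by simp
  then have c: "card ({..<(2::nat) ^ card S} \<times> {..<(2::nat) ^ card ?T}) = 2 ^ n"
    by (simp add: card_cartesian_product power_add[symmetric])
  have "?h ` {..<2^n} = {..<2 ^ card S} \<times> {..<2 ^ card ?T}"
  proof (rule card_subset_eq)
    show "?h ` {..<2^n} \<subseteq> {..<2 ^ card S} \<times> {..<2 ^ card ?T}"
      using sub_idx_less[OF f(1)] sub_idx_less[OF f(2)] by auto
    show "card (?h ` {..<2^n}) = card ({..<(2::nat) ^ card S} \<times> {..<(2::nat) ^ card ?T})"
      unfolding c card_image[OF inj] by simp
  qed simp
  with inj show ?thesis by (simp add: bij_betw_def)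
qed

lemma sum_sub_idx:
  assumes "S \<subseteq> {0..<n}"
  shows "(\<Sum>a<2^n. f (sub_idx S a) (sub_idx ({0..<n} - S) a))
    = (\<Sum>x<2 ^ card S. \<Sum>y<2 ^ card ({0..<n} - S). f x y)"
  using sum.reindex_bij_betw[OF sub_idx_bij[OF assms], of "\<lambda>(x,y). f x y"]
  by (simp add: sum.cartesian_product)

lemma sub_idx_obtain:
  assumes "S \<subseteq> {0..<n}" "x < 2 ^ card S" "y < 2 ^ card ({0..<n} - S)"
  obtains a where "a < 2^n" "sub_idx S a = x" "sub_idx ({0..<n} - S) a = y"
proof -
  have "(x,y) \<in> (\<lambda>a. (sub_idx S a, sub_idx ({0..<n} - S) a)) ` {..<2^n}"
    using sub_idx_bij[OF assms(1)] assms(2,3) by (simp add: bij_betw_def)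
  then show ?thesis using that by auto
qed

text \<open>\<open>x\<close> ranges over the gate indices 0 to 3 with qubit \<open>i\<close> as the
  high bit, the convention of the row index in \<open>gate_on\<close>.\<close>

definition put2 :: "nat \<Rightarrow> nat \<Rightarrow> nat \<Rightarrow> nat \<Rightarrow> nat" where
  "put2 i j a x = (if x \<ge> 2 then set_bit i else unset_bit i) ((if odd x then set_bit j else unset_bit j) a)"

lemma bit_put2: "i \<noteq> j \<Longrightarrow> bit (put2 i j a x) q \<longleftrightarrow> (if q = i then x \<ge> 2 else if q = j then odd x else bit a q)"
  by (auto simp: put2_def bit_set_bit_iff bit_unset_bit_iff)

lemma put2_less: "i \<noteq> j \<Longrightarrow> i < n \<Longrightarrow> j < n \<Longrightarrow> a < 2^n \<Longrightarrow> put2 i j a x < 2^n"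
  unfolding less_two_power_iff by (auto simp: bit_put2)

abbreviation pair_idx :: "nat \<Rightarrow> nat \<Rightarrow> nat \<Rightarrow> nat" where
  "pair_idx i j a \<equiv> 2 * bitq a i + bitq a j"

lemma nat_less_four_cases: "x < 4 \<Longrightarrow> x = 0 \<or> x = 1 \<or> x = 2 \<or> x = (3::nat)" by auto

lemma pair_idx_put2: "i \<noteq> j \<Longrightarrow> x < 4 \<Longrightarrow> pair_idx i j (put2 i j a x) = x"
  by (drule nat_less_four_cases) (auto simp: bitq_bit bit_put2)

lemma pair_idx_less: "pair_idx i j a < 4"
  by (auto simp: bitq_bit)

lemma pair_idx_eq_iff: "pair_idx i j a = pair_idx i j b \<longleftrightarrow> bit a i = bit b i \<and> bit a j = bit b j"
  by (auto simp: bitq_bit of_bool_def)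

text \<open>Sparsity of a gate: an index that agrees with \<open>a\<close> off the two qubits is
  fixed by their bits, which leaves four candidates.\<close>

lemma sum_agree_off_pair:
  assumes ij: "i < n" "j < n" "i \<noteq> j" and a: "a < 2^n"
  shows "(\<Sum>c<2^n. if \<forall>q<n. q \<noteq> i \<and> q \<noteq> j \<longrightarrow> bitq a q = bitq c q then f c else 0) = (\<Sum>x<4. f (put2 i j a x))"
proof -
  let ?P = "\<lambda>c. \<forall>q<n. q \<noteq> i \<and> q \<noteq> j \<longrightarrow> bitq a q = bitq c q"
  have "(\<Sum>c<2^n. if ?P c then f c else 0) = (\<Sum>c\<in>{c. c < 2^n \<and> ?P c}. f c)"
    by (subst sum.inter_filter[symmetric]) auto
  also have "\<dots> = (\<Sum>x<4. f (put2 i j a x))"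
  proof (rule sum.reindex_bij_witness[of _ "put2 i j a" "pair_idx i j"])
    fix c assume "c \<in> {c. c < 2^n \<and> ?P c}"
    then have c: "c < 2^n" "\<And>q. q < n \<Longrightarrow> q \<noteq> i \<Longrightarrow> q \<noteq> j \<Longrightarrow> bit a q = bit c q"
      by (auto simp: bitq_eq_iff)
    show "put2 i j a (pair_idx i j c) = c"
      by (rule nat_eq_bitsI[OF put2_less[OF ij(3,1,2) a] c(1)])
        (use c(2) ij in \<open>auto simp: bit_put2 bitq_bit\<close>)
    then show "f (put2 i j a (pair_idx i j c)) = f c" by simp
    show "pair_idx i j c \<in> {..<4}" using pair_idx_less by auto
  next
    fix x :: nat assume x: "x \<in> {..<4}"
    then show "pair_idx i j (put2 i j a x) = x" using pair_idx_put2[OF ij(3)] by auto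
    show "put2 i j a x \<in> {c. c < 2^n \<and> ?P c}"
      using put2_less[OF ij(3,1,2) a] ij by (auto simp: bitq_eq_iff bit_put2)
  qed
  finally show ?thesis .
qed

section \<open>Matrix algebra of two-qubit gates\<close>

lemma gate_on_carrier [simp]: "gate_on n i j U \<in> carrier_mat (2^n) (2^n)"
  "dim_row (gate_on n i j U) = 2^n" "dim_col (gate_on n i j U) = 2^n"
  by (auto simp: gate_on_def)

lemma gate_on_index: "a < 2^n \<Longrightarrow> b < 2^n \<Longrightarrow> gate_on n i j U $$ (a,b) =
    (if \<forall>q<n. q \<noteq> i \<and> q \<noteq> j \<longrightarrow> bitq a q = bitq b q then U $$ (pair_idx i j a, pair_idx i j b) else 0)"
  by (simp add: gate_on_def)

lemma gate_on_mult_vec: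
  assumes ij: "i < n" "j < n" "i \<noteq> j" and a: "a < 2^n" and v: "v \<in> carrier_vec (2^n)"
  shows "(gate_on n i j U *\<^sub>v v) $ a = (\<Sum>x<4. U $$ (pair_idx i j a, x) * v $ (put2 i j a x))"
proof -
  have "(gate_on n i j U *\<^sub>v v) $ a = (\<Sum>c<2^n. if \<forall>q<n. q \<noteq> i \<and> q \<noteq> j \<longrightarrow> bitq a q = bitq c q
      then U $$ (pair_idx i j a, pair_idx i j c) * v $ c else 0)"
    unfolding mat_vec_sum[OF gate_on_carrier(1) v a] using a
    by (intro sum.cong refl) (auto simp: gate_on_index)
  also have "\<dots> = (\<Sum>x<4. U $$ (pair_idx i j a, x) * v $ (put2 i j a x))"
    unfolding sum_agree_off_pair[OF ij a]
    by (intro sum.cong refl) (use pair_idx_put2[OF ij(3)] in simp)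
  finally show ?thesis .
qed

lemma gate_on_mult:
  assumes ij: "i < n" "j < n" "i \<noteq> j" and U: "U \<in> carrier_mat 4 4" and W: "W \<in> carrier_mat 4 4"
  shows "gate_on n i j U * gate_on n i j W = gate_on n i j (U * W)"
proof (rule eq_matI)
  fix a b assume "a < dim_row (gate_on n i j (U * W))" "b < dim_col (gate_on n i j (U * W))"
  then have a: "a < 2^n" and b: "b < 2^n" by auto
  let ?P = "\<lambda>a b. \<forall>q<n. q \<noteq> i \<and> q \<noteq> j \<longrightarrow> bitq a q = bitq b q"
  have "(gate_on n i j U * gate_on n i j W) $$ (a,b) = (\<Sum>c<2^n. if ?P a c
      then U $$ (pair_idx i j a, pair_idx i j c) * gate_on n i j W $$ (c,b) else 0)"
    unfolding mat_mult_sum[OF gate_on_carrier(1) gate_on_carrier(1) a b] using a b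
    by (intro sum.cong refl) (auto simp: gate_on_index)
  also have "\<dots> = (\<Sum>x<4. U $$ (pair_idx i j a, x) * gate_on n i j W $$ (put2 i j a x, b))"
    unfolding sum_agree_off_pair[OF ij a]
    by (intro sum.cong refl) (use pair_idx_put2[OF ij(3)] in simp)
  also have "\<dots> = (\<Sum>x<4. U $$ (pair_idx i j a, x) * (if ?P a b then W $$ (x, pair_idx i j b) else 0))"
  proof (intro sum.cong refl)
    fix x :: nat assume "x \<in> {..<4}"
    then have x: "pair_idx i j (put2 i j a x) = x" using pair_idx_put2[OF ij(3)] by auto
    have "?P (put2 i j a x) b = ?P a b" using ij by (auto simp: bitq_eq_iff bit_put2)
    then show "U $$ (pair_idx i j a, x) * gate_on n i j W $$ (put2 i j a x, b)
      = U $$ (pair_idx i j a, x) * (if ?P a b then W $$ (x, pair_idx i j b) else 0)"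
      unfolding gate_on_index[OF put2_less[OF ij(3,1,2) a] b] x by simp
  qed
  also have "\<dots> = gate_on n i j (U * W) $$ (a,b)"
  proof (cases "?P a b")
    case True
    then have e: "?P a b = True" by (rule eqTrueI)
    show ?thesis unfolding gate_on_index[OF a b] mat_mult_sum[OF U W pair_idx_less pair_idx_less] e if_True ..
  next
    case False
    then have e: "?P a b = False" by simp
    show ?thesis unfolding gate_on_index[OF a b] mat_mult_sum[OF U W pair_idx_less pair_idx_less] e if_False by simp
  qed
  finally show "(gate_on n i j U * gate_on n i j W) $$ (a,b) = gate_on n i j (U * W) $$ (a,b)" .
qed auto

lemma gate_on_adj:
  assumes U: "U \<in> carrier_mat 4 4"
  shows "adj (gate_on n i j U) = gate_on n i j (adj U)"
proof (rule eq_matI)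
  fix a b assume "a < dim_row (gate_on n i j (adj U))" "b < dim_col (gate_on n i j (adj U))"
  then have ab: "a < 2^n" "b < 2^n" by auto
  have "adj U $$ (pair_idx i j a, pair_idx i j b) = cnj (U $$ (pair_idx i j b, pair_idx i j a))"
    using adj_index pair_idx_less U by (metis carrier_matD)
  moreover have "(\<forall>q<n. q \<noteq> i \<and> q \<noteq> j \<longrightarrow> bitq a q = bitq b q) \<longleftrightarrow> (\<forall>q<n. q \<noteq> i \<and> q \<noteq> j \<longrightarrow> bitq b q = bitq a q)"
    by auto
  ultimately show "adj (gate_on n i j U) $$ (a,b) = gate_on n i j (adj U) $$ (a,b)"
    using ab by (auto simp: gate_on_index)
qed auto

lemma gate_on_one:
  assumes ij: "i < n" "j < n" "i \<noteq> j"
  shows "gate_on n i j (1\<^sub>m 4) = 1\<^sub>m (2^n)"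
proof (rule eq_matI)
  fix a b assume "a < dim_row (1\<^sub>m (2^n))" "b < dim_col (1\<^sub>m (2^n))"
  then have ab: "a < 2^n" "b < 2^n" by auto
  have "a = b" if "\<forall>q<n. q \<noteq> i \<and> q \<noteq> j \<longrightarrow> bitq a q = bitq b q" "pair_idx i j a = pair_idx i j b"
    by (rule nat_eq_bitsI[OF ab]) (use that pair_idx_eq_iff in \<open>auto simp: bitq_eq_iff\<close>)
  then show "gate_on n i j (1\<^sub>m 4) $$ (a,b) = 1\<^sub>m (2^n) $$ (a,b)"
    using ab pair_idx_less by (auto simp: gate_on_index)
qed auto

lemma gate_on_unitary:
  assumes ij: "i < n" "j < n" "i \<noteq> j" and U: "unitary 4 U"
  shows "unitary (2^n) (gate_on n i j U)"
proof -
  have c: "U \<in> carrier_mat 4 4" "adj U * U = 1\<^sub>m 4" using U by (auto simp: unitary_def)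
  show ?thesis unfolding unitary_def gate_on_adj[OF c(1)]
    using gate_on_mult[OF ij adj_carrier[OF c(1)] c(1)] gate_on_one[OF ij] c(2) by simp
qed

section \<open>Locality and light cones\<close>

text \<open>An entrywise form of "\<open>g\<close> on \<open>S\<close> tensored with the identity":
  diagonal in every outside bit and independent of its value. Conditions on one bit at a time pass
  easily through products; the factor \<open>g\<close> is recovered in
  \<open>supported_repr\<close>.\<close>

definition supported :: "nat \<Rightarrow> nat set \<Rightarrow> cmat \<Rightarrow> bool" where
  "supported n S G \<longleftrightarrow> (\<forall>q<n. q \<notin> S \<longrightarrow> (\<forall>a<2^n. \<forall>b<2^n.
     (bit a q \<noteq> bit b q \<longrightarrow> G $$ (a,b) = 0) \<and> G $$ (flip_bit q a, flip_bit q b) = G $$ (a,b)))"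

lemma supportedI:
  assumes "\<And>q a b. q < n \<Longrightarrow> q \<notin> S \<Longrightarrow> a < 2^n \<Longrightarrow> b < 2^n \<Longrightarrow> bit a q \<noteq> bit b q \<Longrightarrow> G $$ (a,b) = 0"
    and "\<And>q a b. q < n \<Longrightarrow> q \<notin> S \<Longrightarrow> a < 2^n \<Longrightarrow> b < 2^n \<Longrightarrow> G $$ (flip_bit q a, flip_bit q b) = G $$ (a,b)"
  shows "supported n S G"
  using assms unfolding supported_def by blast

lemma supportedD:
  assumes "supported n S G" "q < n" "q \<notin> S" "a < 2^n" "b < 2^n"
  shows "bit a q \<noteq> bit b q \<Longrightarrow> G $$ (a,b) = 0" "G $$ (flip_bit q a, flip_bit q b) = G $$ (a,b)"
  using assms unfolding supported_def by blast+

lemma supported_mono: "supported n S G \<Longrightarrow> S \<subseteq> S' \<Longrightarrow> supported n S' G"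
  unfolding supported_def by blast

lemma supported_mult:
  assumes A: "A \<in> carrier_mat (2^n) (2^n)" "supported n S A" and B: "B \<in> carrier_mat (2^n) (2^n)" "supported n S B"
  shows "supported n S (A * B)"
proof (rule supportedI)
  fix q a b :: nat assume q: "q < n" "q \<notin> S" and ab: "a < 2^n" "b < 2^n" and d: "bit a q \<noteq> bit b q"
  have "A $$ (a,c) * B $$ (c,b) = 0" if "c < 2^n" for c
    using supportedD(1)[OF A(2) q ab(1) that] supportedD(1)[OF B(2) q that ab(2)] d by auto
  then show "(A * B) $$ (a,b) = 0" unfolding mat_mult_sum[OF A(1) B(1) ab] by (auto intro!: sum.neutral)
next
  fix q a b :: nat assume q: "q < n" "q \<notin> S" and ab: "a < 2^n" "b < 2^n"
  have "(A * B) $$ (flip_bit q a, flip_bit q b) = (\<Sum>c<2^n. A $$ (flip_bit q a, flip_bit q c) * B $$ (flip_bit q c, flip_bit q b))"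
    unfolding mat_mult_sum[OF A(1) B(1) flip_less[OF q(1) ab(1)] flip_less[OF q(1) ab(2)]]
    by (rule sum_flip[OF q(1), symmetric])
  also have "\<dots> = (A * B) $$ (a,b)"
    unfolding mat_mult_sum[OF A(1) B(1) ab] using ab
    by (intro sum.cong refl) (simp add: supportedD(2)[OF A(2) q] supportedD(2)[OF B(2) q])
  finally show "(A * B) $$ (flip_bit q a, flip_bit q b) = (A * B) $$ (a,b)" .
qed

lemma supported_gate_on: "supported n {i,j} (gate_on n i j U)"
proof (rule supportedI)
  fix q a b :: nat assume "q < n" "q \<notin> {i,j}" "a < 2^n" "b < 2^n" "bit a q \<noteq> bit b q"
  then show "gate_on n i j U $$ (a,b) = 0" by (auto simp: gate_on_index bitq_eq_iff)
next
  fix q a b :: nat assume q: "q < n" "q \<notin> {i,j}" and ab: "a < 2^n" "b < 2^n"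
  have pi: "pair_idx i j (flip_bit q c) = pair_idx i j c" for c using q by (simp add: bitq_bit)
  have ag: "(bitq (flip_bit q a) r = bitq (flip_bit q b) r) = (bitq a r = bitq b r)" for r
    unfolding bitq_eq_iff by simp
  show "gate_on n i j U $$ (flip_bit q a, flip_bit q b) = gate_on n i j U $$ (a,b)"
    unfolding gate_on_index[OF ab] gate_on_index[OF flip_less[OF q(1) ab(1)] flip_less[OF q(1) ab(2)]] pi ag ..
qed

text \<open>Induction on the number of positions where \<open>a\<close> and \<open>a'\<close>
  differ. Each lies outside \<open>S\<close>, where both indices of the entry may be flipped
  together.\<close>

lemma supported_shift:
  assumes G: "supported n S G"
    and "a < 2^n" "b < 2^n" "a' < 2^n" "b' < 2^n"
    and "\<And>q. q < n \<Longrightarrow> q \<in> S \<Longrightarrow> bit a q = bit a' q \<and> bit b q = bit b' q"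
    and "\<And>q. q < n \<Longrightarrow> q \<notin> S \<Longrightarrow> bit a q = bit b q \<and> bit a' q = bit b' q"
  shows "G $$ (a,b) = G $$ (a',b')"
  using assms(2-)
proof (induction "card {q. q < n \<and> bit a q \<noteq> bit a' q}" arbitrary: a b rule: less_induct)
  case less
  show ?case
  proof (cases "\<exists>q<n. bit a q \<noteq> bit a' q")
    case False
    then have "a = a'" using less by (intro nat_eq_bitsI[of a n a']) auto
    moreover have "b = b'" by (rule nat_eq_bitsI[of b n b']) (use less False in blast)+
    ultimately show ?thesis by simp
  next
    case True
    then obtain q where q: "q < n" "bit a q \<noteq> bit a' q" by blast
    then have qS: "q \<notin> S" using less by blast
    have "{p. p < n \<and> bit (flip_bit q a) p \<noteq> bit a' p} \<subset> {p. p < n \<and> bit a p \<noteq> bit a' p}"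
      using q by auto
    then have "card {p. p < n \<and> bit (flip_bit q a) p \<noteq> bit a' p} < card {p. p < n \<and> bit a p \<noteq> bit a' p}"
      by (intro psubset_card_mono) auto
    then have "G $$ (flip_bit q a, flip_bit q b) = G $$ (a',b')"
    proof (rule less(1))
      show "flip_bit q a < 2^n" "flip_bit q b < 2^n" using flip_less[OF q(1)] less by auto
    qed (use less qS q in auto)
    then show ?thesis using supportedD(2)[OF G q(1) qS] less by simp
  qed
qed

text \<open>\<open>G\<close> preserves bits \<open>i\<close> and \<open>j\<close>, so one term
  survives in each product. The two surviving entries of \<open>G\<close> differ only in the common
  values of these two bits and agree by \<open>supported_shift\<close>, unless another outside bit
  makes both zero.\<close>

lemma supported_commute_gate:
  assumes G: "supported n S G" "G \<in> carrier_mat (2^n) (2^n)"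
    and ij: "i < n" "j < n" "i \<noteq> j" "i \<notin> S" "j \<notin> S"
  shows "gate_on n i j U * G = G * gate_on n i j U"
proof (rule eq_matI)
  fix a b assume "a < dim_row (G * gate_on n i j U)" "b < dim_col (G * gate_on n i j U)"
  then have a: "a < 2^n" and b: "b < 2^n" using G by auto
  note pl = put2_less[OF ij(3,1,2)]
  let ?P = "\<lambda>a b. \<forall>q<n. q \<noteq> i \<and> q \<noteq> j \<longrightarrow> bitq a q = bitq b q"
  let ?ia = "pair_idx i j a" and ?ib = "pair_idx i j b"
  have ne: "x \<noteq> pair_idx i j c \<Longrightarrow> x < 4 \<Longrightarrow> bit (put2 i j d x) i \<noteq> bit c i \<or> bit (put2 i j d x) j \<noteq> bit c j" for x c d
    using pair_idx_put2[OF ij(3), of x d] pair_idx_eq_iff[where i=i and j=j and a="put2 i j d x" and b=c] by auto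
  have "(gate_on n i j U * G) $$ (a,b) = (\<Sum>c<2^n. if ?P a c then U $$ (?ia, pair_idx i j c) * G $$ (c,b) else 0)"
    unfolding mat_mult_sum[OF gate_on_carrier(1) G(2) a b] using a by (intro sum.cong refl) (auto simp: gate_on_index)
  also have "\<dots> = (\<Sum>x<4. if x = ?ib then U $$ (?ia, ?ib) * G $$ (put2 i j a ?ib, b) else 0)"
    unfolding sum_agree_off_pair[OF ij(1-3) a]
  proof (intro sum.cong refl)
    fix x :: nat assume x: "x \<in> {..<4}"
    show "U $$ (?ia, pair_idx i j (put2 i j a x)) * G $$ (put2 i j a x, b)
      = (if x = ?ib then U $$ (?ia, ?ib) * G $$ (put2 i j a ?ib, b) else 0)"
    proof (cases "x = ?ib")
      case True
      then show ?thesis using pair_idx_put2[OF ij(3), of x] x by simp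
    next
      case False
      then have "G $$ (put2 i j a x, b) = 0"
        using ne[of x b a] x supportedD(1)[OF G(1) ij(1,4) pl[OF a] b] supportedD(1)[OF G(1) ij(2,5) pl[OF a] b] by auto
      with False show ?thesis by simp
    qed
  qed
  also have "\<dots> = U $$ (?ia, ?ib) * G $$ (put2 i j a ?ib, b)" using pair_idx_less[where i=i and a=b and j=j] by simp
  finally have L: "(gate_on n i j U * G) $$ (a,b) = U $$ (?ia, ?ib) * G $$ (put2 i j a ?ib, b)" .
  have "(G * gate_on n i j U) $$ (a,b) = (\<Sum>c<2^n. if ?P b c then G $$ (a,c) * U $$ (pair_idx i j c, ?ib) else 0)"
    unfolding mat_mult_sum[OF G(2) gate_on_carrier(1) a b] using b by (intro sum.cong refl) (auto simp: gate_on_index)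
  also have "\<dots> = (\<Sum>x<4. if x = ?ia then G $$ (a, put2 i j b ?ia) * U $$ (?ia, ?ib) else 0)"
    unfolding sum_agree_off_pair[OF ij(1-3) b]
  proof (intro sum.cong refl)
    fix x :: nat assume x: "x \<in> {..<4}"
    show "G $$ (a, put2 i j b x) * U $$ (pair_idx i j (put2 i j b x), ?ib)
      = (if x = ?ia then G $$ (a, put2 i j b ?ia) * U $$ (?ia, ?ib) else 0)"
    proof (cases "x = ?ia")
      case True
      then show ?thesis using pair_idx_put2[OF ij(3), of x] x by simp
    next
      case False
      then have "G $$ (a, put2 i j b x) = 0"
        using ne[of x a b] x supportedD(1)[OF G(1) ij(1,4) a pl[OF b]] supportedD(1)[OF G(1) ij(2,5) a pl[OF b]] by auto
      with False show ?thesis by simp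
    qed
  qed
  also have "\<dots> = G $$ (a, put2 i j b ?ia) * U $$ (?ia, ?ib)" using pair_idx_less[where i=i and a=a and j=j] by simp
  finally have R: "(G * gate_on n i j U) $$ (a,b) = G $$ (a, put2 i j b ?ia) * U $$ (?ia, ?ib)" .
  have "G $$ (put2 i j a ?ib, b) = G $$ (a, put2 i j b ?ia)"
  proof (cases "\<exists>q<n. q \<notin> S \<and> q \<noteq> i \<and> q \<noteq> j \<and> bit a q \<noteq> bit b q")
    case True
    then obtain q where q: "q < n" "q \<notin> S" "q \<noteq> i" "q \<noteq> j" "bit a q \<noteq> bit b q" by blast
    then show ?thesis
      using supportedD(1)[OF G(1) q(1,2) pl[OF a] b, of ?ib] supportedD(1)[OF G(1) q(1,2) a pl[OF b], of ?ia]
      by (simp add: bit_put2[OF ij(3)])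
  next
    case False
    then show ?thesis
      by (intro supported_shift[OF G(1) pl[OF a] b a pl[OF b]]) (use ij in \<open>auto simp: bit_put2[OF ij(3)] bitq_bit\<close>)
  qed
  then show "(gate_on n i j U * G) $$ (a,b) = (G * gate_on n i j U) $$ (a,b)" unfolding L R by simp
qed (use G in auto)

section \<open>Unitaries and conjugated observables\<close>

lemma unitary_carrier: "unitary D U \<Longrightarrow> U \<in> carrier_mat D D"
  by (simp add: unitary_def)

lemma unitary_adj_right:
  assumes "unitary D U" shows "U * adj U = 1\<^sub>m D"
  using assms mat_mult_left_right_inverse[of "adj U" D U] unfolding unitary_def by auto

lemma unitary_one: "unitary D (1\<^sub>m D)"
  by (simp add: unitary_def)

lemma unitary_adj: "unitary D U \<Longrightarrow> unitary D (adj U)"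
  using unitary_adj_right by (auto simp: unitary_def)

lemma unitary_mult:
  assumes U: "unitary D U" and W: "unitary D W" shows "unitary D (U * W)"
proof -
  note c = unitary_carrier[OF U] unitary_carrier[OF W]
  note ac = adj_carrier[OF c(1)] adj_carrier[OF c(2)]
  have "adj (U * W) * (U * W) = adj W * (adj U * (U * W))"
    unfolding adj_mult[OF c] by (rule assoc_mult_mat[OF ac(2,1) mult_carrier_mat[OF c]])
  also have "adj U * (U * W) = (adj U * U) * W" by (rule assoc_mult_mat[OF ac(1) c, symmetric])
  also have "adj W * ((adj U * U) * W) = 1\<^sub>m D" using U W c by (simp add: unitary_def)
  finally show ?thesis using c by (auto simp: unitary_def)
qed

text \<open>The observable whose expectation in a state evolved by \<open>U\<close> equals that of
  \<open>G\<close> before the evolution.\<close>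

definition conj_by :: "cmat \<Rightarrow> cmat \<Rightarrow> cmat" where
  "conj_by U G = U * G * adj U"

lemma conj_by_carrier [simp]: "U \<in> carrier_mat D D \<Longrightarrow> G \<in> carrier_mat D D \<Longrightarrow> conj_by U G \<in> carrier_mat D D"
  by (auto simp: conj_by_def)

lemma conj_by_mult:
  assumes "U \<in> carrier_mat D D" "W \<in> carrier_mat D D" "G \<in> carrier_mat D D"
  shows "conj_by (U * W) G = conj_by U (conj_by W G)"
proof -
  have c: "adj U \<in> carrier_mat D D" "adj W \<in> carrier_mat D D" "W * G \<in> carrier_mat D D" using assms by auto
  have "U * W * G * (adj W * adj U) = U * (W * G) * (adj W * adj U)"
    using assoc_mult_mat[OF assms] by simp
  also have "\<dots> = U * (W * G * (adj W * adj U))" by (rule assoc_mult_mat[OF assms(1) c(3) mult_carrier_mat[OF c(2,1)]])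
  also have "W * G * (adj W * adj U) = W * G * adj W * adj U" by (rule assoc_mult_mat[OF c(3,2,1), symmetric])
  also have "U * (W * G * adj W * adj U) = U * (W * G * adj W) * adj U"
    by (rule assoc_mult_mat[OF assms(1) mult_carrier_mat[OF c(3,2)] c(1), symmetric])
  finally show ?thesis unfolding conj_by_def adj_mult[OF assms(1,2)] .
qed

lemma conj_by_one: "G \<in> carrier_mat D D \<Longrightarrow> conj_by (1\<^sub>m D) G = G"
  by (simp add: conj_by_def)

lemma conj_gate_disjoint:
  assumes G: "supported n S G" "G \<in> carrier_mat (2^n) (2^n)" and U: "unitary 4 U"
    and ij: "i < n" "j < n" "i \<noteq> j" "i \<notin> S" "j \<notin> S"
  shows "conj_by (gate_on n i j U) G = G"
proof -
  have u: "unitary (2^n) (gate_on n i j U)" using gate_on_unitary ij U by auto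
  have "conj_by (gate_on n i j U) G = G * (gate_on n i j U * adj (gate_on n i j U))"
    unfolding conj_by_def supported_commute_gate[OF assms(1,2) ij]
    using G by (intro assoc_mult_mat[of _ "2^n" "2^n" _ "2^n" _ "2^n"]) auto
  then show ?thesis unfolding unitary_adj_right[OF u] using G by simp
qed

lemma supported_conj_gate:
  assumes G: "supported n S G" "G \<in> carrier_mat (2^n) (2^n)" and U: "U \<in> carrier_mat 4 4"
  shows "supported n (S \<union> {i,j}) (conj_by (gate_on n i j U) G)"
proof -
  let ?S = "S \<union> {i,j}"
  have g: "supported n ?S (gate_on n i j W)" for W by (rule supported_mono[OF supported_gate_on]) blast
  have "supported n ?S G" by (rule supported_mono[OF G(1)]) blast
  from supported_mult[OF gate_on_carrier(1) g G(2) this] show ?thesis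
    unfolding conj_by_def gate_on_adj[OF U]
    by (intro supported_mult[OF mult_carrier_mat[OF gate_on_carrier(1) G(2)] _ gate_on_carrier(1) g])
qed

text \<open>A gate touching \<open>S\<close> adds at most as many qubits as it has in
  \<open>S\<close>; any other gate commutes past and cancels. The inclusion of \<open>S'\<close> in
  \<open>S \<union> prs gs\<close> is carried along because, the gates being disjoint, it shows that
  a gate missing \<open>S\<close> also misses the enlarged support.\<close>

lemma layer_light_cone:
  fixes gs :: "(nat \<times> nat \<times> cmat) list"
  assumes "\<forall>(i,j,U) \<in> set gs. i < n \<and> j < n \<and> i \<noteq> j \<and> unitary 4 U"
    and "\<forall>p<length gs. \<forall>q<length gs. p \<noteq> q \<longrightarrow>
        {fst (gs!p), fst (snd (gs!p))} \<inter> {fst (gs!q), fst (snd (gs!q))} = {}"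
    and G: "supported n S G" "G \<in> carrier_mat (2^n) (2^n)" and S: "S \<subseteq> {0..<n}"
  defines "prs \<equiv> \<lambda>gs :: (nat \<times> nat \<times> cmat) list. \<Union>g\<in>set gs. {fst g, fst (snd g)}"
  shows "unitary (2^n) (foldr (\<lambda>(i,j,U) M. gate_on n i j U * M) gs (1\<^sub>m (2^n))) \<and>
    (\<exists>S'. S \<subseteq> S' \<and> S' \<subseteq> S \<union> prs gs \<and> S' \<subseteq> {0..<n} \<and> card S' \<le> card S + card (S \<inter> prs gs) \<and>
      supported n S' (conj_by (foldr (\<lambda>(i,j,U) M. gate_on n i j U * M) gs (1\<^sub>m (2^n))) G))"
  using assms(1,2)
proof (induction gs)
  case Nil
  have "supported n S (conj_by (1\<^sub>m (2^n)) G)" unfolding conj_by_one[OF G(2)] by (rule G(1))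
  then show ?case using S by (intro conjI exI[of _ S]) (simp_all add: unitary_one)
next
  case (Cons g gs)
  obtain i j U where g: "g = (i,j,U)" by (cases g) auto
  have v: "i < n" "j < n" "i \<noteq> j" "unitary 4 U" using Cons(2) g by auto
  let ?L = "foldr (\<lambda>(i,j,U) M. gate_on n i j U * M) gs (1\<^sub>m (2^n))"
  have dis: "{i,j} \<inter> prs gs = {}"
  proof -
    have "{i,j} \<inter> {fst h, fst (snd h)} = {}" if h: "h \<in> set gs" for h
    proof -
      obtain q where q: "q < length gs" "gs ! q = h" using h unfolding in_set_conv_nth by blast
      have "0 < length (g # gs)" "Suc q < length (g # gs)" "0 \<noteq> Suc q" using q by auto
      from Cons(3)[rule_format, OF this] show ?thesis
        unfolding nth_Cons_0 nth_Cons_Suc q(2) unfolding g fst_conv snd_conv .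
    qed
    then show ?thesis unfolding prs_def by blast
  qed
  have pd: "\<forall>p<length gs. \<forall>q<length gs. p \<noteq> q \<longrightarrow>
        {fst (gs!p), fst (snd (gs!p))} \<inter> {fst (gs!q), fst (snd (gs!q))} = {}"
  proof (intro allI impI)
    fix p q assume "p < length gs" "q < length gs" "p \<noteq> q"
    then have "Suc p < length (g # gs)" "Suc q < length (g # gs)" "Suc p \<noteq> Suc q" by auto
    from Cons(3)[rule_format, OF this] show "{fst (gs!p), fst (snd (gs!p))} \<inter> {fst (gs!q), fst (snd (gs!q))} = {}"
      unfolding nth_Cons_Suc .
  qed
  have vd: "\<forall>(i,j,U) \<in> set gs. i < n \<and> j < n \<and> i \<noteq> j \<and> unitary 4 U" using Cons(2) by simp
  obtain S' where u: "unitary (2^n) ?L" and S': "S \<subseteq> S'" "S' \<subseteq> S \<union> prs gs" "S' \<subseteq> {0..<n}"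
    "card S' \<le> card S + card (S \<inter> prs gs)" "supported n S' (conj_by ?L G)"
    using Cons.IH[OF vd pd] by blast
  have fin: "finite S" "finite S'" using S S'(3) finite_subset by auto
  have gu: "unitary (2^n) (gate_on n i j U)" using gate_on_unitary v by auto
  have Lc: "?L \<in> carrier_mat (2^n) (2^n)" using u by (rule unitary_carrier)
  have gc: "conj_by ?L G \<in> carrier_mat (2^n) (2^n)" using Lc G by simp
  have eq: "conj_by (gate_on n i j U * ?L) G = conj_by (gate_on n i j U) (conj_by ?L G)"
    using conj_by_mult[OF gate_on_carrier(1) Lc G(2)] .
  have prs: "prs (g # gs) = {i,j} \<union> prs gs" unfolding prs_def g by auto
  have fp: "finite (prs gs)" unfolding prs_def by auto
  have "\<exists>S''. S \<subseteq> S'' \<and> S'' \<subseteq> S \<union> prs (g # gs) \<and> S'' \<subseteq> {0..<n} \<and> card S'' \<le> card S + card (S \<inter> prs (g # gs)) \<and>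
      supported n S'' (conj_by (gate_on n i j U) (conj_by ?L G))"
  proof (cases "i \<in> S \<or> j \<in> S")
    case False
    then have "i \<notin> S'" "j \<notin> S'" using S'(2) dis by auto
    then have "conj_by (gate_on n i j U) (conj_by ?L G) = conj_by ?L G"
      using conj_gate_disjoint[OF S'(5) gc v(4) v(1-3)] by blast
    moreover have "S \<inter> prs (g # gs) = S \<inter> prs gs" using False prs by auto
    ultimately show ?thesis using S' prs by (intro exI[of _ S'] conjI) (simp_all, blast)
  next
    case True
    have "card (S' \<union> {i,j}) \<le> card S + card (S \<inter> prs (g # gs))"
    proof -
      have "S \<inter> prs (g # gs) = (S \<inter> {i,j}) \<union> (S \<inter> prs gs)" using prs by auto
      moreover have "(S \<inter> {i,j}) \<inter> (S \<inter> prs gs) = {}" using dis by auto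
      ultimately have c: "card (S \<inter> prs (g # gs)) = card (S \<inter> {i,j}) + card (S \<inter> prs gs)"
        using fin fp by (simp add: card_Un_disjoint)
      have "card (S' \<union> {i,j}) \<le> card S' + card (S \<inter> {i,j})"
      proof (cases "i \<in> S")
        case True
        then have "S' \<union> {i,j} = insert j S'" using S'(1) by auto
        moreover have "card (S \<inter> {i,j}) \<ge> 1" using card_mono[of "S \<inter> {i,j}" "{i}"] True fin by simp
        ultimately show ?thesis using fin by (simp add: card_insert_if)
      next
        case False
        then have "j \<in> S" using \<open>i \<in> S \<or> j \<in> S\<close> by simp
        then have "S' \<union> {i,j} = insert i S'" using S'(1) by auto
        moreover have "card (S \<inter> {i,j}) \<ge> 1" using card_mono[of "S \<inter> {i,j}" "{j}"] \<open>j \<in> S\<close> fin by simp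
        ultimately show ?thesis using fin by (simp add: card_insert_if)
      qed
      then show ?thesis using c S'(4) by simp
    qed
    moreover have "supported n (S' \<union> {i,j}) (conj_by (gate_on n i j U) (conj_by ?L G))"
      using supported_conj_gate[OF S'(5) gc] v(4) by (simp add: unitary_def)
    moreover have "S \<subseteq> S' \<union> {i,j}" "S' \<union> {i,j} \<subseteq> S \<union> prs (g # gs)" "S' \<union> {i,j} \<subseteq> {0..<n}"
      using S' prs v by auto
    ultimately show ?thesis by blast
  qed
  moreover have "foldr (\<lambda>(i,j,U) M. gate_on n i j U * M) (g # gs) (1\<^sub>m (2^n)) = gate_on n i j U * ?L"
    by (simp add: g)
  ultimately show ?case using unitary_mult[OF gu u] eq by (simp only:)
qed

lemma layer_unitary:
  assumes "layer n L" shows "unitary (2^n) L"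
proof -
  obtain gs :: "(nat \<times> nat \<times> cmat) list" where gs: "\<forall>(i,j,U) \<in> set gs. i < n \<and> j < n \<and> i \<noteq> j \<and> unitary 4 U"
    "L = foldr (\<lambda>(i,j,U) M. gate_on n i j U * M) gs (1\<^sub>m (2^n))"
    using assms unfolding layer_def by blast
  show ?thesis using gs(1) unfolding gs(2)
  proof (induction gs)
    case (Cons g gs)
    then show ?case by (cases g) (auto intro!: unitary_mult gate_on_unitary)
  qed (simp add: unitary_one)
qed

lemma layer_support:
  assumes L: "layer n L" and G: "supported n S G" "G \<in> carrier_mat (2^n) (2^n)" and S: "S \<subseteq> {0..<n}"
  obtains S' where "S' \<subseteq> {0..<n}" "card S' \<le> 2 * card S" "supported n S' (conj_by L G)"
proof -
  obtain gs :: "(nat \<times> nat \<times> cmat) list" where gs: "\<forall>(i,j,U) \<in> set gs. i < n \<and> j < n \<and> i \<noteq> j \<and> unitary 4 U"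
    "\<forall>p<length gs. \<forall>q<length gs. p \<noteq> q \<longrightarrow>
        {fst (gs!p), fst (snd (gs!p))} \<inter> {fst (gs!q), fst (snd (gs!q))} = {}"
    "L = foldr (\<lambda>(i,j,U) M. gate_on n i j U * M) gs (1\<^sub>m (2^n))"
    using L unfolding layer_def by blast
  have "finite S" using S finite_subset by auto
  then have c: "card (S \<inter> X) \<le> card S" for X by (intro card_mono) auto
  obtain S' X where S': "S' \<subseteq> {0..<n}" "card S' \<le> card S + card (S \<inter> X)" "supported n S' (conj_by L G)"
    using layer_light_cone[OF gs(1,2) G S] unfolding gs(3) by blast
  then have "card S' \<le> 2 * card S" using c[of X] by linarith
  then show ?thesis using S' by (intro that[of S'])
qed

text \<open>Each layer at most doubles the support, and conjugation by a product nests with the head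
  of the list outermost, as the list induction wants.\<close>

lemma circuit_light_cone:
  assumes "\<forall>L\<in>set Ls. layer n L" and G: "supported n S G" "G \<in> carrier_mat (2^n) (2^n)" and S: "S \<subseteq> {0..<n}"
  shows "unitary (2^n) (foldr (*) Ls (1\<^sub>m (2^n))) \<and>
    (\<exists>S'. S' \<subseteq> {0..<n} \<and> card S' \<le> 2 ^ length Ls * card S \<and>
      supported n S' (conj_by (foldr (*) Ls (1\<^sub>m (2^n))) G))"
  using assms(1)
proof (induction Ls)
  case Nil
  have "supported n S (conj_by (1\<^sub>m (2^n)) G)" unfolding conj_by_one[OF G(2)] by (rule G(1))
  then show ?case using S by (intro conjI exI[of _ S]) (simp_all add: unitary_one)
next
  case (Cons L Ls)
  let ?U = "foldr (*) Ls (1\<^sub>m (2^n))"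
  obtain S' where u: "unitary (2^n) ?U" and S': "S' \<subseteq> {0..<n}" "card S' \<le> 2 ^ length Ls * card S"
    "supported n S' (conj_by ?U G)" using Cons.IH Cons.prems by (meson list.set_intros(2))
  have L: "layer n L" using Cons.prems by simp
  note lu = layer_unitary[OF L]
  have gc: "conj_by ?U G \<in> carrier_mat (2^n) (2^n)" using unitary_carrier[OF u] G by simp
  obtain S'' where S'': "S'' \<subseteq> {0..<n}" "card S'' \<le> 2 * card S'" "supported n S'' (conj_by L (conj_by ?U G))"
    using layer_support[OF L S'(3) gc S'(1)] by blast
  have "2 * card S' \<le> 2 ^ length (L # Ls) * card S" using S'(2) by simp
  then have le: "card S'' \<le> 2 ^ length (L # Ls) * card S" using S''(2) by linarith
  have e: "foldr (*) (L # Ls) (1\<^sub>m (2^n)) = L * ?U" by simp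
  show ?case unfolding e conj_by_mult[OF unitary_carrier[OF lu] unitary_carrier[OF u] G(2)]
    using unitary_mult[OF lu u] S''(1,3) le by blast
qed

section \<open>Partial traces\<close>

text \<open>\<open>G\<close> is block diagonal in the outside bits with identical blocks;
  \<open>g\<close> is one such block.\<close>

lemma supported_repr:
  assumes G: "supported n S G" "G \<in> carrier_mat (2^n) (2^n)" and S: "S \<subseteq> {0..<n}"
  obtains g where "g \<in> carrier_mat (2 ^ card S) (2 ^ card S)"
    "\<And>a b. a < 2^n \<Longrightarrow> b < 2^n \<Longrightarrow> G $$ (a,b) =
      (if sub_idx ({0..<n} - S) a = sub_idx ({0..<n} - S) b then g $$ (sub_idx S a, sub_idx S b) else 0)"
proof -
  let ?T = "{0..<n} - S"
  have f: "finite S" "finite ?T" using S finite_subset by auto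
  \<comment> \<open>Representatives \<open>J x\<close> have all outside bits 0, so \<open>g\<close>
    is the block of \<open>G\<close> at that setting.\<close>
  have "\<forall>x. \<exists>a. x < 2 ^ card S \<longrightarrow> a < 2^n \<and> sub_idx S a = x \<and> sub_idx ?T a = 0"
    using sub_idx_obtain[OF S, of _ 0] by (metis zero_less_numeral zero_less_power)
  then obtain J where J: "\<And>x. x < 2 ^ card S \<Longrightarrow> J x < 2^n \<and> sub_idx S (J x) = x \<and> sub_idx ?T (J x) = 0"
    by metis
  define g where "g = mat (2 ^ card S) (2 ^ card S) (\<lambda>(x,y). G $$ (J x, J y))"
  show ?thesis
  proof (rule that[of g])
    show "g \<in> carrier_mat (2 ^ card S) (2 ^ card S)" by (simp add: g_def)
    fix a b :: nat assume a: "a < 2^n" and b: "b < 2^n"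
    let ?x = "sub_idx S a" and ?y = "sub_idx S b"
    have xy: "?x < 2 ^ card S" "?y < 2 ^ card S" using sub_idx_less[OF f(1)] by auto
    note Jx = J[OF xy(1)] and Jy = J[OF xy(2)]
    show "G $$ (a,b) = (if sub_idx ?T a = sub_idx ?T b then g $$ (?x, ?y) else 0)"
    proof (cases "sub_idx ?T a = sub_idx ?T b")
      case True
      have "G $$ (a,b) = G $$ (J ?x, J ?y)"
      proof (rule supported_shift[OF G(1) a b])
        show "J ?x < 2^n" "J ?y < 2^n" using Jx Jy by auto
        fix q assume q: "q < n"
        { assume "q \<in> S"
          then show "bit a q = bit (J ?x) q \<and> bit b q = bit (J ?y) q"
            using Jx Jy sub_idx_eq_iff[OF f(1), of a "J ?x"] sub_idx_eq_iff[OF f(1), of b "J ?y"] by metis }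
        { assume "q \<notin> S"
          then have "q \<in> ?T" using q by simp
          moreover have "sub_idx ?T (J ?x) = sub_idx ?T (J ?y)" using Jx Jy by simp
          ultimately show "bit a q = bit b q \<and> bit (J ?x) q = bit (J ?y) q"
            using True sub_idx_eq_iff[OF f(2)] by metis }
      qed
      then show ?thesis using True xy by (simp add: g_def)
    next
      case False
      then obtain q where q: "q \<in> ?T" "bit a q \<noteq> bit b q" using sub_idx_eq_iff[OF f(2)] by blast
      then have "G $$ (a,b) = 0" using supportedD(1)[OF G(1) _ _ a b, of q] by auto
      then show ?thesis using False by simp
    qed
  qed
qed

text \<open>Entries of \<open>adj g * g\<close> are entries of \<open>adj G * G\<close> between
  indices whose outside bits vanish. Unitarity of the block is what
  \<open>trace_mult_unitary_le\<close> asks for on the marginal.\<close>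

lemma supported_repr_unitary:
  assumes G: "unitary (2^n) G" and S: "S \<subseteq> {0..<n}" and g: "g \<in> carrier_mat (2 ^ card S) (2 ^ card S)"
    and eq: "\<And>a b. a < 2^n \<Longrightarrow> b < 2^n \<Longrightarrow> G $$ (a,b) =
      (if sub_idx ({0..<n} - S) a = sub_idx ({0..<n} - S) b then g $$ (sub_idx S a, sub_idx S b) else 0)"
  shows "unitary (2 ^ card S) g"
proof -
  let ?T = "{0..<n} - S"
  have f: "finite S" "finite ?T" using S finite_subset by auto
  have Gc: "G \<in> carrier_mat (2^n) (2^n)" "adj G * G = 1\<^sub>m (2^n)" using G by (auto simp: unitary_def)
  have "adj g * g = 1\<^sub>m (2 ^ card S)"
  proof (rule eq_matI)
    fix x y assume "x < dim_row (1\<^sub>m (2 ^ card S))" "y < dim_col (1\<^sub>m (2 ^ card S))"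
    then have xy: "x < 2 ^ card S" "y < 2 ^ card S" by auto
    have p: "(0::nat) < 2 ^ card ?T" by simp
    obtain a where a: "a < 2^n" "sub_idx S a = x" "sub_idx ?T a = 0" using sub_idx_obtain[OF S xy(1) p] .
    obtain b where b: "b < 2^n" "sub_idx S b = y" "sub_idx ?T b = 0" using sub_idx_obtain[OF S xy(2) p] .
    have "(adj G * G) $$ (a,b) = (\<Sum>c<2^n. cnj (G $$ (c,a)) * G $$ (c,b))"
      unfolding mat_mult_sum[OF adj_carrier[OF Gc(1)] Gc(1) a(1) b(1)] using Gc a
      by (intro sum.cong refl) auto
    also have "\<dots> = (\<Sum>c<2^n. if sub_idx ?T c = 0 then cnj (g $$ (sub_idx S c, x)) * g $$ (sub_idx S c, y) else 0)"
      using a b by (intro sum.cong refl) (simp add: eq)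
    also have "\<dots> = (\<Sum>z<2 ^ card S. \<Sum>w<2 ^ card ?T. if w = (0::nat) then cnj (g $$ (z, x)) * g $$ (z, y) else 0)"
      by (rule sum_sub_idx[OF S, of "\<lambda>z w. if w = 0 then cnj (g $$ (z, x)) * g $$ (z, y) else 0"])
    also have "\<dots> = (\<Sum>z<2 ^ card S. cnj (g $$ (z, x)) * g $$ (z, y))" by simp
    also have "\<dots> = (adj g * g) $$ (x,y)"
      unfolding mat_mult_sum[OF adj_carrier[OF g] g xy] using g xy
      by (intro sum.cong refl) auto
    finally have e: "(adj g * g) $$ (x,y) = (adj G * G) $$ (a,b)" by simp
    have "a = b \<longleftrightarrow> x = y"
    proof
      assume "x = y"
      then show "a = b" by (intro inj_onD[OF bij_betw_imp_inj_on[OF sub_idx_bij[OF S]]]) (simp_all add: a b)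
    next
      assume "a = b"
      then show "x = y" using a(2) b(2) by simp
    qed
    then show "(adj g * g) $$ (x,y) = 1\<^sub>m (2 ^ card S) $$ (x,y)" unfolding e Gc(2) using a b xy by simp
  qed (use g in auto)
  then show ?thesis using g by (simp add: unitary_def)
qed

lemma ptrace_keep_carrier [simp]: "ptrace_keep n S \<rho> \<in> carrier_mat (2 ^ card S) (2 ^ card S)"
  "dim_row (ptrace_keep n S \<rho>) = 2 ^ card S" "dim_col (ptrace_keep n S \<rho>) = 2 ^ card S"
  by (auto simp: ptrace_keep_def)

lemma ptrace_keep_index: "x < 2 ^ card S \<Longrightarrow> y < 2 ^ card S \<Longrightarrow> ptrace_keep n S \<rho> $$ (x,y) =
   (\<Sum>a<2^n. \<Sum>b<2^n.
       if sub_idx S a = x \<and> sub_idx S b = y \<and> sub_idx ({0..<n} - S) a = sub_idx ({0..<n} - S) b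
       then \<rho> $$ (a,b) else 0)"
  by (simp add: ptrace_keep_def)

lemma ptrace_keep_adj:
  assumes "\<rho> \<in> carrier_mat (2^n) (2^n)"
  shows "adj (ptrace_keep n S \<rho>) = ptrace_keep n S (adj \<rho>)"
proof (rule eq_matI)
  fix x y assume "x < dim_row (ptrace_keep n S (adj \<rho>))" "y < dim_col (ptrace_keep n S (adj \<rho>))"
  then have xy: "x < 2 ^ card S" "y < 2 ^ card S" by auto
  let ?T = "{0..<n} - S"
  have "adj (ptrace_keep n S \<rho>) $$ (x,y) = (\<Sum>a<2^n. \<Sum>b<2^n.
       if sub_idx S a = y \<and> sub_idx S b = x \<and> sub_idx ?T a = sub_idx ?T b then cnj (\<rho> $$ (a,b)) else 0)"
    using xy by (simp add: ptrace_keep_index if_distrib[of cnj] cong: if_cong)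
  also have "\<dots> = (\<Sum>b<2^n. \<Sum>a<2^n.
       if sub_idx S a = y \<and> sub_idx S b = x \<and> sub_idx ?T a = sub_idx ?T b then cnj (\<rho> $$ (a,b)) else 0)"
    by (rule sum.swap)
  also have "\<dots> = ptrace_keep n S (adj \<rho>) $$ (x,y)"
    unfolding ptrace_keep_index[OF xy] using assms by (intro sum.cong refl) auto
  finally show "adj (ptrace_keep n S \<rho>) $$ (x,y) = ptrace_keep n S (adj \<rho>) $$ (x,y)" .
qed auto

text \<open>The adjointness that characterises the partial trace: agreement of the outside indices,
  the condition in \<open>ptrace_keep\<close>, is also the condition under which \<open>G\<close>
  may be nonzero.\<close>

lemma ptrace_keep_trace:
  assumes \<rho>: "\<rho> \<in> carrier_mat (2^n) (2^n)" and Gc: "G \<in> carrier_mat (2^n) (2^n)" and S: "S \<subseteq> {0..<n}"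
    and g: "g \<in> carrier_mat (2 ^ card S) (2 ^ card S)"
    and eq: "\<And>a b. a < 2^n \<Longrightarrow> b < 2^n \<Longrightarrow> G $$ (a,b) =
      (if sub_idx ({0..<n} - S) a = sub_idx ({0..<n} - S) b then g $$ (sub_idx S a, sub_idx S b) else 0)"
  shows "mtrace (ptrace_keep n S \<rho> * g) = mtrace (\<rho> * G)"
proof -
  let ?T = "{0..<n} - S" and ?D = "(2::nat) ^ card S"
  have f: "finite S" using S finite_subset by auto
  define h where "h = (\<lambda>x y a b. if sub_idx S a = x \<and> sub_idx S b = y \<and> sub_idx ?T a = sub_idx ?T b
       then \<rho> $$ (a,b) * g $$ (y,x) else 0)"
  have "mtrace (ptrace_keep n S \<rho> * g) = (\<Sum>x<?D. \<Sum>y<?D. \<Sum>a<2^n. \<Sum>b<2^n. h x y a b)"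
    unfolding mtrace_mult[OF ptrace_keep_carrier(1) g] h_def
    by (intro sum.cong refl) (simp add: ptrace_keep_index sum_distrib_right if_distrib[of "\<lambda>x. x * _"] cong: if_cong)
  also have "\<dots> = (\<Sum>a<2^n. \<Sum>x<?D. \<Sum>y<?D. \<Sum>b<2^n. h x y a b)" by (rule sum_rotate)
  also have "\<dots> = (\<Sum>a<2^n. \<Sum>b<2^n. \<Sum>x<?D. \<Sum>y<?D. h x y a b)"
    by (rule sum.cong[OF refl], rule sum_rotate)
  also have "\<dots> = (\<Sum>a<2^n. \<Sum>b<2^n. \<rho> $$ (a,b) * G $$ (b,a))"
  proof (intro sum.cong refl)
    fix a b :: nat assume ab: "a \<in> {..<2^n}" "b \<in> {..<2^n}"
    have "(\<Sum>x<?D. \<Sum>y<?D. h x y a b) = (\<Sum>x<?D. if x = sub_idx S a then (\<Sum>y<?D. if y = sub_idx S b then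
        (if sub_idx ?T a = sub_idx ?T b then \<rho> $$ (a,b) * g $$ (sub_idx S b, sub_idx S a) else 0) else 0) else 0)"
      unfolding h_def by (rule sum.cong[OF refl]) (auto intro!: sum.neutral sum.cong)
    also have "\<dots> = (if sub_idx ?T a = sub_idx ?T b then \<rho> $$ (a,b) * g $$ (sub_idx S b, sub_idx S a) else 0)"
      using sub_idx_less[OF f] by simp
    also have "\<dots> = \<rho> $$ (a,b) * G $$ (b,a)" using ab eq[of b a] by auto
    finally show "(\<Sum>x<?D. \<Sum>y<?D. h x y a b) = \<rho> $$ (a,b) * G $$ (b,a)" .
  qed
  also have "\<dots> = mtrace (\<rho> * G)" using mtrace_mult[OF \<rho> Gc] by simp
  finally show ?thesis .
qed

lemma mtrace_minus_mult:
  assumes "A \<in> carrier_mat D D" "B \<in> carrier_mat D D" "G \<in> carrier_mat D D"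
  shows "mtrace ((A - B) * G) = mtrace (A * G) - mtrace (B * G)"
proof -
  have c: "A - B \<in> carrier_mat D D" using assms by auto
  show ?thesis unfolding mtrace_mult[OF c assms(3)] mtrace_mult[OF assms(1,3)] mtrace_mult[OF assms(2,3)] sum_subtractf[symmetric]
    using assms by (intro sum.cong refl) (auto simp: algebra_simps)
qed

lemma adj_minus: "A \<in> carrier_mat r c \<Longrightarrow> B \<in> carrier_mat r c \<Longrightarrow> adj (A - B) = adj A - adj B"
  by (intro eq_matI) auto

text \<open>Both expectations are those of the block \<open>g\<close> in the marginals on
  \<open>S\<close>, so trace-norm duality applies to the difference of the marginals.\<close>

lemma supported_expectation_le:
  assumes G: "supported n S G" "unitary (2^n) G" and S: "S \<subseteq> {0..<n}"
    and \<rho>: "\<rho> \<in> carrier_mat (2^n) (2^n)" "adj \<rho> = \<rho>" and \<sigma>: "\<sigma> \<in> carrier_mat (2^n) (2^n)" "adj \<sigma> = \<sigma>"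
  shows "cmod (mtrace (\<rho> * G) - mtrace (\<sigma> * G)) \<le> trace_norm (ptrace_keep n S \<rho> - ptrace_keep n S \<sigma>)"
proof -
  have Gc: "G \<in> carrier_mat (2^n) (2^n)" using G unitary_carrier by auto
  obtain g where g: "g \<in> carrier_mat (2 ^ card S) (2 ^ card S)"
    and eq: "\<And>a b. a < 2^n \<Longrightarrow> b < 2^n \<Longrightarrow> G $$ (a,b) =
      (if sub_idx ({0..<n} - S) a = sub_idx ({0..<n} - S) b then g $$ (sub_idx S a, sub_idx S b) else 0)"
    using supported_repr[OF G(1) Gc S] by blast
  have gu: "unitary (2 ^ card S) g" by (rule supported_repr_unitary[OF G(2) S g eq])
  let ?A = "ptrace_keep n S \<rho> - ptrace_keep n S \<sigma>"
  have "adj ?A = ?A"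
    unfolding adj_minus[OF ptrace_keep_carrier(1) ptrace_keep_carrier(1)] ptrace_keep_adj[OF \<rho>(1)]
      ptrace_keep_adj[OF \<sigma>(1)] \<rho>(2) \<sigma>(2) ..
  moreover have "?A \<in> carrier_mat (2 ^ card S) (2 ^ card S)" by (intro minus_carrier_mat ptrace_keep_carrier)
  ultimately have "cmod (mtrace (?A * g)) \<le> trace_norm ?A" using trace_mult_unitary_le[OF _ _ gu] by blast
  moreover have "mtrace (ptrace_keep n S \<rho> * g) = mtrace (\<rho> * G)"
    by (rule ptrace_keep_trace[OF \<rho>(1) Gc S g]) (rule eq)
  moreover have "mtrace (ptrace_keep n S \<sigma> * g) = mtrace (\<sigma> * G)"
    by (rule ptrace_keep_trace[OF \<sigma>(1) Gc S g]) (rule eq)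
  ultimately show ?thesis
    unfolding mtrace_minus_mult[OF ptrace_keep_carrier(1) ptrace_keep_carrier(1) g] by simp
qed

section \<open>Finiteness of the supremum over code states and regions\<close>

lemma unit_vec_entry_le:
  assumes "\<psi> \<in> carrier_vec D" "\<psi> \<bullet>c \<psi> = 1" "a < D"
  shows "cmod (\<psi> $ a) \<le> 1"
proof -
  have "complex_of_real (\<Sum>k<D. (cmod (\<psi> $ k))\<^sup>2) = 1"
    using assms(2) cscalar_prod_sum[OF assms(1)] by (simp only: of_real_sum complex_norm_square)
  then have "(\<Sum>k<D. (cmod (\<psi> $ k))\<^sup>2) = 1" by (simp only: of_real_eq_1_iff)
  moreover have "(cmod (\<psi> $ a))\<^sup>2 \<le> (\<Sum>k<D. (cmod (\<psi> $ k))\<^sup>2)" using assms(3) by (intro member_le_sum) auto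
  ultimately have "(cmod (\<psi> $ a))\<^sup>2 \<le> 1\<^sup>2" by simp
  then show ?thesis by (rule power2_le_imp_le) simp
qed

lemma code_Gamma_carrier: "V \<in> carrier_mat N D \<Longrightarrow> code_Gamma k V \<in> carrier_mat N N"
  by (auto simp: code_Gamma_def)

lemma code_Gamma_index:
  assumes V: "V \<in> carrier_mat N D" and ab: "a < N" "b < N"
  shows "code_Gamma k V $$ (a,b) = (1 / 2^k) * (\<Sum>l<D. V $$ (a,l) * cnj (V $$ (b,l)))"
proof -
  have "(V * adj V) $$ (a,b) = (\<Sum>l<D. V $$ (a,l) * cnj (V $$ (b,l)))"
    unfolding mat_mult_sum[OF V adj_carrier[OF V] ab] using V ab by (intro sum.cong refl) auto
  then show ?thesis using V ab by (simp add: code_Gamma_def del: index_mult_mat(1))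
qed

lemma code_Gamma_hermitian:
  assumes V: "V \<in> carrier_mat N D" shows "adj (code_Gamma k V) = code_Gamma k V"
proof (rule eq_matI)
  note c = code_Gamma_carrier[OF V, of k]
  fix a b assume "a < dim_row (code_Gamma k V)" "b < dim_col (code_Gamma k V)"
  then have ab: "a < N" "b < N" using c by auto
  have "adj (code_Gamma k V) $$ (a,b) = cnj (code_Gamma k V $$ (b,a))" using c ab by simp
  also have "\<dots> = code_Gamma k V $$ (a,b)"
    unfolding code_Gamma_index[OF V ab] code_Gamma_index[OF V ab(2,1)] by (simp add: mult.commute)
  finally show "adj (code_Gamma k V) $$ (a,b) = code_Gamma k V $$ (a,b)" .
qed (use code_Gamma_carrier[OF V, of k] in auto)

text \<open>A member lies below a real \<open>Sup\<close> only once the set is known to be bounded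
  above; any bound depending on \<open>n\<close> and \<open>V\<close> alone suffices.\<close>

lemma eps_g_complete_upper:
  assumes V: "V \<in> carrier_mat (2^n) (2^k)" and \<psi>: "\<psi> \<in> code_space n k V" "\<psi> \<bullet>c \<psi> = 1"
    and S: "S \<subseteq> {0..<n}" "card S \<le> d"
  shows "trace_norm (ptrace_keep n S (outer \<psi>) - ptrace_keep n S (code_Gamma k V)) \<le> eps_g_complete n k V d"
proof -
  let ?G = "code_Gamma k V"
  have code: "\<phi> \<in> carrier_vec (2^n)" if "\<phi> \<in> code_space n k V" for \<phi>
    using that V by (auto simp: code_space_def)
  note Gc = code_Gamma_carrier[OF V, of k] and Gh = code_Gamma_hermitian[OF V, of k]
  \<comment> \<open>\<open>M\<close> majorises every entry of every difference of marginals, because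
    products of two amplitudes of a unit vector have modulus at most 1. \<open>B\<close> comes from
    \<open>trace_norm_le_entries\<close>, with the dimension on \<open>S\<close> replaced by the
    full one.\<close>
  define M where "M = (\<Sum>a<2^n. \<Sum>b<(2::nat)^n. 1 + cmod (?G $$ (a,b)))"
  have M0: "0 \<le> M" unfolding M_def by (intro sum_nonneg) auto
  define B where "B = (2::real)^n * (\<Sum>x<(2::nat)^n. \<Sum>y<(2::nat)^n. M)"
  have bd: "trace_norm (ptrace_keep n S (outer \<psi>) - ptrace_keep n S ?G) \<le> B"
    if asm: "\<psi> \<in> code_space n k V" "\<psi> \<bullet>c \<psi> = 1" "S \<subseteq> {0..<n}" for \<psi> S
  proof -
    let ?A = "ptrace_keep n S (outer \<psi>) - ptrace_keep n S ?G" and ?D = "(2::nat) ^ card S"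
    have \<psi>c: "\<psi> \<in> carrier_vec (2^n)" using code that by auto
    have DS: "?D \<le> 2^n" using card_mono[OF _ that(3)] by simp
    have A: "?A \<in> carrier_mat ?D ?D" by (intro minus_carrier_mat ptrace_keep_carrier)
    have Ah: "adj ?A = ?A"
      unfolding adj_minus[OF ptrace_keep_carrier(1) ptrace_keep_carrier(1)] ptrace_keep_adj[OF outer_carrier[OF \<psi>c]]
        ptrace_keep_adj[OF Gc] Gh outer_hermitian ..
    have ent: "cmod (?A $$ (x,y)) \<le> M" if xy: "x < ?D" "y < ?D" for x y
    proof -
      let ?P = "\<lambda>a b. sub_idx S a = x \<and> sub_idx S b = y \<and> sub_idx ({0..<n} - S) a = sub_idx ({0..<n} - S) b"
      define h where "h = (\<lambda>a b. if ?P a b then outer \<psi> $$ (a,b) - ?G $$ (a,b) else 0)"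
      have hb: "cmod (h a b) \<le> 1 + cmod (?G $$ (a,b))" if ab: "a < 2^n" "b < 2^n" for a b
      proof -
        have "cmod (\<psi> $ a) * cmod (\<psi> $ b) \<le> 1"
          by (intro mult_le_one unit_vec_entry_le[OF \<psi>c asm(2)] ab norm_ge_zero)
        then have "cmod (outer \<psi> $$ (a,b)) \<le> 1" using ab \<psi>c by (simp add: norm_mult)
        then have "cmod (outer \<psi> $$ (a,b) - ?G $$ (a,b)) \<le> 1 + cmod (?G $$ (a,b))"
          using norm_triangle_ineq4[of "outer \<psi> $$ (a,b)" "?G $$ (a,b)"] by linarith
        then show ?thesis by (simp add: h_def)
      qed
      have "?A $$ (x,y) = ptrace_keep n S (outer \<psi>) $$ (x,y) - ptrace_keep n S ?G $$ (x,y)" using xy by simp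
      also have "\<dots> = (\<Sum>a<2^n. \<Sum>b<2^n. h a b)"
        unfolding ptrace_keep_index[OF xy] sum_subtractf[symmetric] h_def by (intro sum.cong refl) simp
      finally have "cmod (?A $$ (x,y)) \<le> (\<Sum>a<2^n. \<Sum>b<2^n. cmod (h a b))"
        by (simp only:) (rule order_trans[OF norm_sum], rule sum_mono, rule norm_sum)
      also have "\<dots> \<le> M" unfolding M_def by (rule sum_mono, rule sum_mono, rule hb) auto
      finally show ?thesis .
    qed
    have "trace_norm ?A \<le> real ?D * (\<Sum>x<?D. \<Sum>y<?D. cmod (?A $$ (x,y)))"
      by (rule trace_norm_le_entries[OF A Ah])
    also have "\<dots> \<le> real ?D * (\<Sum>x<?D. \<Sum>y<?D. M)"
      using ent by (intro mult_left_mono sum_mono) auto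
    also have "\<dots> = real (?D * (?D * ?D)) * M" by simp
    also have "\<dots> \<le> real (2^n * (2^n * 2^n)) * M"
      using DS M0 by (intro mult_right_mono of_nat_mono mult_le_mono) auto
    also have "\<dots> = B" by (simp add: B_def)
    finally show ?thesis .
  qed
  show ?thesis unfolding eps_g_complete_def
  proof (rule cSup_upper)
    show "bdd_above {trace_norm (ptrace_keep n S (outer \<psi>) - ptrace_keep n S ?G) | \<psi> S.
      \<psi> \<in> code_space n k V \<and> \<psi> \<bullet>c \<psi> = 1 \<and> S \<subseteq> {0..<n} \<and> card S \<le> d}"
      by (rule bdd_aboveI[of _ B]) (use bd in blast)
  qed (use \<psi> S in blast)
qed

section \<open>Decoupling of erased qubits\<close>

text \<open>Information-disturbance: \<open>f\<close> is a purification carrying the environment label \<open>(c, s)\<close>; if its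
  overlap with \<open>\<chi>\<close> is nearly maximal, no observable on \<open>s\<close> correlates with the sign observable \<open>z\<close>,
  whose mean in \<open>\<chi>\<close> is zero.\<close>
lemma decoupling_bound:
  fixes f :: "'c \<Rightarrow> nat \<Rightarrow> 'i \<Rightarrow> complex" and \<chi> :: "'i \<Rightarrow> complex" and z :: "'i \<Rightarrow> real"
  assumes fin: "finite C" "finite J"
    and \<chi>1: "(\<Sum>i\<in>J. (cmod (\<chi> i))\<^sup>2) = 1" and \<chi>z: "(\<Sum>i\<in>J. z i * (cmod (\<chi> i))\<^sup>2) = 0"
    and z1: "\<And>i. i \<in> J \<Longrightarrow> (z i)\<^sup>2 = 1"
    and f1: "(\<Sum>c\<in>C. \<Sum>s<m. \<Sum>i\<in>J. (cmod (f c s i))\<^sup>2) = 1"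
    and g: "unitary m g" and gh: "adj g = g"
  defines "\<eta> \<equiv> \<lambda>c s. \<Sum>i\<in>J. cnj (\<chi> i) * f c s i"
  shows "(\<Sum>c\<in>C. \<Sum>s<m. (cmod (\<eta> c s))\<^sup>2) \<le> 1"
    and "cmod (\<Sum>c\<in>C. \<Sum>s<m. \<Sum>i\<in>J. cnj (f c s i) * (of_real (z i) * (\<Sum>s'<m. g $$ (s,s') * f c s' i)))
      \<le> 2 * sqrt (1 - (\<Sum>c\<in>C. \<Sum>s<m. (cmod (\<eta> c s))\<^sup>2))"
proof -
  have gc: "g \<in> carrier_mat m m" using g by (simp add: unitary_def)
  define X where "X = C \<times> {..<m} \<times> J"
  define ip where "ip = (\<lambda>x y :: 'c \<times> nat \<times> 'i \<Rightarrow> complex. \<Sum>u\<in>X. cnj (x u) * y u)"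
  define nm where "nm = (\<lambda>x :: 'c \<times> nat \<times> 'i \<Rightarrow> complex. \<Sum>u\<in>X. (cmod (x u))\<^sup>2)"
  \<comment> \<open>The product observable of \<open>z\<close> on the label \<open>i\<close> and
    \<open>g\<close> on the label \<open>s\<close>. It preserves norms since \<open>z\<close>
    squares to 1 and \<open>g\<close> is unitary, and is Hermitian since \<open>z\<close> is real
    and \<open>g\<close> Hermitian.\<close>
  define Op where "Op = (\<lambda>x :: 'c \<times> nat \<times> 'i \<Rightarrow> complex. \<lambda>(c,s,i). of_real (z i) * (\<Sum>s'<m. g $$ (s,s') * x (c,s',i)))"
  have sX: "(\<Sum>u\<in>X. h u) = (\<Sum>c\<in>C. \<Sum>s<m. \<Sum>i\<in>J. h (c,s,i))" for h :: "_ \<Rightarrow> 'b::comm_monoid_add"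
    unfolding X_def by (simp add: sum.cartesian_product case_prod_unfold)
  have nm0: "0 \<le> nm x" for x unfolding nm_def by (simp add: sum_nonneg)
  have CS: "cmod (ip x y) \<le> sqrt (nm x) * sqrt (nm y)" for x y
    using Cauchy_Schwarz_complex_sum[of "\<lambda>u. cnj (x u)" y X] by (simp add: ip_def nm_def)
  have Opn: "nm (Op x) = nm x" for x
  proof -
    have "nm (Op x) = (\<Sum>c\<in>C. \<Sum>i\<in>J. \<Sum>s<m. (cmod (of_real (z i) * (\<Sum>s'<m. g $$ (s,s') * x (c,s',i))))\<^sup>2)"
      unfolding nm_def sX Op_def by (simp add: sum.swap[of _ _ J])
    also have "\<dots> = (\<Sum>c\<in>C. \<Sum>i\<in>J. \<Sum>s<m. (cmod (\<Sum>s'<m. g $$ (s,s') * x (c,s',i)))\<^sup>2)"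
      using z1 by (intro sum.cong refl) (simp add: norm_mult power_mult_distrib)
    also have "\<dots> = (\<Sum>c\<in>C. \<Sum>i\<in>J. \<Sum>s<m. (cmod (x (c,s,i)))\<^sup>2)"
      by (rule sum.cong[OF refl], rule sum.cong[OF refl], rule unitary_norm_preserving[OF g])
    also have "\<dots> = nm x" unfolding nm_def sX by (simp add: sum.swap[of _ _ J])
    finally show ?thesis .
  qed
  have herm: "ip x (Op y) = cnj (ip y (Op x))" for x y
  proof -
    have "ip x (Op y) = (\<Sum>c\<in>C. \<Sum>s<m. \<Sum>i\<in>J. \<Sum>s'<m. of_real (z i) * (cnj (x (c,s,i)) * g $$ (s,s') * y (c,s',i)))"
      unfolding ip_def sX Op_def by (simp add: sum_distrib_left mult_ac)
    also have "\<dots> = (\<Sum>c\<in>C. \<Sum>s'<m. \<Sum>s<m. \<Sum>i\<in>J. of_real (z i) * (cnj (x (c,s,i)) * g $$ (s,s') * y (c,s',i)))"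
      by (rule sum.cong[OF refl], rule sum_rotate)
    also have "\<dots> = (\<Sum>c\<in>C. \<Sum>s'<m. \<Sum>s<m. \<Sum>i\<in>J. cnj (of_real (z i) * (cnj (y (c,s',i)) * g $$ (s',s) * x (c,s,i))))"
    proof (intro sum.cong refl)
      fix c s s' i assume "s \<in> {..<m}" "s' \<in> {..<m}"
      then have "g $$ (s,s') = cnj (g $$ (s',s))" by (intro hermitian_index[OF gh gc]) auto
      then show "of_real (z i) * (cnj (x (c,s,i)) * g $$ (s,s') * y (c,s',i))
        = cnj (of_real (z i) * (cnj (y (c,s',i)) * g $$ (s',s) * x (c,s,i)))" by simp
    qed
    also have "\<dots> = (\<Sum>c\<in>C. \<Sum>s'<m. \<Sum>i\<in>J. \<Sum>s<m. cnj (of_real (z i) * (cnj (y (c,s',i)) * g $$ (s',s) * x (c,s,i))))"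
      by (simp add: sum.swap[of _ J])
    also have "\<dots> = cnj (ip y (Op x))"
      unfolding ip_def sX Op_def by (simp add: sum_distrib_left mult_ac)
    finally show ?thesis .
  qed
  define F where "F = (\<lambda>(c,s,i). f c s i)"
  \<comment> \<open>\<open>E\<close> is the component of \<open>F\<close> along
    \<open>\<chi>\<close>, with squared norm \<open>a\<close>; \<open>H\<close> is the orthogonal
    remainder, with squared norm \<open>1 - a\<close>.\<close>
  define E where "E = (\<lambda>(c,s,i). \<chi> i * \<eta> c s)"
  define H where "H = (\<lambda>u. F u - E u)"
  define a where "a = (\<Sum>c\<in>C. \<Sum>s<m. (cmod (\<eta> c s))\<^sup>2)"
  have F: "F u = E u + H u" for u by (simp add: H_def)
  have \<chi>1': "(\<Sum>i\<in>J. cnj (\<chi> i) * \<chi> i) = 1"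
  proof -
    have "(\<Sum>i\<in>J. cnj (\<chi> i) * \<chi> i) = of_real (\<Sum>i\<in>J. (cmod (\<chi> i))\<^sup>2)"
      unfolding of_real_sum complex_norm_square by (simp add: mult.commute)
    then show ?thesis using \<chi>1 by simp
  qed
  have nmE: "nm E = a"
    unfolding nm_def sX E_def a_def by (simp add: norm_mult power_mult_distrib sum_distrib_right[symmetric] \<chi>1)
  have nmF: "nm F = 1" unfolding nm_def sX F_def using f1 by simp
  have EH: "ip E H = 0"
  proof -
    have "ip E H = (\<Sum>c\<in>C. \<Sum>s<m. cnj (\<eta> c s) * (\<Sum>i\<in>J. cnj (\<chi> i) * (f c s i - \<chi> i * \<eta> c s)))"
      unfolding ip_def sX E_def H_def F_def by (simp add: sum_distrib_left mult_ac)
    also have "\<dots> = (\<Sum>c\<in>C. \<Sum>s<m. cnj (\<eta> c s) * (\<eta> c s - (\<Sum>i\<in>J. cnj (\<chi> i) * \<chi> i) * \<eta> c s))"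
      unfolding \<eta>_def by (simp add: right_diff_distrib sum_subtractf sum_distrib_right mult_ac)
    also have "\<dots> = 0" by (simp add: \<chi>1')
    finally show ?thesis .
  qed
  have nmip: "complex_of_real (nm x) = ip x x" for x
    unfolding nm_def ip_def of_real_sum complex_norm_square by (simp add: mult.commute)
  have HE: "ip H E = 0"
  proof -
    have "ip H E = cnj (ip E H)" unfolding ip_def by (simp add: mult.commute)
    then show ?thesis using EH by simp
  qed
  have pyth: "nm (\<lambda>u. of_real r * E u + H u) = r\<^sup>2 * a + nm H" for r
  proof -
    have "complex_of_real (nm (\<lambda>u. of_real r * E u + H u)) = of_real (r\<^sup>2) * ip E E + of_real r * ip E H + of_real r * ip H E + ip H H"
      unfolding nmip unfolding ip_def by (simp add: algebra_simps sum.distrib sum_distrib_left power2_eq_square)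
    also have "\<dots> = of_real (r\<^sup>2 * a + nm H)" by (simp add: EH HE nmip[symmetric] nmE)
    finally show ?thesis by (simp only: of_real_eq_iff)
  qed
  have aH: "a + nm H = 1"
    using pyth[of 1] nmF F by (simp add: nm_def)
  then show "a \<le> 1" using nm0[of H] by linarith
  have EE: "ip E (Op E) = 0"
  proof -
    have "ip E (Op E) = (\<Sum>c\<in>C. \<Sum>s<m. \<Sum>i\<in>J. of_real (z i * (cmod (\<chi> i))\<^sup>2) * (cnj (\<eta> c s) * (\<Sum>s'<m. g $$ (s,s') * \<eta> c s')))"
      unfolding ip_def sX E_def Op_def of_real_mult complex_norm_square
      by (simp add: sum_distrib_left mult_ac)
    also have "\<dots> = (\<Sum>c\<in>C. \<Sum>s<m. of_real (\<Sum>i\<in>J. z i * (cmod (\<chi> i))\<^sup>2) * (cnj (\<eta> c s) * (\<Sum>s'<m. g $$ (s,s') * \<eta> c s')))"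
      by (simp only: of_real_sum sum_distrib_right)
    also have "\<dots> = 0" by (simp add: \<chi>z)
    finally show ?thesis .
  qed
  have lin: "ip (\<lambda>u. x u + y u) w = ip x w + ip y w" for x y w
    unfolding ip_def by (simp add: algebra_simps sum.distrib)
  have lin2: "ip w (Op F) = ip w (Op E) + ip w (Op H)" for w
  proof -
    have "Op F u = Op E u + Op H u" for u
      unfolding Op_def by (cases u) (simp add: F algebra_simps sum.distrib)
    then show ?thesis unfolding ip_def by (simp add: algebra_simps sum.distrib)
  qed
  have Fd: "F = (\<lambda>u. E u + H u)" by (rule ext) (rule F)
  have e0: "ip F (Op F) = ip E (Op H) + cnj (ip E (Op H)) + ip H (Op H)"
  proof -
    have lF: "ip F w = ip E w + ip H w" for w using lin[of E H w] by (simp only: Fd[symmetric])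
    have "ip F (Op F) = ip E (Op E) + ip H (Op E) + (ip E (Op H) + ip H (Op H))"
      by (simp add: lF lin2 add_ac)
    then show ?thesis unfolding EE herm[of H E] by simp
  qed
  have real: "ip F (Op F) = of_real (Re (ip F (Op F)))"
    using herm[of F F] by (simp add: complex_eq_iff)
  \<comment> \<open>The two cross terms are conjugate, so they merge into one with
    \<open>2 * E\<close>, and a single Cauchy-Schwarz estimate suffices. The factor is
    \<open>sqrt (4 * a + (1 - a)) \<le> 2\<close>; estimating the terms one by one would give a
    larger constant.\<close>
  have "Re (ip F (Op F)) = Re (ip (\<lambda>u. of_real 2 * E u + H u) (Op H))"
  proof -
    have "ip (\<lambda>u. of_real 2 * E u + H u) (Op H) = 2 * ip E (Op H) + ip H (Op H)"
      unfolding ip_def by (simp add: algebra_simps sum.distrib sum_distrib_left)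
    then show ?thesis using e0 by simp
  qed
  moreover have "cmod (ip F (Op F)) = \<bar>Re (ip F (Op F))\<bar>"
    using arg_cong[OF real, of cmod] by (simp only: norm_of_real)
  ultimately have "cmod (ip F (Op F)) \<le> cmod (ip (\<lambda>u. of_real 2 * E u + H u) (Op H))"
    using abs_Re_le_cmod[of "ip (\<lambda>u. of_real 2 * E u + H u) (Op H)"] by linarith
  also have "\<dots> \<le> sqrt (4 * a + nm H) * sqrt (nm H)"
    using CS[of "\<lambda>u. of_real 2 * E u + H u" "Op H"] unfolding Opn pyth by simp
  also have "\<dots> \<le> 2 * sqrt (nm H)"
  proof (rule mult_right_mono)
    have "sqrt (4 * a + nm H) \<le> sqrt (2\<^sup>2)" using aH nm0[of H] by (intro real_sqrt_le_mono) simp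
    then show "sqrt (4 * a + nm H) \<le> 2" by simp
  qed (use nm0 in simp)
  also have "nm H = 1 - a" using aH by simp
  finally have "cmod (ip F (Op F)) \<le> 2 * sqrt (1 - a)" .
  then show "cmod (\<Sum>c\<in>C. \<Sum>s<m. \<Sum>i\<in>J. cnj (f c s i) * (of_real (z i) * (\<Sum>s'<m. g $$ (s,s') * f c s' i))) \<le> 2 * sqrt (1 - a)"
    unfolding ip_def sX F_def Op_def by simp
qed

section \<open>Channels in operator-sum form\<close>

lemma foldr_add_mat_carrier:
  assumes "\<And>K. K \<in> set Ks \<Longrightarrow> h K \<in> carrier_mat r c"
  shows "foldr (+) (map h Ks) (0\<^sub>m r c) \<in> carrier_mat r c"
  using assms by (induction Ks) auto

lemma foldr_add_mat_index:
  assumes "\<And>K. K \<in> set Ks \<Longrightarrow> h K \<in> carrier_mat r c" "i < r" "j < c"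
  shows "foldr (+) (map h Ks) (0\<^sub>m r c) $$ (i,j) = (\<Sum>t<length Ks. h (Ks ! t) $$ (i,j))"
  using assms(1)
proof (induction Ks)
  case (Cons K Ks)
  have c: "foldr (+) (map h Ks) (0\<^sub>m r c) \<in> carrier_mat r c" using Cons.prems by (intro foldr_add_mat_carrier) auto
  have "foldr (+) (map h (K # Ks)) (0\<^sub>m r c) $$ (i,j) = h K $$ (i,j) + foldr (+) (map h Ks) (0\<^sub>m r c) $$ (i,j)"
    using c assms(2,3) by simp
  also have "\<dots> = (\<Sum>t<length (K # Ks). h ((K # Ks) ! t) $$ (i,j))"
    using Cons by (simp add: sum.lessThan_Suc_shift del: sum.lessThan_Suc)
  finally show ?case .
qed (use assms in simp)

lemma sandwich_index:
  assumes "K \<in> carrier_mat r c" "\<rho> \<in> carrier_mat c c" "p < r" "q < r"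
  shows "(K * \<rho> * adj K) $$ (p,q) = (\<Sum>a<c. \<Sum>b<c. K $$ (p,a) * \<rho> $$ (a,b) * cnj (K $$ (q,b)))"
proof -
  have "(K * \<rho> * adj K) $$ (p,q) = (\<Sum>b<c. (\<Sum>a<c. K $$ (p,a) * \<rho> $$ (a,b)) * adj K $$ (b,q))"
    unfolding mat_mult_sum[OF mult_carrier_mat[OF assms(1,2)] adj_carrier[OF assms(1)] assms(3,4)]
    by (rule sum.cong[OF refl], subst mat_mult_sum[OF assms(1,2,3)]) auto
  also have "\<dots> = (\<Sum>b<c. \<Sum>a<c. K $$ (p,a) * \<rho> $$ (a,b) * cnj (K $$ (q,b)))"
    unfolding sum_distrib_right using assms by (intro sum.cong refl) auto
  also have "\<dots> = (\<Sum>a<c. \<Sum>b<c. K $$ (p,a) * \<rho> $$ (a,b) * cnj (K $$ (q,b)))" by (rule sum.swap)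
  finally show ?thesis .
qed

text \<open>Entrywise form with numbered Kraus operators, so that their index can serve as an
  environment label.\<close>

lemma kraus_channelE:
  assumes "kraus_channel din dout R"
  obtains J :: nat and K where "\<And>j. j < J \<Longrightarrow> K j \<in> carrier_mat dout din"
    "\<And>a b. a < din \<Longrightarrow> b < din \<Longrightarrow> (\<Sum>j<J. \<Sum>p<dout. cnj (K j $$ (p,a)) * K j $$ (p,b)) = (if a = b then 1 else 0)"
    "\<And>\<rho> p q. \<rho> \<in> carrier_mat din din \<Longrightarrow> p < dout \<Longrightarrow> q < dout \<Longrightarrow>
       R \<rho> $$ (p,q) = (\<Sum>j<J. \<Sum>a<din. \<Sum>b<din. K j $$ (p,a) * \<rho> $$ (a,b) * cnj (K j $$ (q,b)))"
proof -
  obtain Ks where Ks: "set Ks \<subseteq> carrier_mat dout din"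
    "foldr (+) (map (\<lambda>K. adj K * K) Ks) (0\<^sub>m din din) = 1\<^sub>m din"
    "\<And>\<rho>. \<rho> \<in> carrier_mat din din \<Longrightarrow> R \<rho> = foldr (+) (map (\<lambda>K. K * \<rho> * adj K) Ks) (0\<^sub>m dout dout)"
    using assms unfolding kraus_channel_def by blast
  have kc: "Ks ! j \<in> carrier_mat dout din" if "j < length Ks" for j using Ks(1) that nth_mem by blast
  show ?thesis
  proof (rule that[of "length Ks" "\<lambda>j. Ks ! j"])
    fix a b assume ab: "a < din" "b < din"
    have c: "K \<in> set Ks \<Longrightarrow> adj K * K \<in> carrier_mat din din" for K
      using Ks(1) mult_carrier_mat[OF adj_carrier] by blast
    have "(if a = b then 1 else 0) = (\<Sum>j<length Ks. (adj (Ks ! j) * Ks ! j) $$ (a,b))"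
      using foldr_add_mat_index[of Ks "\<lambda>K. adj K * K" din din a b, OF c ab] unfolding Ks(2) using ab by simp
    also have "\<dots> = (\<Sum>j<length Ks. \<Sum>p<dout. cnj (Ks ! j $$ (p,a)) * Ks ! j $$ (p,b))"
    proof (rule sum.cong[OF refl])
      fix j assume "j \<in> {..<length Ks}"
      then have k: "Ks ! j \<in> carrier_mat dout din" using kc by simp
      show "(adj (Ks ! j) * Ks ! j) $$ (a,b) = (\<Sum>p<dout. cnj (Ks ! j $$ (p,a)) * Ks ! j $$ (p,b))"
        unfolding mat_mult_sum[OF adj_carrier[OF k] k ab] using k ab by (intro sum.cong refl) auto
    qed
    finally show "(\<Sum>j<length Ks. \<Sum>p<dout. cnj (Ks ! j $$ (p,a)) * Ks ! j $$ (p,b)) = (if a = b then 1 else 0)" by simp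
  next
    fix \<rho> :: cmat and p q :: nat assume \<rho>: "\<rho> \<in> carrier_mat din din" and pq: "p < dout" "q < dout"
    have c: "K * \<rho> * adj K \<in> carrier_mat dout dout" if "K \<in> set Ks" for K
    proof -
      have K: "K \<in> carrier_mat dout din" using Ks(1) that by blast
      show ?thesis by (rule mult_carrier_mat[OF mult_carrier_mat[OF K \<rho>] adj_carrier[OF K]])
    qed
    have "R \<rho> $$ (p,q) = (\<Sum>j<length Ks. (Ks ! j * \<rho> * adj (Ks ! j)) $$ (p,q))"
      unfolding Ks(3)[OF \<rho>] by (rule foldr_add_mat_index[of Ks "\<lambda>K. K * \<rho> * adj K", OF c pq])
    also have "\<dots> = (\<Sum>j<length Ks. \<Sum>a<din. \<Sum>b<din. Ks ! j $$ (p,a) * \<rho> $$ (a,b) * cnj (Ks ! j $$ (q,b)))"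
      using sandwich_index[OF kc \<rho> pq] by (intro sum.cong refl) auto
    finally show "R \<rho> $$ (p,q) = (\<Sum>j<length Ks. \<Sum>a<din. \<Sum>b<din. Ks ! j $$ (p,a) * \<rho> $$ (a,b) * cnj (Ks ! j $$ (q,b)))" .
  qed (use kc in auto)
qed

text \<open>The infimum over recoveries must range over a nonempty set. The witness discards its
  input and outputs the first basis state; its Kraus operators each send one basis vector
  there.\<close>

lemma kraus_channel_exists:
  assumes "0 < dout" shows "\<exists>R. kraus_channel din dout R"
proof -
  define E where "E = (\<lambda>a. mat dout din (\<lambda>(i,j). if i = 0 \<and> j = a then (1::complex) else 0))"
  have Ec: "E a \<in> carrier_mat dout din" for a by (simp add: E_def)
  define Ks where "Ks = map E [0..<din]"
  have "foldr (+) (map (\<lambda>K. adj K * K) Ks) (0\<^sub>m din din) = 1\<^sub>m din"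
  proof (rule eq_matI)
    fix i j assume "i < dim_row (1\<^sub>m din)" "j < dim_col (1\<^sub>m din)"
    then have ij: "i < din" "j < din" by auto
    have c: "K \<in> set Ks \<Longrightarrow> adj K * K \<in> carrier_mat din din" for K
      using mult_carrier_mat[OF adj_carrier[OF Ec] Ec] unfolding Ks_def by auto
    have "foldr (+) (map (\<lambda>K. adj K * K) Ks) (0\<^sub>m din din) $$ (i,j) = (\<Sum>t<length Ks. (adj (Ks ! t) * Ks ! t) $$ (i,j))"
      by (rule foldr_add_mat_index[of Ks "\<lambda>K. adj K * K", OF c ij])
    also have "\<dots> = (\<Sum>t<din. if t = i \<and> t = j then 1 else 0)"
    proof (rule sum.cong)
      fix t assume "t \<in> {..<din}"
      then have t: "t < din" "Ks ! t = E t" by (auto simp: Ks_def)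
      have "(adj (E t) * E t) $$ (i,j) = (\<Sum>p<dout. if p = 0 then (if t = i \<and> t = j then 1 else 0) else 0)"
        unfolding mat_mult_sum[OF adj_carrier[OF Ec] Ec ij] using ij Ec
        by (intro sum.cong refl) (auto simp: E_def)
      then show "(adj (Ks ! t) * Ks ! t) $$ (i,j) = (if t = i \<and> t = j then 1 else 0)" using assms t(2) by simp
    qed (simp add: Ks_def)
    also have "\<dots> = (\<Sum>t<din. if t = i then (if i = j then 1 else 0) else 0)" by (intro sum.cong) auto
    also have "\<dots> = 1\<^sub>m din $$ (i,j)" using ij by simp
    finally show "foldr (+) (map (\<lambda>K. adj K * K) Ks) (0\<^sub>m din din) $$ (i,j) = 1\<^sub>m din $$ (i,j)" .
  next
    have "foldr (+) (map (\<lambda>K. adj K * K) Ks) (0\<^sub>m din din) \<in> carrier_mat din din"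
      using mult_carrier_mat[OF adj_carrier[OF Ec] Ec] unfolding Ks_def by (intro foldr_add_mat_carrier) auto
    then show "dim_row (foldr (+) (map (\<lambda>K. adj K * K) Ks) (0\<^sub>m din din)) = dim_row (1\<^sub>m din)"
      "dim_col (foldr (+) (map (\<lambda>K. adj K * K) Ks) (0\<^sub>m din din)) = dim_col (1\<^sub>m din)" by auto
  qed
  moreover have "set Ks \<subseteq> carrier_mat dout din" using Ec by (auto simp: Ks_def)
  ultimately show ?thesis unfolding kraus_channel_def
    by (intro exI[of _ "\<lambda>\<rho>. foldr (+) (map (\<lambda>K. K * \<rho> * adj K) Ks) (0\<^sub>m dout dout)"] exI[of _ Ks]) auto
qed

text \<open>The amplitude of \<open>w\<close> at \<open>s\<close> on \<open>S\<close> and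
  \<open>y\<close> on the rest. By \<open>sub_idx_bij\<close> the sum has one matching index for
  valid \<open>s\<close> and \<open>y\<close>, and so replaces an explicit inverse of that
  bijection.\<close>

definition block :: "nat \<Rightarrow> nat set \<Rightarrow> (nat \<Rightarrow> complex) \<Rightarrow> nat \<Rightarrow> nat \<Rightarrow> complex" where
  "block n S w s y = (\<Sum>a<2^n. if sub_idx S a = s \<and> sub_idx ({0..<n} - S) a = y then w a else 0)"

lemma block_sub_idx:
  assumes S: "S \<subseteq> {0..<n}" and a: "a < 2^n"
  shows "block n S w (sub_idx S a) (sub_idx ({0..<n} - S) a) = w a"
proof -
  have "sub_idx S b = sub_idx S a \<and> sub_idx ({0..<n} - S) b = sub_idx ({0..<n} - S) a \<longleftrightarrow> b = a" if "b < 2^n" for b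
    using inj_onD[OF bij_betw_imp_inj_on[OF sub_idx_bij[OF S]], of b a] that a by auto
  then have "block n S w (sub_idx S a) (sub_idx ({0..<n} - S) a) = (\<Sum>b<2^n. if b = a then w b else 0)"
    unfolding block_def by (intro sum.cong refl) auto
  then show ?thesis using a by simp
qed

lemma sum_block:
  assumes S: "S \<subseteq> {0..<n}"
  shows "(\<Sum>s<2 ^ card S. \<Sum>y<2 ^ card ({0..<n} - S). h s y (block n S w s y))
    = (\<Sum>a<2^n. h (sub_idx S a) (sub_idx ({0..<n} - S) a) (w a))"
  unfolding sum_sub_idx[OF S, of "\<lambda>s y. h s y (block n S w s y)", symmetric]
  using block_sub_idx[OF S] by (intro sum.cong refl) auto

text \<open>An observable on \<open>S\<close> sees only the Gram matrix of the blocks over the rest,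
  that is, the marginal on \<open>S\<close>.\<close>

lemma quad_form_block:
  assumes S: "S \<subseteq> {0..<n}"
    and eq: "\<And>a b. a < 2^n \<Longrightarrow> b < 2^n \<Longrightarrow> G $$ (a,b) =
      (if sub_idx ({0..<n} - S) a = sub_idx ({0..<n} - S) b then g $$ (sub_idx S a, sub_idx S b) else 0)"
  shows "quad_form (2^n) G w = (\<Sum>s<2 ^ card S. \<Sum>s'<2 ^ card S. g $$ (s,s') *
    (\<Sum>y<2 ^ card ({0..<n} - S). cnj (block n S w s y) * block n S w s' y))"
proof -
  let ?T = "{0..<n} - S"
  have "quad_form (2^n) G w = (\<Sum>a<2^n. \<Sum>b<2^n. if sub_idx ?T b = sub_idx ?T a
      then cnj (w a) * g $$ (sub_idx S a, sub_idx S b) * w b else 0)"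
    unfolding quad_form_def by (intro sum.cong refl) (auto simp: eq)
  also have "\<dots> = (\<Sum>a<2^n. \<Sum>s'<2 ^ card S. \<Sum>y'<2 ^ card ?T. if y' = sub_idx ?T a
      then cnj (w a) * g $$ (sub_idx S a, s') * block n S w s' y' else 0)"
    by (rule sum.cong[OF refl], rule sum_block[OF S, symmetric])
  also have "\<dots> = (\<Sum>a<2^n. \<Sum>s'<2 ^ card S. cnj (w a) * g $$ (sub_idx S a, s') * block n S w s' (sub_idx ?T a))"
    using sub_idx_less[of ?T] by (intro sum.cong refl) simp
  also have "\<dots> = (\<Sum>s<2 ^ card S. \<Sum>y<2 ^ card ?T. \<Sum>s'<2 ^ card S. cnj (block n S w s y) * g $$ (s, s') * block n S w s' y)"
    by (rule sum_block[OF S, symmetric])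
  also have "\<dots> = (\<Sum>s<2 ^ card S. \<Sum>s'<2 ^ card S. \<Sum>y<2 ^ card ?T. cnj (block n S w s y) * g $$ (s, s') * block n S w s' y)"
    by (rule sum.cong[OF refl], rule sum.swap)
  finally show ?thesis by (simp add: sum_distrib_left mult_ac)
qed

text \<open>Operator-sum form of the replacement: \<open>s\<close> labels the values of the erased
  qubits that are traced out, \<open>i\<close> purifies the inserted state, which factors as
  \<open>B\<close> times its adjoint.\<close>

lemma replacement_rank_one:
  assumes S: "S \<subseteq> {0..<n}" and ab: "a < 2^n" "b < 2^n"
    and B: "\<And>x y. x < 2 ^ card S \<Longrightarrow> y < 2 ^ card S \<Longrightarrow> \<gamma> $$ (x,y) = (\<Sum>i<2 ^ card S. B $$ (x,i) * cnj (B $$ (y,i)))"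
  defines "W \<equiv> block n S"
  shows "replacement n S \<gamma> (mat (2^n) (2^n) (\<lambda>(a,b). w a * cnj (w' b))) $$ (a,b) =
    (\<Sum>i<2 ^ card S. \<Sum>s<2 ^ card S. (B $$ (sub_idx S a, i) * W w s (sub_idx ({0..<n} - S) a)) *
        cnj (B $$ (sub_idx S b, i) * W w' s (sub_idx ({0..<n} - S) b)))"
proof -
  let ?T = "{0..<n} - S" and ?m = "(2::nat) ^ card S"
  have f: "finite S" "finite ?T" using S finite_subset by auto
  have ST: "{0..<n} - ?T = S" using S by auto
  let ?x = "sub_idx ?T a" and ?y = "sub_idx ?T b"
  have xy: "?x < 2 ^ card ?T" "?y < 2 ^ card ?T" using sub_idx_less[OF f(2)] by auto
  let ?\<rho> = "mat (2^n) (2^n) (\<lambda>(a,b). w a * cnj (w' b))"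
  have "ptrace_keep n ?T ?\<rho> $$ (?x,?y) = (\<Sum>c<2^n. \<Sum>d<2^n.
      if sub_idx ?T c = ?x \<and> sub_idx ?T d = ?y \<and> sub_idx S c = sub_idx S d then w c * cnj (w' d) else 0)"
    unfolding ptrace_keep_index[OF xy] ST by (intro sum.cong refl) auto
  also have "\<dots> = (\<Sum>c<2^n. \<Sum>d<2^n. \<Sum>s<?m. (if sub_idx S c = s \<and> sub_idx ?T c = ?x then w c else 0) *
      cnj (if sub_idx S d = s \<and> sub_idx ?T d = ?y then w' d else 0))"
  proof (intro sum.cong refl)
    fix c d :: nat
    have "(\<Sum>s<?m. (if sub_idx S c = s \<and> sub_idx ?T c = ?x then w c else 0) *
      cnj (if sub_idx S d = s \<and> sub_idx ?T d = ?y then w' d else 0)) = (\<Sum>s<?m. if s = sub_idx S c then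
      (if sub_idx ?T c = ?x \<and> sub_idx ?T d = ?y \<and> sub_idx S c = sub_idx S d then w c * cnj (w' d) else 0) else 0)"
      by (intro sum.cong refl) auto
    also have "\<dots> = (if sub_idx ?T c = ?x \<and> sub_idx ?T d = ?y \<and> sub_idx S c = sub_idx S d then w c * cnj (w' d) else 0)"
      using sub_idx_less[OF f(1), of c] by simp
    finally show "(if sub_idx ?T c = ?x \<and> sub_idx ?T d = ?y \<and> sub_idx S c = sub_idx S d then w c * cnj (w' d) else 0)
      = (\<Sum>s<?m. (if sub_idx S c = s \<and> sub_idx ?T c = ?x then w c else 0) *
      cnj (if sub_idx S d = s \<and> sub_idx ?T d = ?y then w' d else 0))" by simp
  qed
  also have "\<dots> = (\<Sum>s<?m. \<Sum>c<2^n. \<Sum>d<2^n. (if sub_idx S c = s \<and> sub_idx ?T c = ?x then w c else 0) *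
      cnj (if sub_idx S d = s \<and> sub_idx ?T d = ?y then w' d else 0))"
    by (rule sum_rotate)
  also have "\<dots> = (\<Sum>s<?m. W w s ?x * cnj (W w' s ?y))"
    unfolding W_def block_def cnj_sum sum_product ..
  finally have tau: "ptrace_keep n ?T ?\<rho> $$ (?x,?y) = (\<Sum>s<?m. W w s ?x * cnj (W w' s ?y))" .
  have "replacement n S \<gamma> ?\<rho> $$ (a,b) = ptrace_keep n ?T ?\<rho> $$ (?x,?y) * \<gamma> $$ (sub_idx S a, sub_idx S b)"
    using ab by (simp add: replacement_def Let_def)
  also have "\<dots> = (\<Sum>i<?m. B $$ (sub_idx S a,i) * cnj (B $$ (sub_idx S b,i))) * (\<Sum>s<?m. W w s ?x * cnj (W w' s ?y))"
    unfolding tau using B sub_idx_less[OF f(1)] by (simp add: mult.commute)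
  also have "\<dots> = (\<Sum>i<?m. \<Sum>s<?m. (B $$ (sub_idx S a, i) * W w s ?x) * cnj (B $$ (sub_idx S b, i) * W w' s ?y))"
    unfolding sum_product by (intro sum.cong refl) (simp add: mult_ac)
  finally show ?thesis .
qed

text \<open>Splits a joint index by the reference qubit, the minor index in \<open>tensor_id\<close>
  with a two-dimensional reference.\<close>

lemma sum_pairs: "(\<Sum>i<D*2. h i) = (\<Sum>p<D. h (p*2+0)) + (\<Sum>p<D. h (p*2+1))" for h :: "nat \<Rightarrow> 'a::comm_monoid_add"
  by (induction D) (simp_all add: add_ac)

text \<open>Stacked over \<open>j\<close>, the Kraus operators form an isometry, so they preserve
  inner products.\<close>

lemma kraus_inner:
  assumes "\<And>a b. a < N \<Longrightarrow> b < N \<Longrightarrow> (\<Sum>j<J. \<Sum>p<D. cnj (K j $$ (p,a)) * K j $$ (p,b)) = (if a = b then 1 else 0)"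
  shows "(\<Sum>j<J. \<Sum>p<D. cnj (\<Sum>a<N. K j $$ (p,a) * x a) * (\<Sum>b<N. K j $$ (p,b) * y b)) = (\<Sum>a<N. cnj (x a) * y a)"
proof -
  have "(\<Sum>j<J. \<Sum>p<D. cnj (\<Sum>a<N. K j $$ (p,a) * x a) * (\<Sum>b<N. K j $$ (p,b) * y b))
     = (\<Sum>j<J. \<Sum>p<D. \<Sum>a<N. \<Sum>b<N. cnj (x a) * y b * (cnj (K j $$ (p,a)) * K j $$ (p,b)))"
    unfolding cnj_sum sum_product by (intro sum.cong refl) (simp add: mult_ac)
  also have "\<dots> = (\<Sum>a<N. \<Sum>j<J. \<Sum>p<D. \<Sum>b<N. cnj (x a) * y b * (cnj (K j $$ (p,a)) * K j $$ (p,b)))"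
    by (rule sum_rotate)
  also have "\<dots> = (\<Sum>a<N. \<Sum>b<N. \<Sum>j<J. \<Sum>p<D. cnj (x a) * y b * (cnj (K j $$ (p,a)) * K j $$ (p,b)))"
    by (rule sum.cong[OF refl], rule sum_rotate)
  also have "\<dots> = (\<Sum>a<N. \<Sum>b<N. cnj (x a) * y b * (if a = b then 1 else 0))"
    unfolding sum_distrib_left[symmetric] using assms by (intro sum.cong refl) auto
  also have "\<dots> = (\<Sum>a<N. cnj (x a) * y a)"
    by (intro sum.cong refl) (simp add: if_distrib[of "\<lambda>x. _ * x"] cong: if_cong)
  finally show ?thesis .
qed

lemma isometry_columns:
  assumes V: "V \<in> carrier_mat N D" "adj V * V = 1\<^sub>m D" and ll: "l < D" "l' < D"
  shows "(\<Sum>a<N. cnj (V $$ (a,l)) * V $$ (a,l')) = (if l = l' then 1 else 0)"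
proof -
  have "(adj V * V) $$ (l,l') = (\<Sum>p<N. cnj (V $$ (p,l)) * V $$ (p,l'))"
    unfolding mat_mult_sum[OF adj_carrier[OF V(1)] V(1) ll] using V ll by (intro sum.cong refl) auto
  then show ?thesis unfolding V(2) using ll by simp
qed

lemma isometry_norm:
  assumes V: "V \<in> carrier_mat N D" "adj V * V = 1\<^sub>m D" and \<phi>: "\<phi> \<in> carrier_vec D"
  shows "(\<Sum>a<N. cnj ((V *\<^sub>v \<phi>) $ a) * (V *\<^sub>v \<phi>) $ a) = (\<Sum>l<D. cnj (\<phi> $ l) * \<phi> $ l)"
proof -
  \<comment> \<open>An isometry is a channel with the single Kraus operator
    \<open>V\<close>.\<close>
  have "(\<Sum>j<(1::nat). \<Sum>p<N. cnj (V $$ (p,a)) * V $$ (p,b)) = (if a = b then 1 else 0)" if "a < D" "b < D" for a b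
    using isometry_columns[OF V that] by simp
  from kraus_inner[where N=D and J=1 and D=N and K="\<lambda>_. V" and x="\<lambda>l. \<phi> $ l" and y="\<lambda>l. \<phi> $ l", OF this]
  show ?thesis using mat_vec_sum[OF V(1) \<phi>] by simp
qed

section \<open>Channel fidelity and its evaluation on an entangled test input\<close>

lemma chan_fid_nonneg: "0 \<le> chan_fid din dout M1 M2" if "density din \<rho>"
  unfolding chan_fid_def
proof (rule cInf_greatest)
  have "density (din * 1) \<rho>" using that by simp
  then show "{fidelity (tensor_id din dout m M1 \<rho>) (tensor_id din dout m M2 \<rho>) | m \<rho>.
      1 \<le> m \<and> density (din * m) \<rho>} \<noteq> {}" using le_refl[of "1::nat"] by blast
qed (auto simp: fidelity_def trace_norm_nonneg)

lemma chan_fid_le: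
  assumes "1 \<le> m" "density (din * m) \<rho>"
  shows "chan_fid din dout M1 M2 \<le> fidelity (tensor_id din dout m M1 \<rho>) (tensor_id din dout m M2 \<rho>)"
  unfolding chan_fid_def
proof (rule cInf_lower)
  show "bdd_below {fidelity (tensor_id din dout m M1 \<rho>) (tensor_id din dout m M2 \<rho>) | m \<rho>.
      1 \<le> m \<and> density (din * m) \<rho>}"
    by (rule bdd_belowI[of _ 0]) (auto simp: fidelity_def trace_norm_nonneg)
qed (use assms in blast)

lemma tensor_id_id:
  assumes "\<rho> \<in> carrier_mat (D * m) (D * m)" "0 < m"
  shows "tensor_id D D m id \<rho> = \<rho>"
proof (rule eq_matI)
  fix i j assume "i < dim_row \<rho>" "j < dim_col \<rho>"
  then have ij: "i < D * m" "j < D * m" using assms by auto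
  then have "i div m < D" "j div m < D" using assms(2) by (auto simp: less_mult_imp_div_less)
  then show "tensor_id D D m id \<rho> $$ (i,j) = \<rho> $$ (i,j)" using ij by (simp add: tensor_id_def Let_def)
qed (use assms in \<open>auto simp: tensor_id_def Let_def\<close>)

lemma density_outer:
  assumes "v \<in> carrier_vec D" "v \<bullet>c v = 1"
  shows "density D (outer v)"
proof -
  have "mtrace (outer v) = v \<bullet>c v"
    unfolding mtrace_sum[OF outer_carrier[OF assms(1)]] cscalar_prod_sum[OF assms(1)]
    using assms(1) by (intro sum.cong refl) auto
  then show ?thesis using assms psd_outer by (simp add: density_def)
qed

text \<open>Good recovery on a test input entangled with a reference qubit means that the erased
  register carries no information about the reference. The observable \<open>G\<close> acts on that
  register before it is replaced, so its expectation can hardly depend on the reference value. The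
  bounds on \<open>P\<close> serve the extrema taken later.\<close>

lemma replacement_decoupling:
  assumes V: "V \<in> carrier_mat (2^n) (2^k)" "adj V * V = 1\<^sub>m (2^k)"
    and S: "S \<subseteq> {0..<n}" and \<gamma>: "density (2 ^ card S) \<gamma>" and R: "kraus_channel (2^n) (2^k) R"
    and G: "supported n S G" "unitary (2^n) G" "adj G = G"
    and \<phi>: "\<And>r. r < 2 \<Longrightarrow> \<phi> r \<in> carrier_vec (2^k)" "\<And>r. r < (2::nat) \<Longrightarrow> \<phi> r \<bullet>c \<phi> r = 1"
  defines "P \<equiv> purified_dist (2^k) (2^k) (R \<circ> replacement n S \<gamma> \<circ> encoding V) id"
  shows "0 \<le> P" "P \<le> 1"
    "cmod (quad_form (2^n) G (\<lambda>a. (V *\<^sub>v \<phi> 0) $ a) - quad_form (2^n) G (\<lambda>a. (V *\<^sub>v \<phi> 1) $ a)) \<le> 4 * P"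
proof -
  define m where "m = (2::nat) ^ card S"
  define D where "D = (2::nat) ^ k"
  define N where "N = (2::nat) ^ n"
  define T where "T = {0..<n} - S"
  note defs = m_def[symmetric] D_def[symmetric] N_def[symmetric] T_def[symmetric]
  have Vc: "V \<in> carrier_mat N D" "adj V * V = 1\<^sub>m D" using V by (simp_all add: defs)
  have r0: "(0::nat) < 2" and r1: "(1::nat) < 2" by auto
  obtain g where g: "g \<in> carrier_mat m m"
    and eq: "\<And>a b. a < 2^n \<Longrightarrow> b < 2^n \<Longrightarrow> G $$ (a,b) =
      (if sub_idx ({0..<n} - S) a = sub_idx ({0..<n} - S) b then g $$ (sub_idx S a, sub_idx S b) else 0)"
    using supported_repr[OF G(1) unitary_carrier[OF G(2)] S] unfolding m_def by blast
  have gu: "unitary m g" unfolding m_def by (rule supported_repr_unitary[OF G(2) S g[unfolded m_def] eq])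
  have gh: "adj g = g"
  proof (rule eq_matI)
    fix x y assume "x < dim_row g" "y < dim_col g"
    then have xy: "x < m" "y < m" using g by auto
    have p: "(0::nat) < 2 ^ card ({0..<n} - S)" by simp
    obtain a where a: "a < 2^n" "sub_idx S a = x" "sub_idx ({0..<n} - S) a = 0" using sub_idx_obtain[OF S xy(1)[unfolded m_def] p] .
    obtain b where b: "b < 2^n" "sub_idx S b = y" "sub_idx ({0..<n} - S) b = 0" using sub_idx_obtain[OF S xy(2)[unfolded m_def] p] .
    have "G $$ (b,a) = cnj (G $$ (a,b))" by (rule hermitian_index[OF G(3) unitary_carrier[OF G(2)] a(1) b(1)])
    then have "g $$ (y,x) = cnj (g $$ (x,y))" using eq[OF a(1) b(1)] eq[OF b(1) a(1)] a b by simp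
    then show "adj g $$ (x,y) = g $$ (x,y)" using xy g by simp
  qed (use g in auto)
  have \<gamma>c: "\<gamma> \<in> carrier_mat m m" "psd \<gamma>" "mtrace \<gamma> = 1" using \<gamma> by (auto simp: density_def m_def)
  \<comment> \<open>Factors \<open>\<gamma>\<close> as \<open>B\<close> times its adjoint; the
    column index becomes the environment label that purifies the inserted state.\<close>
  define B where "B = msqrt \<gamma>"
  note Bp = msqrt_psd[OF \<gamma>c(2,1), folded B_def]
  have B: "\<gamma> $$ (x,y) = (\<Sum>i<m. B $$ (x,i) * cnj (B $$ (y,i)))" if "x < m" "y < m" for x y
  proof -
    have "\<gamma> $$ (x,y) = (\<Sum>i<m. B $$ (x,i) * B $$ (i,y))" using mat_mult_sum[OF Bp(2,2) that] Bp(3) by simp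
    also have "\<dots> = (\<Sum>i<m. B $$ (x,i) * cnj (B $$ (y,i)))"
    proof (intro sum.cong refl)
      fix i assume "i \<in> {..<m}"
      then have "B $$ (i,y) = cnj (B $$ (y,i))"
        using that by (intro hermitian_index[OF psd_hermitian[OF Bp(1,2)] Bp(2)]) auto
      then show "B $$ (x,i) * B $$ (i,y) = B $$ (x,i) * cnj (B $$ (y,i))" by (simp only:)
    qed
    finally show ?thesis .
  qed
  have Btr: "(\<Sum>x<m. \<Sum>i<m. cnj (B $$ (x,i)) * B $$ (x,i)) = 1"
    using \<gamma>c(3) B unfolding mtrace_sum[OF \<gamma>c(1)] by (simp add: mult.commute)
  obtain J :: nat and K where Kc: "\<And>j. j < J \<Longrightarrow> K j \<in> carrier_mat D N"
    and Kone: "\<And>a b. a < N \<Longrightarrow> b < N \<Longrightarrow> (\<Sum>j<J. \<Sum>p<D. cnj (K j $$ (p,a)) * K j $$ (p,b)) = (if a = b then 1 else 0)"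
    and Kact: "\<And>\<rho> p q. \<rho> \<in> carrier_mat N N \<Longrightarrow> p < D \<Longrightarrow> q < D \<Longrightarrow>
       R \<rho> $$ (p,q) = (\<Sum>j<J. \<Sum>a<N. \<Sum>b<N. K j $$ (p,a) * \<rho> $$ (a,b) * cnj (K j $$ (q,b)))"
    by (rule kraus_channelE[OF R[folded D_def N_def]]) (rule that)
  \<comment> \<open>The test input \<open>(|\<phi> 0>|0> + |\<phi> 1>|1>) / sqrt 2\<close>,
    reference qubit last. The two branches have equal weight, so the reference sign has mean
    0.\<close>
  define \<chi> where "\<chi> = vec (D*2) (\<lambda>I. \<phi> (I mod 2) $ (I div 2) / of_real (sqrt 2))"
  have \<chi>c: "\<chi> \<in> carrier_vec (D*2)" by (simp add: \<chi>_def)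
  have \<chi>i: "\<chi> $ (l*2+r) = \<phi> r $ l / of_real (sqrt 2)" if "l < D" "r < 2" for l r
    using that by (simp add: \<chi>_def)
  have s2: "complex_of_real (sqrt 2) * complex_of_real (sqrt 2) = 2" by (simp flip: of_real_mult)
  have half: "cnj (x / of_real (sqrt 2)) * (y / of_real (sqrt 2)) = (cnj x * y) / 2" for x y :: complex
    by (simp add: s2)
  have \<phi>n: "(\<Sum>l<D. cnj (\<phi> r $ l) * \<phi> r $ l) = 1" if "r < 2" for r
    using \<phi>[OF that] cscalar_prod_sum[of "\<phi> r" D "\<phi> r"] unfolding D_def by (simp add: mult.commute)
  have nrm: "(\<Sum>l<D. cnj (\<chi> $ (l*2+r)) * \<chi> $ (l*2+r)) = 1/2" if "r < 2" for r
  proof -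
    have "(\<Sum>l<D. cnj (\<chi> $ (l*2+r)) * \<chi> $ (l*2+r)) = (\<Sum>l<D. (cnj (\<phi> r $ l) * \<phi> r $ l) / 2)"
    proof (intro sum.cong refl)
      fix l assume "l \<in> {..<D}"
      then have "l < D" by simp
      then show "cnj (\<chi> $ (l*2+r)) * \<chi> $ (l*2+r) = (cnj (\<phi> r $ l) * \<phi> r $ l) / 2"
        using that by (simp only: \<chi>i half)
    qed
    then show ?thesis unfolding sum_divide_distrib[symmetric] \<phi>n[OF that] .
  qed
  have sqm: "complex_of_real ((cmod x)\<^sup>2) = cnj x * x" for x by (simp only: complex_norm_square mult.commute)
  have nrmr: "(\<Sum>l<D. (cmod (\<chi> $ (l*2+r)))\<^sup>2) = 1/2" if "r < 2" for r
  proof -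
    have "complex_of_real (\<Sum>l<D. (cmod (\<chi> $ (l*2+r)))\<^sup>2) = of_real (1/2)"
      unfolding of_real_sum sqm nrm[OF that] by simp
    then show ?thesis by (simp only: of_real_eq_iff)
  qed
  have \<chi>1: "\<chi> \<bullet>c \<chi> = 1"
  proof -
    have "\<chi> \<bullet>c \<chi> = (\<Sum>I<D*2. cnj (\<chi> $ I) * \<chi> $ I)" unfolding cscalar_prod_sum[OF \<chi>c] by (simp add: mult.commute)
    then show ?thesis unfolding sum_pairs nrm[OF r0] nrm[OF r1] by simp
  qed
  define w where "w = (\<lambda>r a. \<Sum>l<D. V $$ (a,l) * \<chi> $ (l*2+r))"
  have w: "w r a = (V *\<^sub>v \<phi> r) $ a / of_real (sqrt 2)" if "r < 2" "a < N" for r a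
  proof -
    have "w r a = (\<Sum>l<D. V $$ (a,l) * \<phi> r $ l / of_real (sqrt 2))"
      unfolding w_def using that by (intro sum.cong refl) (simp add: \<chi>i)
    then show ?thesis using mat_vec_sum[OF Vc(1) _ that(2), of "\<phi> r"] \<phi>(1)[OF that(1)]
      by (simp add: sum_divide_distrib D_def)
  qed
  define W where "W = (\<lambda>r. block n S (w r))"
  define u where "u = (\<lambda>r i s a. B $$ (sub_idx S a, i) * W r s (sub_idx T a))"
  \<comment> \<open>Amplitudes of a purification of the recovered state. The environment labels are
    the Kraus index and the purifying index of \<open>\<gamma>\<close>, paired in \<open>c\<close>,
    and the value \<open>s\<close> of the erased bits.\<close>
  define f where "f = (\<lambda>c s I. \<Sum>a<N. K (fst c) $$ (I div 2, a) * u (I mod 2) (snd c) s a)"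
  define C where "C = {..<J} \<times> {..<m}"
  have fpr: "f (j,i) s (p*2+r) = (\<Sum>a<N. K j $$ (p,a) * u r i s a)" if "r < 2" for j i s p r
    using that by (simp add: f_def)
  \<comment> \<open>Recovery and inserted state drop out: the Kraus operators preserve inner
    products and \<open>B\<close> has Hilbert-Schmidt norm 1. What remains on the label
    \<open>s\<close> is the marginal of the encoded branch \<open>r\<close>.\<close>
  have gram: "(\<Sum>c\<in>C. \<Sum>p<D. cnj (f c s (p*2+r)) * f c s' (p*2+r)) = (\<Sum>y<2 ^ card T. cnj (W r s y) * W r s' y)"
    if "r < 2" for r s s'
  proof -
    have "(\<Sum>c\<in>C. \<Sum>p<D. cnj (f c s (p*2+r)) * f c s' (p*2+r))
      = (\<Sum>j<J. \<Sum>i<m. \<Sum>p<D. cnj (\<Sum>a<N. K j $$ (p,a) * u r i s a) * (\<Sum>a<N. K j $$ (p,a) * u r i s' a))"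
      unfolding C_def sum.cartesian_product[symmetric, of "\<lambda>j i. \<Sum>p<D. cnj (f (j,i) s (p*2+r)) * f (j,i) s' (p*2+r)", simplified]
      by (simp add: fpr that sum.cartesian_product)
    also have "\<dots> = (\<Sum>i<m. \<Sum>j<J. \<Sum>p<D. cnj (\<Sum>a<N. K j $$ (p,a) * u r i s a) * (\<Sum>a<N. K j $$ (p,a) * u r i s' a))"
      by (rule sum.swap)
    also have "\<dots> = (\<Sum>i<m. \<Sum>a<N. cnj (u r i s a) * u r i s' a)"
      by (rule sum.cong[OF refl], rule kraus_inner[OF Kone])
    also have "\<dots> = (\<Sum>i<m. \<Sum>a<2^n. (cnj (B $$ (sub_idx S a, i)) * B $$ (sub_idx S a, i)) * (cnj (W r s (sub_idx ({0..<n} - S) a)) * W r s' (sub_idx ({0..<n} - S) a)))"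
      unfolding u_def N_def T_def by (simp add: mult_ac)
    also have "\<dots> = (\<Sum>i<m. \<Sum>x<2 ^ card S. \<Sum>y<2 ^ card ({0..<n} - S). (cnj (B $$ (x, i)) * B $$ (x, i)) * (cnj (W r s y) * W r s' y))"
      by (rule sum.cong[OF refl], rule sum_sub_idx[OF S])
    also have "\<dots> = (\<Sum>i<m. (\<Sum>x<m. cnj (B $$ (x, i)) * B $$ (x, i)) * (\<Sum>y<2 ^ card T. cnj (W r s y) * W r s' y))"
      unfolding defs sum_product ..
    also have "\<dots> = (\<Sum>x<m. \<Sum>i<m. cnj (B $$ (x, i)) * B $$ (x, i)) * (\<Sum>y<2 ^ card T. cnj (W r s y) * W r s' y)"
      unfolding sum_distrib_right[symmetric] by (subst sum.swap) (rule refl)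
    finally show ?thesis unfolding Btr by simp
  qed
  have wnorm: "(\<Sum>s<m. \<Sum>y<2 ^ card T. cnj (W r s y) * W r s y) = 1/2" if "r < 2" for r
  proof -
    have "(\<Sum>s<m. \<Sum>y<2 ^ card T. cnj (W r s y) * W r s y) = (\<Sum>a<N. cnj (w r a) * w r a)"
      unfolding W_def m_def T_def N_def by (rule sum_block[OF S, of "\<lambda>_ _ x. cnj x * x"])
    also have "\<dots> = (\<Sum>a<N. (cnj ((V *\<^sub>v \<phi> r) $ a) * (V *\<^sub>v \<phi> r) $ a) / 2)"
    proof (intro sum.cong refl)
      fix a assume "a \<in> {..<N}"
      then have "a < N" by simp
      then show "cnj (w r a) * w r a = (cnj ((V *\<^sub>v \<phi> r) $ a) * (V *\<^sub>v \<phi> r) $ a) / 2"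
        using that by (simp only: w half)
    qed
    also have "\<dots> = 1/2" unfolding sum_divide_distrib[symmetric]
      using isometry_norm[OF Vc, of "\<phi> r"] \<phi>(1)[OF that] \<phi>n[OF that] by (simp add: D_def)
    finally show ?thesis .
  qed
  have f1: "(\<Sum>c\<in>C. \<Sum>s<m. \<Sum>I<D*2. (cmod (f c s I))\<^sup>2) = 1"
  proof -
    have "complex_of_real (\<Sum>c\<in>C. \<Sum>s<m. \<Sum>I<D*2. (cmod (f c s I))\<^sup>2) = (\<Sum>c\<in>C. \<Sum>s<m. \<Sum>I<D*2. cnj (f c s I) * f c s I)"
      unfolding of_real_sum sqm ..
    also have "\<dots> = (\<Sum>s<m. \<Sum>c\<in>C. (\<Sum>p<D. cnj (f c s (p*2+0)) * f c s (p*2+0)) + (\<Sum>p<D. cnj (f c s (p*2+1)) * f c s (p*2+1)))"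
      unfolding sum_pairs by (rule sum.swap)
    also have "\<dots> = 1" unfolding sum.distrib gram[OF r0] gram[OF r1] wnorm[OF r0] wnorm[OF r1] by simp
    finally show ?thesis by (simp only: of_real_eq_1_iff)
  qed
  define z where "z = (\<lambda>I::nat. if even I then 1 else -1 :: real)"
  have \<chi>r1: "(\<Sum>I<D*2. (cmod (\<chi> $ I))\<^sup>2) = 1" unfolding sum_pairs nrmr[OF r0] nrmr[OF r1] by simp
  have \<chi>z: "(\<Sum>I<D*2. z I * (cmod (\<chi> $ I))\<^sup>2) = 0"
  proof -
    have "(\<Sum>I<D*2. z I * (cmod (\<chi> $ I))\<^sup>2) = (\<Sum>p<D. (cmod (\<chi> $ (p*2+0)))\<^sup>2) - (\<Sum>p<D. (cmod (\<chi> $ (p*2+1)))\<^sup>2)"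
      by (simp add: sum_pairs z_def sum_negf)
    then show ?thesis unfolding nrmr[OF r0] nrmr[OF r1] by simp
  qed
  \<comment> \<open>The squared fidelity of the recovered state with the test input, as
    \<open>fid\<close> confirms below.\<close>
  define a where "a = (\<Sum>c\<in>C. \<Sum>s<m. (cmod (\<Sum>I<D*2. cnj (\<chi> $ I) * f c s I))\<^sup>2)"
  have fin: "finite C" by (simp add: C_def)
  note dec = decoupling_bound[OF fin finite_lessThan \<chi>r1 \<chi>z _ f1 gu gh, folded a_def]
  have a1: "a \<le> 1" by (rule dec(1)) (simp add: z_def)
  have dec2: "cmod (\<Sum>c\<in>C. \<Sum>s<m. \<Sum>I<D*2. cnj (f c s I) * (of_real (z I) * (\<Sum>s'<m. g $$ (s,s') * f c s' I))) \<le> 2 * sqrt (1 - a)"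
    by (rule dec(2)) (simp add: z_def)
  have qw: "quad_form (2^n) G (w r) = (\<Sum>s<m. \<Sum>s'<m. g $$ (s,s') * (\<Sum>y<2 ^ card T. cnj (W r s y) * W r s' y))" for r
    unfolding W_def m_def T_def by (rule quad_form_block[OF S eq])
  \<comment> \<open>The sign \<open>z\<close> of the reference turns its correlation with the erased
    register into a difference of the two branch expectations.\<close>
  have obs: "(\<Sum>c\<in>C. \<Sum>s<m. \<Sum>I<D*2. cnj (f c s I) * (of_real (z I) * (\<Sum>s'<m. g $$ (s,s') * f c s' I)))
    = quad_form (2^n) G (w 0) - quad_form (2^n) G (w 1)"
  proof -
    have half_sum: "(\<Sum>c\<in>C. \<Sum>s<m. \<Sum>p<D. cnj (f c s (p*2+r)) * (\<Sum>s'<m. g $$ (s,s') * f c s' (p*2+r))) = quad_form (2^n) G (w r)"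
      if r: "r < 2" for r
    proof -
      have "(\<Sum>c\<in>C. \<Sum>s<m. \<Sum>p<D. cnj (f c s (p*2+r)) * (\<Sum>s'<m. g $$ (s,s') * f c s' (p*2+r)))
        = (\<Sum>c\<in>C. \<Sum>s<m. \<Sum>p<D. \<Sum>s'<m. g $$ (s,s') * (cnj (f c s (p*2+r)) * f c s' (p*2+r)))"
        by (simp add: sum_distrib_left mult_ac)
      also have "\<dots> = (\<Sum>c\<in>C. \<Sum>s<m. \<Sum>s'<m. \<Sum>p<D. g $$ (s,s') * (cnj (f c s (p*2+r)) * f c s' (p*2+r)))"
        by (rule sum.cong[OF refl], rule sum.cong[OF refl], rule sum.swap)
      also have "\<dots> = (\<Sum>s<m. \<Sum>s'<m. \<Sum>c\<in>C. \<Sum>p<D. g $$ (s,s') * (cnj (f c s (p*2+r)) * f c s' (p*2+r)))"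
        by (rule sum_rotate[symmetric])
      also have "\<dots> = quad_form (2^n) G (w r)"
        unfolding qw sum_distrib_left[symmetric] gram[OF r] ..
      finally show ?thesis .
    qed
    have "(\<Sum>c\<in>C. \<Sum>s<m. \<Sum>I<D*2. cnj (f c s I) * (of_real (z I) * (\<Sum>s'<m. g $$ (s,s') * f c s' I)))
      = (\<Sum>c\<in>C. \<Sum>s<m. (\<Sum>p<D. cnj (f c s (p*2+0)) * (\<Sum>s'<m. g $$ (s,s') * f c s' (p*2+0)))
          - (\<Sum>p<D. cnj (f c s (p*2+1)) * (\<Sum>s'<m. g $$ (s,s') * f c s' (p*2+1))))"
      by (simp add: sum_pairs z_def sum_negf)
    also have "\<dots> = quad_form (2^n) G (w 0) - quad_form (2^n) G (w 1)"
      unfolding sum_subtractf half_sum[OF r0] half_sum[OF r1] ..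
    finally show ?thesis .
  qed
  \<comment> \<open>Each branch has amplitude \<open>1 / sqrt 2\<close>, so its expectation counts
    half; this turns the constant 2 of \<open>decoupling_bound\<close> into 4.\<close>
  have qV: "quad_form (2^n) G (w r) = quad_form (2^n) G (\<lambda>a. (V *\<^sub>v \<phi> r) $ a) / 2" if "r < 2" for r
  proof -
    have "quad_form (2^n) G (w r) = (\<Sum>a<N. \<Sum>b<N. (cnj ((V *\<^sub>v \<phi> r) $ a) * G $$ (a,b) * (V *\<^sub>v \<phi> r) $ b) / 2)"
      unfolding quad_form_def N_def[symmetric]
    proof (intro sum.cong refl)
      fix a b assume ab: "a \<in> {..<N}" "b \<in> {..<N}"
      have "cnj (w r a) * G $$ (a,b) * w r b = G $$ (a,b) * (cnj (w r a) * w r b)" by (simp add: mult_ac)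
      also have "\<dots> = G $$ (a,b) * ((cnj ((V *\<^sub>v \<phi> r) $ a) * (V *\<^sub>v \<phi> r) $ b) / 2)"
        using ab by (simp only: w[OF that] half lessThan_iff)
      finally show "cnj (w r a) * G $$ (a,b) * w r b = (cnj ((V *\<^sub>v \<phi> r) $ a) * G $$ (a,b) * (V *\<^sub>v \<phi> r) $ b) / 2"
        by (simp add: mult_ac)
    qed
    then show ?thesis unfolding quad_form_def sum_divide_distrib N_def .
  qed
  have diff: "cmod (quad_form (2^n) G (\<lambda>a. (V *\<^sub>v \<phi> 0) $ a) - quad_form (2^n) G (\<lambda>a. (V *\<^sub>v \<phi> 1) $ a)) \<le> 4 * sqrt (1 - a)"
  proof -
    let ?q = "\<lambda>r::nat. quad_form (2^n) G (\<lambda>a. (V *\<^sub>v \<phi> r) $ a)"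
    have "cmod ((?q 0 - ?q 1) / 2) \<le> 2 * sqrt (1 - a)"
      using dec2 unfolding obs qV[OF r0] qV[OF r1] by (simp add: diff_divide_distrib)
    then show ?thesis by (simp add: norm_divide)
  qed
  let ?M = "R \<circ> replacement n S \<gamma> \<circ> encoding V"
  define \<sigma> where "\<sigma> = tensor_id D D 2 ?M (outer \<chi>)"
  have \<sigma>c: "\<sigma> \<in> carrier_mat (D*2) (D*2)" by (simp add: \<sigma>_def tensor_id_def Let_def)
  have enc: "encoding V (mat D D (\<lambda>(s,t). outer \<chi> $$ (s*2+r, t*2+r'))) = mat N N (\<lambda>(a,b). w r a * cnj (w r' b))"
    if r: "r < 2" "r' < 2" for r r'
  proof (rule eq_matI)
    let ?b = "mat D D (\<lambda>(s,t). outer \<chi> $$ (s*2+r, t*2+r'))"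
    have bc: "?b \<in> carrier_mat D D" by simp
    fix a b assume "a < dim_row (mat N N (\<lambda>(a,b). w r a * cnj (w r' b)))" "b < dim_col (mat N N (\<lambda>(a,b). w r a * cnj (w r' b)))"
    then have ab: "a < N" "b < N" by auto
    have "encoding V ?b $$ (a,b) = (\<Sum>l<D. \<Sum>l'<D. V $$ (a,l) * ?b $$ (l,l') * cnj (V $$ (b,l')))"
      unfolding encoding_def by (rule sandwich_index[OF Vc(1) bc ab])
    also have "\<dots> = (\<Sum>l<D. \<Sum>l'<D. (V $$ (a,l) * \<chi> $ (l*2+r)) * cnj (V $$ (b,l') * \<chi> $ (l'*2+r')))"
      using r \<chi>c by (intro sum.cong refl) (simp add: mult_ac)
    also have "\<dots> = w r a * cnj (w r' b)" unfolding w_def cnj_sum sum_product ..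
    finally show "encoding V ?b $$ (a,b) = mat N N (\<lambda>(a,b). w r a * cnj (w r' b)) $$ (a,b)" using ab by simp
  qed (use Vc in \<open>auto simp: encoding_def\<close>)
  have \<sigma>: "\<sigma> $$ (I,I') = (\<Sum>cs\<in>C \<times> {..<m}. f (fst cs) (snd cs) I * cnj (f (fst cs) (snd cs) I'))"
    if I: "I < D*2" "I' < D*2" for I I'
  proof -
    let ?r = "I mod 2" and ?r' = "I' mod 2" and ?p = "I div 2" and ?p' = "I' div 2"
    have pp: "?p < D" "?p' < D" using I by auto
    let ?X = "mat N N (\<lambda>(a,b). w ?r a * cnj (w ?r' b))"
    have "\<sigma> $$ (I,I') = R (replacement n S \<gamma> ?X) $$ (?p,?p')"
      using I enc[of ?r ?r'] by (simp add: \<sigma>_def tensor_id_def Let_def)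
    also have "\<dots> = (\<Sum>j<J. \<Sum>a<N. \<Sum>b<N. K j $$ (?p,a) * replacement n S \<gamma> ?X $$ (a,b) * cnj (K j $$ (?p',b)))"
      using pp by (intro Kact) (auto simp: replacement_def Let_def N_def)
    also have "\<dots> = (\<Sum>j<J. \<Sum>a<N. \<Sum>b<N. \<Sum>i<m. \<Sum>s<m. (K j $$ (?p,a) * u ?r i s a) * cnj (K j $$ (?p',b) * u ?r' i s b))"
    proof (intro sum.cong refl)
      fix j a b assume ab: "a \<in> {..<N}" "b \<in> {..<N}"
      have "replacement n S \<gamma> ?X $$ (a,b) = (\<Sum>i<m. \<Sum>s<m. u ?r i s a * cnj (u ?r' i s b))"
        unfolding u_def W_def T_def m_def N_def
        by (rule replacement_rank_one[OF S]) (use ab B in \<open>auto simp: N_def m_def\<close>)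
      then show "K j $$ (?p,a) * replacement n S \<gamma> ?X $$ (a,b) * cnj (K j $$ (?p',b))
        = (\<Sum>i<m. \<Sum>s<m. (K j $$ (?p,a) * u ?r i s a) * cnj (K j $$ (?p',b) * u ?r' i s b))"
        by (simp add: sum_distrib_left sum_distrib_right mult_ac)
    qed
    also have "\<dots> = (\<Sum>j<J. \<Sum>i<m. \<Sum>a<N. \<Sum>b<N. \<Sum>s<m. (K j $$ (?p,a) * u ?r i s a) * cnj (K j $$ (?p',b) * u ?r' i s b))"
      by (rule sum.cong[OF refl], rule sum_rotate)
    also have "\<dots> = (\<Sum>j<J. \<Sum>i<m. \<Sum>s<m. \<Sum>a<N. \<Sum>b<N. (K j $$ (?p,a) * u ?r i s a) * cnj (K j $$ (?p',b) * u ?r' i s b))"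
      by (rule sum.cong[OF refl], rule sum.cong[OF refl], rule sum_rotate)
    also have "\<dots> = (\<Sum>j<J. \<Sum>i<m. \<Sum>s<m. f (j,i) s I * cnj (f (j,i) s I'))"
      unfolding f_def cnj_sum sum_product by simp
    also have "\<dots> = (\<Sum>c\<in>C. \<Sum>s<m. f c s I * cnj (f c s I'))"
      unfolding C_def by (rule trans[OF sum.cartesian_product]) (simp add: case_prod_unfold)
    also have "\<dots> = (\<Sum>cs\<in>C \<times> {..<m}. f (fst cs) (snd cs) I * cnj (f (fst cs) (snd cs) I'))"
      by (rule trans[OF sum.cartesian_product]) (simp add: case_prod_unfold)
    finally show ?thesis .
  qed
  have psd\<sigma>: "psd \<sigma>" by (rule psd_gram[OF \<sigma>c \<sigma>])
  have "quad_form (D*2) \<sigma> (\<lambda>I. \<chi> $ I) = of_real (\<Sum>cs\<in>C \<times> {..<m}. (cmod (\<Sum>I<D*2. cnj (\<chi> $ I) * f (fst cs) (snd cs) I))\<^sup>2)"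
    by (rule quad_form_gram[OF \<sigma>])
  also have "(\<Sum>cs\<in>C \<times> {..<m}. (cmod (\<Sum>I<D*2. cnj (\<chi> $ I) * f (fst cs) (snd cs) I))\<^sup>2) = a"
    unfolding a_def by (simp add: sum.cartesian_product case_prod_unfold)
  finally have fid: "fidelity \<sigma> (outer \<chi>) = sqrt a"
    using fidelity_pure[OF psd\<sigma> \<sigma>c \<chi>c \<chi>1] by simp
  have a0: "0 \<le> a" unfolding a_def by (simp add: sum_nonneg)
  have dens: "density (D*2) (outer \<chi>)" by (rule density_outer[OF \<chi>c \<chi>1])
  define F where "F = chan_fid D D ?M id"
  \<comment> \<open>\<open>chan_fid\<close> is an infimum over inputs, so the fidelity on this one
    input bounds it from above; hence \<open>sqrt (1 - a) \<le> P\<close>.\<close>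
  have Fle: "F \<le> sqrt a"
    using chan_fid_le[of 2 D "outer \<chi>" D ?M id] dens fid tensor_id_id[OF outer_carrier[OF \<chi>c]]
    by (simp add: F_def \<sigma>_def)
  have F0: "0 \<le> F" unfolding F_def
    by (rule chan_fid_nonneg[OF density_outer[of "\<phi> 0"]]) (use \<phi>[of 0] in \<open>auto simp: D_def\<close>)
  have F2: "F\<^sup>2 \<le> a"
    using power_mono[OF Fle F0, of 2] a0 by simp
  have P: "P = sqrt (1 - F\<^sup>2)" by (simp add: P_def purified_dist_def F_def D_def)
  show "0 \<le> P" unfolding P using F2 a1 by simp
  show "P \<le> 1" unfolding P by simp
  have "sqrt (1 - a) \<le> P" unfolding P using F2 by simp
  then show "cmod (quad_form (2^n) G (\<lambda>a. (V *\<^sub>v \<phi> 0) $ a) - quad_form (2^n) G (\<lambda>a. (V *\<^sub>v \<phi> 1) $ a)) \<le> 4 * P"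
    using diff by linarith
qed

section \<open>State preparation by two-qubit gates\<close>

text \<open>Unitarity of a 2x2 matrix indexed by truth values, so that \<open>bit a t\<close> can
  serve directly as a row index.\<close>

definition unit2 :: "(bool \<Rightarrow> bool \<Rightarrow> complex) \<Rightarrow> bool" where
  "unit2 m \<longleftrightarrow> (\<forall>x y. cnj (m False x) * m False y + cnj (m True x) * m True y = of_bool (x = y))"

text \<open>The high bit is the control. With a separate block for each of its values, one form
  covers control on 0, control on 1 and, for equal blocks, no control.\<close>

definition ctrl_gate :: "(bool \<Rightarrow> bool \<Rightarrow> complex) \<Rightarrow> (bool \<Rightarrow> bool \<Rightarrow> complex) \<Rightarrow> cmat" where
  "ctrl_gate m0 m1 = mat 4 4 (\<lambda>(x,y). if x div 2 = y div 2 then (if x \<ge> 2 then m1 else m0) (odd x) (odd y) else 0)"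

lemma sum_lessThan_four: "(\<Sum>x<4. h x) = h 0 + h 1 + h 2 + h (3::nat)" for h :: "nat \<Rightarrow> complex"
  by (simp add: eval_nat_numeral)

lemma ctrl_gate_unitary:
  assumes "unit2 m0" "unit2 m1"
  shows "unitary 4 (ctrl_gate m0 m1)"
proof -
  have c: "ctrl_gate m0 m1 \<in> carrier_mat 4 4" by (simp add: ctrl_gate_def)
  have u: "cnj (m False x) * m False y + cnj (m True x) * m True y = of_bool (x = y)" if "m = m0 \<or> m = m1" for m x y
    using assms that unfolding unit2_def by blast
  have i: "ctrl_gate m0 m1 $$ (x,y) = (if x div 2 = y div 2 then (if x \<ge> 2 then m1 else m0) (odd x) (odd y) else 0)"
    if "x < 4" "y < 4" for x y using that by (simp add: ctrl_gate_def)
  have "adj (ctrl_gate m0 m1) * ctrl_gate m0 m1 = 1\<^sub>m 4"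
  proof (rule eq_matI)
    fix x y assume "x < dim_row (1\<^sub>m 4 :: cmat)" "y < dim_col (1\<^sub>m 4 :: cmat)"
    then have xy: "x < 4" "y < 4" by auto
    have "(adj (ctrl_gate m0 m1) * ctrl_gate m0 m1) $$ (x,y) = (\<Sum>p<4. cnj (ctrl_gate m0 m1 $$ (p,x)) * ctrl_gate m0 m1 $$ (p,y))"
      unfolding mat_mult_sum[OF adj_carrier[OF c] c xy] using c xy by (intro sum.cong refl) auto
    also have "\<dots> = (if x = y then 1 else 0)"
      unfolding sum_lessThan_four using nat_less_four_cases[OF xy(1)] nat_less_four_cases[OF xy(2)]
      by (elim disjE) (simp_all add: i u)
    finally show "(adj (ctrl_gate m0 m1) * ctrl_gate m0 m1) $$ (x,y) = 1\<^sub>m 4 $$ (x,y)" using xy by simp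
  qed (use c in auto)
  then show ?thesis using c by (simp add: unitary_def)
qed

definition apply_gates :: "nat \<Rightarrow> (nat \<times> nat \<times> cmat) list \<Rightarrow> complex vec \<Rightarrow> complex vec" where
  "apply_gates n gs v = foldr (\<lambda>(i,j,U) w. gate_on n i j U *\<^sub>v w) gs v"

definition valid_gates :: "nat \<Rightarrow> (nat \<times> nat \<times> cmat) list \<Rightarrow> bool" where
  "valid_gates n gs \<longleftrightarrow> (\<forall>(i,j,U)\<in>set gs. i < n \<and> j < n \<and> i \<noteq> j \<and> unitary 4 U)"

text \<open>One gate list has to work for all amplitudes \<open>f\<close>: operations are composed
  when controls are added. The later notion \<open>prepares\<close> concerns a single state.\<close>

definition implementable :: "nat \<Rightarrow> ((nat \<Rightarrow> complex) \<Rightarrow> nat \<Rightarrow> complex) \<Rightarrow> bool" where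
  "implementable n F \<longleftrightarrow> (\<exists>gs. valid_gates n gs \<and> (\<forall>f. apply_gates n gs (vec (2^n) f) = vec (2^n) (F f)))"

lemma implementable_comp:
  assumes "implementable n F" "implementable n F'"
  shows "implementable n (\<lambda>f. F (F' f))"
proof -
  obtain gs gs' where g: "valid_gates n gs" "\<And>f. apply_gates n gs (vec (2^n) f) = vec (2^n) (F f)"
    "valid_gates n gs'" "\<And>f. apply_gates n gs' (vec (2^n) f) = vec (2^n) (F' f)"
    using assms unfolding implementable_def by blast
  have "apply_gates n (gs @ gs') (vec (2^n) f) = vec (2^n) (F (F' f))" for f
    using g(2)[of "F' f"] g(4)[of f] by (simp add: apply_gates_def)
  moreover have "valid_gates n (gs @ gs')" using g(1,3) by (auto simp: valid_gates_def)
  ultimately show ?thesis unfolding implementable_def by blast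
qed

lemma implementable_cong:
  assumes "implementable n F" "\<And>f a. a < 2^n \<Longrightarrow> F f a = F' f a"
  shows "implementable n F'"
proof -
  have "vec (2^n) (F f) = vec (2^n) (F' f)" for f using assms(2) by (intro eq_vecI) auto
  then show ?thesis using assms(1) unfolding implementable_def by simp
qed

section \<open>Multiply controlled rotations\<close>

definition act2 :: "nat \<Rightarrow> (bool \<Rightarrow> bool \<Rightarrow> complex) \<Rightarrow> (nat \<Rightarrow> complex) \<Rightarrow> nat \<Rightarrow> complex" where
  "act2 t m f a = m (bit a t) False * f (unset_bit t a) + m (bit a t) True * f (set_bit t a)"

lemma unset_bit_id: "\<not> bit a t \<Longrightarrow> unset_bit t a = a" for a :: nat
  by (rule bit_eqI) (auto simp: bit_unset_bit_iff)

lemma set_bit_id: "bit a t \<Longrightarrow> set_bit t a = a" for a :: nat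
  by (rule bit_eqI) (auto simp: bit_set_bit_iff)

lemma implementable_ctrl:
  assumes ct: "c < n" "t < n" "c \<noteq> t" and m: "unit2 m0" "unit2 m1"
  shows "implementable n (\<lambda>f a. act2 t (if bit a c then m1 else m0) f a)"
proof -
  let ?U = "ctrl_gate m0 m1"
  have "apply_gates n [(c,t,?U)] (vec (2^n) f) = vec (2^n) (\<lambda>a. act2 t (if bit a c then m1 else m0) f a)" for f
  proof (rule eq_vecI)
    fix a assume "a < dim_vec (vec (2^n) (\<lambda>a. act2 t (if bit a c then m1 else m0) f a))"
    then have a: "a < 2^n" by simp
    have i: "?U $$ (x,y) = (if x div 2 = y div 2 then (if x \<ge> 2 then m1 else m0) (odd x) (odd y) else 0)"
      if "x < 4" "y < 4" for x y using that by (simp add: ctrl_gate_def)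
    have U: "?U $$ (pair_idx c t a, y) = (if (y \<ge> 2) = bit a c then (if bit a c then m1 else m0) (bit a t) (odd y) else 0)"
      if "y < 4" for y
      unfolding i[OF pair_idx_less that] using nat_less_four_cases[OF that] by (cases "bit a c"; cases "bit a t") (auto simp: bitq_bit)
    have p: "put2 c t a y = (if odd y then set_bit t a else unset_bit t a)" if "(y \<ge> 2) = bit a c" for y
      using that ct(3) by (intro bit_eqI) (auto simp: bit_put2 bit_set_bit_iff bit_unset_bit_iff)
    have v: "vec (2^n) f $ put2 c t a y = f (put2 c t a y)" for y using put2_less[OF ct(3,1,2) a] by simp
    have "apply_gates n [(c,t,?U)] (vec (2^n) f) $ a = (\<Sum>x<4. ?U $$ (pair_idx c t a, x) * f (put2 c t a x))"
      unfolding apply_gates_def using gate_on_mult_vec[OF ct a vec_carrier] v by simp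
    also have "\<dots> = act2 t (if bit a c then m1 else m0) f a"
      unfolding sum_lessThan_four using p[of 0] p[of 1] p[of 2] p[of 3]
      by (cases "bit a c") (simp_all add: U act2_def)
    finally show "apply_gates n [(c,t,?U)] (vec (2^n) f) $ a = vec (2^n) (\<lambda>a. act2 t (if bit a c then m1 else m0) f a) $ a"
      using a by simp
  qed (simp add: apply_gates_def)
  moreover have "valid_gates n [(c,t,?U)]" using ct ctrl_gate_unitary[OF m] by (simp add: valid_gates_def)
  ultimately show ?thesis unfolding implementable_def by blast
qed

definition ctrl_on :: "nat set \<Rightarrow> nat set \<Rightarrow> nat \<Rightarrow> bool" where
  "ctrl_on C Z a \<longleftrightarrow> (\<forall>c\<in>C. bit a c = (c \<in> Z))"

lemma ctrl_on_simps [simp]: "ctrl_on {} Z a" "ctrl_on (insert c C) Z a \<longleftrightarrow> bit a c = (c \<in> Z) \<and> ctrl_on C Z a"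
  by (auto simp: ctrl_on_def)

definition mul_ctrl :: "nat set \<Rightarrow> nat set \<Rightarrow> nat \<Rightarrow> (bool \<Rightarrow> bool \<Rightarrow> complex) \<Rightarrow> (nat \<Rightarrow> complex) \<Rightarrow> nat \<Rightarrow> complex" where
  "mul_ctrl C Z t m f a = (if ctrl_on C Z a then act2 t m f a else f a)"

abbreviation id2 :: "bool \<Rightarrow> bool \<Rightarrow> complex" where "id2 x y \<equiv> of_bool (x = y)"
abbreviation not2 :: "bool \<Rightarrow> bool \<Rightarrow> complex" where "not2 x y \<equiv> of_bool (x \<noteq> y)"

lemma act2_id: "act2 t id2 f a = f a"
  by (cases "bit a t") (simp_all add: act2_def unset_bit_id set_bit_id)

lemma implementable_single_ctrl:
  assumes ct: "c < n" "t < n" "c \<noteq> t" and m: "unit2 m"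
  shows "implementable n (mul_ctrl {c} Z t m)" "implementable n (mul_ctrl {} Z t m)"
proof -
  have i: "unit2 id2" by (auto simp: unit2_def)
  show "implementable n (mul_ctrl {c} Z t m)"
  proof (cases "c \<in> Z")
    case True
    show ?thesis by (rule implementable_cong[OF implementable_ctrl[OF ct i m]]) (use True in \<open>simp add: mul_ctrl_def act2_id\<close>)
  next
    case False
    show ?thesis by (rule implementable_cong[OF implementable_ctrl[OF ct m i]]) (use False in \<open>simp add: mul_ctrl_def act2_id\<close>)
  qed
  show "implementable n (mul_ctrl {} Z t m)"
    by (rule implementable_cong[OF implementable_ctrl[OF ct m m]]) (simp add: mul_ctrl_def)
qed

lemma ctrl_on_bit:
  assumes "t \<notin> C"
  shows "ctrl_on C Z (set_bit t a) \<longleftrightarrow> ctrl_on C Z a" "ctrl_on C Z (unset_bit t a) \<longleftrightarrow> ctrl_on C Z a"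
  using assms unfolding ctrl_on_def by (auto simp: bit_set_bit_iff bit_unset_bit_iff)

text \<open>Every index is of one of these two forms, so identities between controlled operations on
  one target reduce to 2x2 computations.\<close>

lemma mul_ctrl_at:
  assumes "t \<notin> C"
  shows "mul_ctrl C Z t m f (unset_bit t a) = (if ctrl_on C Z a
      then m False False * f (unset_bit t a) + m False True * f (set_bit t a) else f (unset_bit t a))"
    and "mul_ctrl C Z t m f (set_bit t a) = (if ctrl_on C Z a
      then m True False * f (unset_bit t a) + m True True * f (set_bit t a) else f (set_bit t a))"
proof -
  have e: "unset_bit t (unset_bit t a) = unset_bit t a" "set_bit t (unset_bit t a) = set_bit t a"
    "unset_bit t (set_bit t a) = unset_bit t a" "set_bit t (set_bit t a) = set_bit t a"
    by (rule bit_eqI; auto simp: bit_set_bit_iff bit_unset_bit_iff)+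
  have b: "bit (set_bit t a) t" "\<not> bit (unset_bit t a) t" by (auto simp: bit_set_bit_iff bit_unset_bit_iff)
  show "mul_ctrl C Z t m f (unset_bit t a) = (if ctrl_on C Z a
      then m False False * f (unset_bit t a) + m False True * f (set_bit t a) else f (unset_bit t a))"
    unfolding mul_ctrl_def ctrl_on_bit[OF assms] act2_def e using b by simp
  show "mul_ctrl C Z t m f (set_bit t a) = (if ctrl_on C Z a
      then m True False * f (unset_bit t a) + m True True * f (set_bit t a) else f (set_bit t a))"
    unfolding mul_ctrl_def ctrl_on_bit[OF assms] act2_def e using b by simp
qed

text \<open>A one-parameter group of 2x2 unitaries that conjugation with the bit flip inverts; this
  inversion is what lets a control be added.\<close>

definition rot_family :: "(real \<Rightarrow> bool \<Rightarrow> bool \<Rightarrow> complex) \<Rightarrow> bool" where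
  "rot_family M \<longleftrightarrow> (\<forall>\<theta>. unit2 (M \<theta>)) \<and> (\<forall>\<theta> x y. M (- \<theta>) x y = M \<theta> (\<not> x) (\<not> y)) \<and>
     (\<forall>\<theta> \<theta>' x y. M (\<theta> + \<theta>') x y = M \<theta> x False * M \<theta>' False y + M \<theta> x True * M \<theta>' True y) \<and>
     (\<forall>x y. M 0 x y = id2 x y)"

lemma nat_set_or_unset_bit: "a = unset_bit t a \<or> a = set_bit t a" for a :: nat
  using unset_bit_id set_bit_id by metis

text \<open>A further control is added by \<open>M \<theta> = M (\<theta>/2) X M (-\<theta>/2) X\<close>, putting the old controls on the
  rotations and the new control on the flips.\<close>
lemma implementable_mul_ctrl:
  assumes M: "rot_family M" and n: "2 \<le> n" and t: "t < n" and C: "finite C" "C \<subseteq> {..<n} - {t}"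
  shows "implementable n (mul_ctrl C Z t (M \<theta>))"
  using C
proof (induction C arbitrary: \<theta>)
  case empty
  have "\<exists>c<n. c \<noteq> t" using n by (metis One_nat_def Suc_1 less_le_trans zero_less_one_class.zero_less_one lessI zero_neq_one less_trans)
  then obtain c where "c < n" "c \<noteq> t" by blast
  then show ?case using implementable_single_ctrl(2)[of c n t "M \<theta>"] t M by (simp add: rot_family_def)
next
  case (insert c C)
  have c: "c < n" "c \<noteq> t" "t \<notin> C" using insert by auto
  have u: "unit2 not2" by (auto simp: unit2_def)
  let ?h = "M (\<theta>/2)"
  let ?X = "mul_ctrl {c} Z t not2"
  have I: "implementable n (mul_ctrl C Z t (M \<theta>))" for \<theta> using insert by auto
  have X: "implementable n ?X" using implementable_single_ctrl(1)[OF c(1) t c(2) u] .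
  \<comment> \<open>If an old control fails, the two flips cancel; if only the new one fails, the
    half rotations cancel; if all hold, the flips turn the inverse half rotation into a second
    forward one.\<close>
  have "implementable n (\<lambda>f. mul_ctrl C Z t ?h (?X (mul_ctrl C Z t (M (- (\<theta>/2))) (?X f))))"
    by (rule implementable_comp[OF I implementable_comp[OF X implementable_comp[OF I X]]])
  then show ?case
  proof (rule implementable_cong)
    fix f :: "nat \<Rightarrow> complex" and a :: nat
    have tc: "t \<notin> {c}" "t \<notin> insert c C" using c by auto
    have neg: "M (- (\<theta>/2)) x y = ?h (\<not> x) (\<not> y)" for x y using M unfolding rot_family_def by blast
    have sq: "M \<theta> x y = ?h x False * ?h False y + ?h x True * ?h True y" for x y
      using M unfolding rot_family_def by (metis field_sum_of_halves)
    have inv: "?h x False * M (- (\<theta>/2)) False y + ?h x True * M (- (\<theta>/2)) True y = id2 x y" for x y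
    proof -
      have "M (\<theta>/2 + - (\<theta>/2)) x y = ?h x False * M (- (\<theta>/2)) False y + ?h x True * M (- (\<theta>/2)) True y"
        using M unfolding rot_family_def by blast
      moreover have "M (\<theta>/2 + - (\<theta>/2)) x y = id2 x y" using M by (simp add: rot_family_def)
      ultimately show ?thesis by simp
    qed
    have inv': "?h x False * ?h True (\<not> y) + ?h x True * ?h False (\<not> y) = id2 x y" for x y
      using inv[of x y] unfolding neg by simp
    let ?P = "ctrl_on C Z a" and ?p = "bit a c = (c \<in> Z)"
    let ?f0 = "f (unset_bit t a)" and ?f1 = "f (set_bit t a)"
    have i00: "?h False False * ?h True True + ?h False True * ?h False True = 1"
      and i01: "?h False False * ?h True False + ?h False True * ?h False False = 0"
      and i10: "?h True False * ?h True True + ?h True True * ?h False True = 0"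
      and i11: "?h True False * ?h True False + ?h True True * ?h False False = 1"
      using inv'[of False False] inv'[of False True] inv'[of True False] inv'[of True True] by simp_all
    have lin: "A * (B * x + D * y) + E * (F * x + H * y) = (A * B + E * F) * x + (A * D + E * H) * y"
      "A * (B * x + D * y) + E * (F * y + H * x) = (A * B + E * H) * x + (A * D + E * F) * y"
      for A B D E F H x y :: complex by (simp_all add: algebra_simps)
    have at0: "mul_ctrl C Z t ?h (?X (mul_ctrl C Z t (M (- (\<theta>/2))) (?X f))) (unset_bit t a)
      = mul_ctrl (insert c C) Z t (M \<theta>) f (unset_bit t a)"
      unfolding mul_ctrl_at[OF tc(1)] mul_ctrl_at[OF c(3)] mul_ctrl_at[OF tc(2)]
      by (cases ?P; cases ?p) (simp_all add: neg sq lin i00 i01 i10 i11)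
    have at1: "mul_ctrl C Z t ?h (?X (mul_ctrl C Z t (M (- (\<theta>/2))) (?X f))) (set_bit t a)
      = mul_ctrl (insert c C) Z t (M \<theta>) f (set_bit t a)"
      unfolding mul_ctrl_at[OF tc(1)] mul_ctrl_at[OF c(3)] mul_ctrl_at[OF tc(2)]
      by (cases ?P; cases ?p) (simp_all add: neg sq lin i00 i01 i10 i11)
    show "mul_ctrl C Z t ?h (?X (mul_ctrl C Z t (M (- (\<theta>/2))) (?X f))) a = mul_ctrl (insert c C) Z t (M \<theta>) f a"
      using nat_set_or_unset_bit[of a t] at0 at1 by metis
  qed
qed

text \<open>Opposite phases on the two entries, since a phase on one entry alone would not be
  inverted by the bit flip as \<open>rot_family\<close> demands.\<close>

definition diag_rot :: "real \<Rightarrow> bool \<Rightarrow> bool \<Rightarrow> complex" where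
  "diag_rot \<theta> x y = (if x = y then cis (if x then - \<theta> else \<theta>) else 0)"

definition real_rot :: "real \<Rightarrow> bool \<Rightarrow> bool \<Rightarrow> complex" where
  "real_rot \<theta> x y = of_real (if x = y then cos \<theta> else if x then sin \<theta> else - sin \<theta>)"

lemma rot_family_diag: "rot_family diag_rot"
  unfolding rot_family_def unit2_def
proof (intro conjI allI)
  fix \<theta> \<theta>' :: real and x y :: bool
  show "cnj (diag_rot \<theta> False x) * diag_rot \<theta> False y + cnj (diag_rot \<theta> True x) * diag_rot \<theta> True y = of_bool (x = y)"
    by (cases x; cases y) (simp_all add: diag_rot_def cis_cnj cis_mult)
  show "diag_rot (\<theta> + \<theta>') x y = diag_rot \<theta> x False * diag_rot \<theta>' False y + diag_rot \<theta> x True * diag_rot \<theta>' True y"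
    by (cases x; cases y) (simp_all add: diag_rot_def cis_mult)
qed (auto simp: diag_rot_def)

lemma rot_family_real: "rot_family real_rot"
  unfolding rot_family_def unit2_def
proof (intro conjI allI)
  fix \<theta> \<theta>' :: real and x y :: bool
  have "cos \<theta> * cos \<theta> + sin \<theta> * sin \<theta> = 1"
    using sin_cos_squared_add2[of \<theta>] by (simp only: power2_eq_square)
  from arg_cong[OF this, of complex_of_real]
  have cs: "complex_of_real (cos \<theta>) * of_real (cos \<theta>) + of_real (sin \<theta>) * of_real (sin \<theta>) = 1"
    by (simp only: of_real_add of_real_mult of_real_1)
  then have sc: "complex_of_real (sin \<theta>) * of_real (sin \<theta>) + of_real (cos \<theta>) * of_real (cos \<theta>) = 1"
    by (simp only: add.commute)
  show "cnj (real_rot \<theta> False x) * real_rot \<theta> False y + cnj (real_rot \<theta> True x) * real_rot \<theta> True y = of_bool (x = y)"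
    by (cases x; cases y) (simp_all add: real_rot_def cs sc)
  show "real_rot (\<theta> + \<theta>') x y = real_rot \<theta> x False * real_rot \<theta>' False y + real_rot \<theta> x True * real_rot \<theta>' True y"
    by (cases x; cases y) (simp_all add: real_rot_def cos_add sin_add flip: of_real_mult of_real_add)
qed (auto simp: real_rot_def)

section \<open>Clearing amplitudes one at a time\<close>

definition prepares :: "nat \<Rightarrow> (nat \<Rightarrow> complex) \<Rightarrow> (nat \<Rightarrow> complex) \<Rightarrow> bool" where
  "prepares n f f' \<longleftrightarrow> (\<exists>gs. valid_gates n gs \<and> apply_gates n gs (vec (2^n) f) = vec (2^n) f')"

lemma prepares_refl: "prepares n f f"
  unfolding prepares_def by (rule exI[of _ "[]"]) (simp add: valid_gates_def apply_gates_def)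

lemma prepares_trans:
  assumes "prepares n f f'" "prepares n f' f''" shows "prepares n f f''"
proof -
  obtain gs gs' where "valid_gates n gs" "apply_gates n gs (vec (2^n) f) = vec (2^n) f'"
    "valid_gates n gs'" "apply_gates n gs' (vec (2^n) f') = vec (2^n) f''"
    using assms unfolding prepares_def by blast
  then show ?thesis unfolding prepares_def
    by (intro exI[of _ "gs' @ gs"]) (auto simp: valid_gates_def apply_gates_def)
qed

text \<open>The rotation by the opposite angle undoes this one. Simplifying a target state by
  rotations is therefore, read backwards, a way of preparing it.\<close>

lemma prepares_inverse_rot:
  assumes M: "rot_family M" and n: "2 \<le> n" and t: "t < n" and C: "C \<subseteq> {..<n} - {t}"
  shows "prepares n (mul_ctrl C Z t (M \<theta>) f) f"
proof -
  have tC: "t \<notin> C" and fC: "finite C" using C finite_subset by auto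
  obtain gs where gs: "valid_gates n gs" "\<And>f. apply_gates n gs (vec (2^n) f) = vec (2^n) (mul_ctrl C Z t (M (-\<theta>)) f)"
    using implementable_mul_ctrl[OF M n t fC C] unfolding implementable_def by blast
  have inv: "M (-\<theta>) x False * M \<theta> False y + M (-\<theta>) x True * M \<theta> True y = id2 x y" for x y
  proof -
    have "M (-\<theta> + \<theta>) x y = M (-\<theta>) x False * M \<theta> False y + M (-\<theta>) x True * M \<theta> True y"
      using M unfolding rot_family_def by blast
    moreover have "M (-\<theta> + \<theta>) x y = id2 x y" using M by (simp add: rot_family_def)
    ultimately show ?thesis by simp
  qed
  have lin: "A * (B * x + D * y) + E * (F * x + H * y) = (A * B + E * F) * x + (A * D + E * H) * y"
    for A B D E F H x y :: complex by (simp add: algebra_simps)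
  have "mul_ctrl C Z t (M (-\<theta>)) (mul_ctrl C Z t (M \<theta>) f) (unset_bit t a) = f (unset_bit t a)"
    "mul_ctrl C Z t (M (-\<theta>)) (mul_ctrl C Z t (M \<theta>) f) (set_bit t a) = f (set_bit t a)" for a
    unfolding mul_ctrl_at[OF tC] by (simp_all add: lin inv)
  then have "mul_ctrl C Z t (M (-\<theta>)) (mul_ctrl C Z t (M \<theta>) f) a = f a" for a
    using nat_set_or_unset_bit[of a t] by metis
  then have "vec (2^n) (mul_ctrl C Z t (M (-\<theta>)) (mul_ctrl C Z t (M \<theta>) f)) = vec (2^n) f" by (intro eq_vecI) auto
  then show ?thesis unfolding prepares_def using gs by metis
qed

text \<open>A relative phase first aligns the two complex numbers; then a real plane rotation moves
  all weight into the first one.\<close>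

lemma rotate_to_zero:
  obtains \<alpha> \<theta> where "real_rot \<theta> True False * (cis \<alpha> * x) + real_rot \<theta> True True * (cis (-\<alpha>) * y) = 0"
proof -
  obtain r1 p where x: "x = rcis r1 p" using rcis_Ex by blast
  obtain r2 q where y: "y = rcis r2 q" using rcis_Ex by blast
  obtain \<theta> where \<theta>: "sin \<theta> * r1 + cos \<theta> * r2 = 0"
  proof (cases "r1 = 0 \<and> r2 = 0")
    case False
    define r where "r = sqrt (r1\<^sup>2 + r2\<^sup>2)"
    have r: "r\<^sup>2 = r1\<^sup>2 + r2\<^sup>2" "r \<noteq> 0" using False by (auto simp: r_def sum_power2_eq_zero_iff)
    have "(r1 / r)\<^sup>2 + (- r2 / r)\<^sup>2 = (r1\<^sup>2 + r2\<^sup>2) / r\<^sup>2"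
      by (simp add: power_divide add_divide_distrib)
    also have "\<dots> = 1" unfolding r(1)[symmetric] using r(2) by simp
    finally have "(r1 / r)\<^sup>2 + (- r2 / r)\<^sup>2 = 1" .
    then obtain t where "r1 / r = cos t" "- r2 / r = sin t" using sincos_total_2pi by blast
    then have "sin t * r1 + cos t * r2 = (- r2 / r) * r1 + (r1 / r) * r2" by simp
    also have "\<dots> = 0" by simp
    finally show ?thesis by (rule that)
  qed (use that in auto)
  \<comment> \<open>Half the phase difference: both numbers are turned to the mean phase
    \<open>(p + q) / 2\<close>, leaving the real factors \<open>r1\<close> and
    \<open>r2\<close>.\<close>
  define \<alpha> where "\<alpha> = (q - p) / 2"
  have c: "cis \<alpha> * cis p = cis ((p + q) / 2)" "cis (-\<alpha>) * cis q = cis ((p + q) / 2)"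
    unfolding cis_mult by (rule arg_cong[of _ _ cis], simp add: \<alpha>_def field_simps)+
  have "cis \<alpha> * x = of_real r1 * cis ((p + q) / 2)"
    unfolding x rcis_def c(1)[symmetric] by (simp only: mult.left_commute)
  moreover have "cis (-\<alpha>) * y = of_real r2 * cis ((p + q) / 2)"
    unfolding y rcis_def c(2)[symmetric] by (simp only: mult.left_commute)
  ultimately have "real_rot \<theta> True False * (cis \<alpha> * x) + real_rot \<theta> True True * (cis (-\<alpha>) * y)
      = of_real (sin \<theta> * r1 + cos \<theta> * r2) * cis ((p + q) / 2)"
    by (simp add: real_rot_def algebra_simps)
  then show ?thesis using \<theta> that by simp
qed

text \<open>The target \<open>t\<close> is a set bit of \<open>a\<close> and all other bits are
  controls fixed to those of \<open>a\<close>. The rotation then mixes only \<open>a\<close> with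
  the smaller index lacking that bit, so larger amplitudes stay zero.\<close>

lemma clear_amplitude:
  assumes n: "2 \<le> n" and a: "0 < a" "a < 2^n" and z: "\<And>b. a < b \<Longrightarrow> b < 2^n \<Longrightarrow> f b = 0"
  obtains f' where "prepares n f' f" "\<And>b. a \<le> b \<Longrightarrow> b < 2^n \<Longrightarrow> f' b = 0"
proof -
  have "\<exists>t. bit a t"
  proof (rule ccontr)
    assume "\<nexists>t. bit a t"
    then have "a = 0" by (intro bit_eqI) auto
    then show False using a by simp
  qed
  then obtain t where t: "bit a t" by blast
  have tn: "t < n" using t a(2) unfolding less_two_power_iff by (meson not_le)
  define C where "C = {..<n} - {t}"
  define Z where "Z = {q. bit a q}"
  have tC: "t \<notin> C" by (simp add: C_def)
  have ua: "unset_bit t a < a"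
  proof -
    have "a = set_bit t (unset_bit t a)"
      by (rule bit_eqI) (use t in \<open>auto simp: bit_set_bit_iff bit_unset_bit_iff\<close>)
    also have "\<dots> = unset_bit t a + 2 ^ t" by (simp add: set_bit_eq bit_unset_bit_iff)
    also have "\<dots> > unset_bit t a" by simp
    finally show ?thesis .
  qed
  have sel: "b = a \<or> b = unset_bit t a" if "b < 2^n" "ctrl_on C Z b" for b
  proof -
    have agree: "bit b q = bit a q" if "q \<noteq> t" for q
      using \<open>ctrl_on C Z b\<close> \<open>b < 2^n\<close> a(2) that unfolding ctrl_on_def C_def Z_def less_two_power_iff
      by (cases "q < n") auto
    show ?thesis
    proof (cases "bit b t")
      case True
      then have "b = a" using agree t by (intro bit_eqI) metis
      then show ?thesis by simp
    next
      case False
      then have "b = unset_bit t a" using agree by (intro bit_eqI) (metis bit_unset_bit_iff)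
      then show ?thesis by simp
    qed
  qed
  have Pa: "ctrl_on C Z a" by (simp add: ctrl_on_def Z_def)
  obtain \<alpha> \<theta> where rot: "real_rot \<theta> True False * (cis \<alpha> * f (unset_bit t a)) + real_rot \<theta> True True * (cis (-\<alpha>) * f (set_bit t a)) = 0"
    using rotate_to_zero .
  define g where "g = mul_ctrl C Z t (diag_rot \<alpha>) f"
  define f' where "f' = mul_ctrl C Z t (real_rot \<theta>) g"
  have CC: "C \<subseteq> {..<n} - {t}" by (simp add: C_def)
  have "prepares n f' f"
    using prepares_trans[OF prepares_inverse_rot[OF rot_family_real n tn CC] prepares_inverse_rot[OF rot_family_diag n tn CC]]
    unfolding f'_def g_def .
  moreover have "f' b = 0" if b: "a \<le> b" "b < 2^n" for b
  proof (cases "b = a")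
    case True
    have "f' (set_bit t a) = real_rot \<theta> True False * (cis \<alpha> * f (unset_bit t a)) + real_rot \<theta> True True * (cis (-\<alpha>) * f (set_bit t a))"
      unfolding f'_def g_def mul_ctrl_at[OF tC] using Pa by (simp add: diag_rot_def)
    then show ?thesis using rot set_bit_id[OF t] True by simp
  next
    case False
    then have "\<not> ctrl_on C Z b" using sel[OF b(2)] b(1) ua by auto
    then have "f' b = f b" unfolding f'_def g_def mul_ctrl_def by auto
    then show ?thesis using z False b by simp
  qed
  ultimately show ?thesis by (rule that)
qed

text \<open>Clearing runs downwards from the top index and stops at 0, which has no set bit to
  rotate on.\<close>

lemma prepare_from_basis:
  assumes n: "2 \<le> n"
  obtains f' where "prepares n f' f" "\<And>b. 0 < b \<Longrightarrow> b < 2^n \<Longrightarrow> f' b = 0"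
proof -
  have "\<exists>f'. prepares n f' f \<and> (\<forall>b. j \<le> b \<longrightarrow> b < 2^n \<longrightarrow> f' b = 0)" if "j \<le> 2^n" "1 \<le> j" for j :: nat
    using that
  proof (induction rule: inc_induct)
    case base
    then show ?case using prepares_refl by (intro exI[of _ f]) auto
  next
    case (step j)
    then obtain f1 where f1: "prepares n f1 f" "\<And>b. j < b \<Longrightarrow> b < 2^n \<Longrightarrow> f1 b = 0" by (auto simp: Suc_le_eq)
    have j: "0 < j" "j < 2^n" using step by auto
    obtain f2 where f2: "prepares n f2 f1" "\<And>b. j \<le> b \<Longrightarrow> b < 2^n \<Longrightarrow> f2 b = 0"
      using clear_amplitude[where f=f1, OF n j f1(2)] by blast
    then show ?case using prepares_trans[OF f2(1) f1(1)] by blast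
  qed
  from this[of 1] obtain f' where f': "prepares n f' f" "\<forall>b. 1 \<le> b \<longrightarrow> b < 2^n \<longrightarrow> f' b = 0" by auto
  show ?thesis by (rule that[OF f'(1)]) (use f'(2) in simp)
qed

lemma apply_gates_layers:
  assumes "valid_gates n gs" "v \<in> carrier_vec (2^n)"
  shows "apply_gates n gs v = foldr (*) (map (\<lambda>(i,j,U). gate_on n i j U) gs) (1\<^sub>m (2^n)) *\<^sub>v v
    \<and> foldr (*) (map (\<lambda>(i,j,U). gate_on n i j U) gs) (1\<^sub>m (2^n)) \<in> carrier_mat (2^n) (2^n)"
proof (induction gs)
  case Nil
  then show ?case using assms by (simp add: apply_gates_def)
next
  case (Cons g gs)
  obtain i j U where g: "g = (i,j,U)" by (cases g) auto
  let ?M = "foldr (*) (map (\<lambda>(i,j,U). gate_on n i j U) gs) (1\<^sub>m (2^n))"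
  have M: "?M \<in> carrier_mat (2^n) (2^n)" "apply_gates n gs v = ?M *\<^sub>v v" using Cons by auto
  have "apply_gates n (g # gs) v = gate_on n i j U *\<^sub>v (?M *\<^sub>v v)"
    using M(2) by (simp add: apply_gates_def g)
  also have "\<dots> = (gate_on n i j U * ?M) *\<^sub>v v"
    by (rule assoc_mult_mat_vec[OF gate_on_carrier(1) M(1) assms(2), symmetric])
  finally show ?case using mult_carrier_mat[OF gate_on_carrier(1) M(1)] by (simp add: g)
qed

text \<open>One gate per layer is enough for preparability, where only existence of a circuit
  matters and not its depth.\<close>

lemma gate_layer:
  assumes "i < n" "j < n" "i \<noteq> j" "unitary 4 U"
  shows "layer n (gate_on n i j U)"
  unfolding layer_def using assms
  by (intro exI[of _ "[(i,j,U)]"]) (simp add: right_mult_one_mat[OF gate_on_carrier(1)])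

text \<open>Clearing ends in a multiple of the basis state, so preparation holds up to a global
  phase; comparing states through \<open>outer\<close> hides it.\<close>

lemma outer_smult_unit:
  assumes "cmod c = 1" shows "outer (c \<cdot>\<^sub>v v) = outer v"
proof -
  have "c * cnj c = 1" using complex_norm_square[of c] assms by simp
  then have "c * x * (cnj c * y) = x * y" for x y by (metis (no_types, opaque_lifting) mult.assoc mult.left_commute mult_1)
  then show ?thesis unfolding outer_def by (intro eq_matI) auto
qed

lemma circuit_unitary: "\<forall>L\<in>set Ls. layer n L \<Longrightarrow> unitary (2^n) (foldr (*) Ls (1\<^sub>m (2^n)))"
proof (induction Ls)
  case (Cons L Ls)
  then show ?case using unitary_mult[OF layer_unitary[of n L]] by simp
qed (simp add: unitary_one)

theorem state_preparable:
  assumes n: "2 \<le> n" and \<psi>: "\<psi> \<in> carrier_vec (2^n)" "\<psi> \<bullet>c \<psi> = 1"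
  shows "\<exists>Ls. (\<forall>L\<in>set Ls. layer n L) \<and> outer (foldr (*) Ls (1\<^sub>m (2^n)) *\<^sub>v unit_vec (2^n) 0) = outer \<psi>"
proof -
  obtain f' where f': "prepares n f' (\<lambda>a. \<psi> $ a)" "\<And>b. 0 < b \<Longrightarrow> b < 2^n \<Longrightarrow> f' b = 0"
    using prepare_from_basis[OF n] by blast
  obtain gs where gs: "valid_gates n gs" "apply_gates n gs (vec (2^n) f') = vec (2^n) (\<lambda>a. \<psi> $ a)"
    using f'(1) unfolding prepares_def by blast
  define Ls where "Ls = map (\<lambda>(i,j,U). gate_on n i j U) gs"
  define Q where "Q = foldr (*) Ls (1\<^sub>m (2^n))"
  have L: "\<forall>L\<in>set Ls. layer n L" using gs(1) gate_layer unfolding Ls_def valid_gates_def by auto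
  have Qu: "unitary (2^n) Q" unfolding Q_def using circuit_unitary[OF L] .
  have Qc: "Q \<in> carrier_mat (2^n) (2^n)" using unitary_carrier[OF Qu] .
  define c where "c = f' 0"
  have e: "vec (2^n) f' = c \<cdot>\<^sub>v unit_vec (2^n) 0"
    using f'(2) by (intro eq_vecI) (auto simp: c_def unit_vec_def)
  have "\<psi> = vec (2^n) (\<lambda>a. \<psi> $ a)" using \<psi> by (intro eq_vecI) auto
  also have "\<dots> = Q *\<^sub>v (c \<cdot>\<^sub>v unit_vec (2^n) 0)"
    unfolding gs(2)[symmetric] e[symmetric] Q_def Ls_def using apply_gates_layers[OF gs(1), of "vec (2^n) f'"] by simp
  finally have \<psi>Q: "\<psi> = Q *\<^sub>v (c \<cdot>\<^sub>v unit_vec (2^n) 0)" .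
  also have "\<dots> = c \<cdot>\<^sub>v (Q *\<^sub>v unit_vec (2^n) 0)" using Qc by (intro mult_mat_vec) auto
  finally have \<psi>c: "\<psi> = c \<cdot>\<^sub>v (Q *\<^sub>v unit_vec (2^n) 0)" .
  \<comment> \<open>The amplitude left at index 0 is a pure phase because the circuit preserves
    norms.\<close>
  have "(cmod c)\<^sup>2 = 1"
  proof -
    let ?h = "\<lambda>b. (c \<cdot>\<^sub>v unit_vec (2^n) 0) $ b"
    have "complex_of_real (\<Sum>a<2^n. (cmod (\<psi> $ a))\<^sup>2) = 1"
      unfolding of_real_sum complex_norm_square using \<psi>(2) cscalar_prod_sum[OF \<psi>(1), of \<psi>] by simp
    then have "1 = (\<Sum>a<2^n. (cmod (\<psi> $ a))\<^sup>2)" by (simp only: of_real_eq_1_iff)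
    also have "\<dots> = (\<Sum>a<2^n. (cmod (\<Sum>b<2^n. Q $$ (a,b) * ?h b))\<^sup>2)"
      by (intro sum.cong refl, subst \<psi>Q, subst mat_vec_sum[OF Qc]) auto
    also have "\<dots> = (\<Sum>b<2^n. (cmod (?h b))\<^sup>2)" by (rule unitary_norm_preserving[OF Qu])
    also have "\<dots> = (\<Sum>b<(2::nat)^n. if b = 0 then (cmod c)\<^sup>2 else 0)" by (intro sum.cong refl) (auto simp: unit_vec_def)
    finally show ?thesis by simp
  qed
  then have "cmod c = 1" using power2_eq_imp_eq[of "cmod c" 1] by simp
  then have "outer (Q *\<^sub>v unit_vec (2^n) 0) = outer \<psi>" by (subst \<psi>c) (rule outer_smult_unit[symmetric])
  then show ?thesis using L unfolding Q_def by blast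
qed

section \<open>Entropy of bits with small bias\<close>

lemma sum_even_odd: "(\<Sum>x<2*m. f x) = (\<Sum>y<m. f (2*y) + f (Suc (2*y)))" for m :: nat and f :: "nat \<Rightarrow> real"
  by (induction m) (simp_all add: algebra_simps)

text \<open>Total mass of \<open>n\<close> independent Bernoulli bits, by splitting off the lowest
  bit.\<close>

lemma sum_bernoulli:
  "(\<Sum>x<(2::nat)^n. \<Prod>i<n. if bit x i then t else 1 - t) = (1::real)"
proof (induction n)
  case (Suc n)
  have e: "(\<Prod>i<Suc n. if bit (2*y) i then t else 1 - t) = (1 - t) * (\<Prod>i<n. if bit y i then t else 1 - t)" for y :: nat
    unfolding prod.lessThan_Suc_shift by (simp add: bit_Suc bit_0)
  have o: "(\<Prod>i<Suc n. if bit (Suc (2*y)) i then t else 1 - t) = t * (\<Prod>i<n. if bit y i then t else 1 - t)" for y :: nat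
    unfolding prod.lessThan_Suc_shift by (simp add: bit_Suc bit_0)
  have "(\<Sum>x<(2::nat)^Suc n. \<Prod>i<Suc n. if bit x i then t else 1 - t)
      = (\<Sum>y<(2::nat)^n. \<Prod>i<n. if bit y i then t else 1 - t)"
    unfolding power_Suc sum_even_odd e o by (simp add: algebra_simps)
  then show ?case using Suc.IH by simp
qed simp

text \<open>Gibbs' inequality against the product of Bernoulli distributions with parameter \<open>t\<close>.\<close>
lemma min_entropy_le_binary_entropy:
  fixes p :: "nat \<Rightarrow> real"
  assumes p0: "\<And>x. x < 2^n \<Longrightarrow> 0 \<le> p x" and p1: "(\<Sum>x<2^n. p x) = 1"
    and pk: "\<And>x. x < 2^n \<Longrightarrow> p x \<le> 1 / 2^k"
    and pt: "\<And>i. i < n \<Longrightarrow> (\<Sum>x<2^n. of_bool (bit x i) * p x) \<le> t"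
    and t: "0 \<le> t" "t < 1/2" and n: "0 < n"
  shows "real k \<le> real n * H2 t"
proof (cases "t = 0")
  case True
  \<comment> \<open>For \<open>t = 0\<close> the comparison with \<open>ln t\<close> breaks down,
    but then every bit is 0 with certainty: all mass sits at index 0, and the bound on single
    outcomes forces \<open>k = 0\<close>.\<close>
  have z: "p x = 0" if x: "x < 2^n" "x \<noteq> 0" for x
  proof -
    have "\<exists>i. bit x i" using x(2) by (metis bit_eqI bit_0_eq bot_apply bot_bool_def)
    then obtain i where i: "bit x i" by blast
    have "i < n"
    proof (rule ccontr)
      assume "\<not> i < n"
      then have "x < 2 ^ i" using x(1) by (meson less_le_trans not_less one_le_numeral power_increasing)
      then show False using i by (simp add: bit_iff_odd)
    qed
    have "of_bool (bit x i) * p x \<le> (\<Sum>x<2^n. of_bool (bit x i) * p x)"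
      using x p0 by (intro member_le_sum) auto
    also have "\<dots> \<le> 0" using pt[OF \<open>i < n\<close>] True by simp
    finally show ?thesis using i p0[OF x(1)] by simp
  qed
  have "1 = p 0 + (\<Sum>x\<in>{..<2^n} - {0}. p x)" unfolding p1[symmetric] by (subst sum.remove[of _ 0]) auto
  also have "(\<Sum>x\<in>{..<2^n} - {0}. p x) = 0" using z by (intro sum.neutral) auto
  finally have "1 \<le> 1 / (2::real)^k" using pk[of 0] by simp
  then have "(2::real)^k \<le> 2^0" by (simp add: field_simps)
  then have "k = 0" using power_le_imp_le_exp[of "2::real" k 0] by simp
  then show ?thesis using True by (simp add: H2_def)
next
  case False
  then have t0: "0 < t" "t < 1" using t by auto
  define c where "c = (\<lambda>b. if b then ln t else ln (1 - t))"
  define q where "q = (\<lambda>x::nat. \<Prod>i<n. if bit x i then t else 1 - t)"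
  have qpos: "0 < q x" for x unfolding q_def using t0 by (intro prod_pos) auto
  have lnq: "ln (q x) = (\<Sum>i<n. c (bit x i))" for x
    unfolding q_def c_def using t0 by (subst ln_prod) (auto intro!: sum.cong)
  \<comment> \<open>From \<open>p x \<le> 1 / 2^k\<close> the bracket is at most
    \<open>ln (q x / p x)\<close>, and \<open>ln y \<le> y - 1\<close> gives the rest. Outcomes of
    probability 0 need only positivity of \<open>q\<close>.\<close>
  have main: "p x * (ln (q x) + real k * ln 2) \<le> q x - p x" if x: "x < 2^n" for x
  proof (cases "p x = 0")
    case True
    then show ?thesis using qpos[of x] by simp
  next
    case False
    then have pp: "0 < p x" using p0[OF x] by simp
    have "ln (p x) \<le> ln (1 / 2^k)" using pk[OF x] pp by simp
    then have "real k * ln 2 \<le> - ln (p x)" by (simp add: ln_div ln_realpow)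
    then have "ln (q x) + real k * ln 2 \<le> ln (q x / p x)" using qpos[of x] pp by (simp add: ln_div)
    also have "\<dots> \<le> q x / p x - 1" using qpos[of x] pp by (intro ln_le_minus_one) simp
    finally have "p x * (ln (q x) + real k * ln 2) \<le> p x * (q x / p x - 1)" using pp by (intro mult_left_mono) auto
    also have "p x * (q x / p x - 1) = q x - p x" using pp by (simp add: field_simps)
    finally show ?thesis .
  qed
  have "(\<Sum>x<2^n. p x * (ln (q x) + real k * ln 2)) \<le> (\<Sum>x<2^n. q x - p x)"
    using main by (intro sum_mono) auto
  also have "\<dots> = 0" using sum_bernoulli[where n=n and t=t] p1 by (simp add: sum_subtractf q_def)
  finally have "(\<Sum>x<2^n. p x * ln (q x)) + (\<Sum>x<2^n. p x) * (real k * ln 2) \<le> 0"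
    by (simp add: algebra_simps sum.distrib sum_distrib_left sum_distrib_right)
  then have k: "real k * ln 2 \<le> - (\<Sum>x<2^n. p x * ln (q x))" using p1 by simp
  have "(\<Sum>x<2^n. p x * ln (q x)) = (\<Sum>x<2^n. \<Sum>i<n. p x * c (bit x i))"
    by (simp add: lnq sum_distrib_left)
  also have "\<dots> = (\<Sum>i<n. \<Sum>x<2^n. p x * c (bit x i))" by (rule sum.swap)
  also have "\<dots> \<ge> (\<Sum>i<n. t * ln t + (1 - t) * ln (1 - t))"
  proof (rule sum_mono)
    fix i assume "i \<in> {..<n}"
    then have i: "i < n" by simp
    define P where "P = (\<Sum>x<2^n. of_bool (bit x i) * p x)"
    have "p x * c (bit x i) = p x * ln (1 - t) + (of_bool (bit x i) * p x) * (ln t - ln (1 - t))" for x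
      by (simp add: c_def algebra_simps)
    then have "(\<Sum>x<2^n. p x * c (bit x i)) = (\<Sum>x<2^n. p x) * ln (1 - t) + P * (ln t - ln (1 - t))"
      by (simp only: sum.distrib P_def sum_distrib_right)
    also have "\<dots> \<ge> ln (1 - t) + t * (ln t - ln (1 - t))"
    proof -
      \<comment> \<open>Here \<open>t < 1/2\<close> enters: the coefficient of the bit probability
        \<open>P\<close> is not positive, so \<open>P \<le> t\<close> bounds the sum from
        below.\<close>
      have "ln t - ln (1 - t) \<le> 0" using t0 t by simp
      then have "t * (ln t - ln (1 - t)) \<le> P * (ln t - ln (1 - t))"
        using pt[OF i] unfolding P_def[symmetric] by (intro mult_right_mono_neg) auto
      then show ?thesis using p1 by simp
    qed
    finally show "t * ln t + (1 - t) * ln (1 - t) \<le> (\<Sum>x<2^n. p x * c (bit x i))" by (simp add: algebra_simps)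
  qed
  finally have "real n * (t * ln t + (1 - t) * ln (1 - t)) \<le> (\<Sum>x<2^n. p x * ln (q x))" by simp
  with k have "real k * ln 2 \<le> real n * (- t * ln t - (1 - t) * ln (1 - t))" by (simp add: algebra_simps)
  also have "\<dots> = real n * H2 t * ln 2"
    using t0 by (simp add: H2_def log_def field_simps)
  finally show ?thesis by simp
qed

section \<open>Circuit lower bound\<close>

lemma mtrace_outer_mult:
  assumes "v \<in> carrier_vec N" "G \<in> carrier_mat N N"
  shows "mtrace (outer v * G) = quad_form N G (\<lambda>a. v $ a)"
proof -
  have "mtrace (outer v * G) = (\<Sum>a<N. \<Sum>b<N. cnj (v $ b) * G $$ (b,a) * v $ a)"
    unfolding mtrace_mult[OF outer_carrier[OF assms(1)] assms(2)]
    using assms(1) by (intro sum.cong refl) (simp add: mult_ac)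
  also have "\<dots> = quad_form N G (\<lambda>a. v $ a)" unfolding quad_form_def by (rule sum.swap)
  finally show ?thesis .
qed

lemma code_Gamma_trace_mult:
  assumes V: "V \<in> carrier_mat N D" and G: "G \<in> carrier_mat N N"
  shows "mtrace (code_Gamma k V * G) = (\<Sum>l<D. quad_form N G (\<lambda>a. V $$ (a,l))) / 2^k"
proof -
  have "mtrace (code_Gamma k V * G) = (\<Sum>a<N. \<Sum>b<N. \<Sum>l<D. (cnj (V $$ (b,l)) * G $$ (b,a) * V $$ (a,l)) / 2^k)"
    unfolding mtrace_mult[OF code_Gamma_carrier[OF V] G]
    by (intro sum.cong refl) (simp add: code_Gamma_index[OF V] sum_distrib_left sum_distrib_right sum_divide_distrib mult_ac)
  also have "\<dots> = (\<Sum>l<D. \<Sum>a<N. \<Sum>b<N. (cnj (V $$ (b,l)) * G $$ (b,a) * V $$ (a,l)) / 2^k)" by (rule sum_rotate)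
  also have "\<dots> = (\<Sum>l<D. \<Sum>b<N. \<Sum>a<N. (cnj (V $$ (b,l)) * G $$ (b,a) * V $$ (a,l)) / 2^k)"
    by (rule sum.cong[OF refl], rule sum.swap)
  finally show ?thesis unfolding quad_form_def sum_divide_distrib .
qed

text \<open>\<open>replacement_decoupling\<close> holds for every recovery, so it survives the
  infimum; one replacement state on \<open>S\<close> then places it below the supremum, which is
  finite because purified distances are at most 1.\<close>

lemma max_repl_inacc_bounds:
  assumes V: "V \<in> carrier_mat (2^n) (2^k)" "adj V * V = 1\<^sub>m (2^k)"
    and S: "S \<subseteq> {0..<n}" "card S \<le> d"
    and G: "supported n S G" "unitary (2^n) G" "adj G = G"
    and \<phi>: "\<phi>0 \<in> carrier_vec (2^k)" "\<phi>0 \<bullet>c \<phi>0 = 1" "\<phi>1 \<in> carrier_vec (2^k)" "\<phi>1 \<bullet>c \<phi>1 = 1"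
  shows "cmod (quad_form (2^n) G (\<lambda>a. (V *\<^sub>v \<phi>0) $ a) - quad_form (2^n) G (\<lambda>a. (V *\<^sub>v \<phi>1) $ a))
     \<le> 4 * max_repl_inacc n k V d"
proof -
  let ?\<phi> = "\<lambda>r::nat. if r = 0 then \<phi>0 else \<phi>1"
  let ?P = "\<lambda>S \<gamma> R. purified_dist (2^k) (2^k) (R \<circ> replacement n S \<gamma> \<circ> encoding V) id"
  obtain R0 where R0: "kraus_channel (2^n) (2^k) R0" using kraus_channel_exists[of "2^k" "2^n"] by auto
  \<comment> \<open>A concrete replacement state, the first basis state, serves as the member of the
    supremum.\<close>
  let ?\<gamma> = "outer (unit_vec (2 ^ card S) 0)"
  have \<gamma>: "density (2 ^ card S) ?\<gamma>" by (rule density_outer) (auto simp: scalar_prod_left_unit)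
  let ?q = "cmod (quad_form (2^n) G (\<lambda>a. (V *\<^sub>v \<phi>0) $ a) - quad_form (2^n) G (\<lambda>a. (V *\<^sub>v \<phi>1) $ a))"
  have "?q / 4 \<le> qec_inacc n k (replacement n S ?\<gamma>) (encoding V)"
    unfolding qec_inacc_def
  proof (rule cInf_greatest)
    show "{?P S ?\<gamma> R | R. kraus_channel (2^n) (2^k) R} \<noteq> {}" using R0 by blast
    fix x assume "x \<in> {?P S ?\<gamma> R | R. kraus_channel (2^n) (2^k) R}"
    then obtain R where R: "kraus_channel (2^n) (2^k) R" "x = ?P S ?\<gamma> R" by blast
    have "?q \<le> 4 * ?P S ?\<gamma> R"
      using replacement_decoupling(3)[OF V S(1) \<gamma> R(1) G, of ?\<phi>] \<phi> by simp
    then show "?q / 4 \<le> x" using R(2) by simp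
  qed
  also have "\<dots> \<le> max_repl_inacc n k V d"
    unfolding max_repl_inacc_def
  proof (rule cSup_upper)
    show "qec_inacc n k (replacement n S ?\<gamma>) (encoding V) \<in> {qec_inacc n k (replacement n S \<gamma>) (encoding V) | S \<gamma>.
      S \<subseteq> {0..<n} \<and> card S \<le> d \<and> density (2 ^ card S) \<gamma>}" using S \<gamma> by blast
    show "bdd_above {qec_inacc n k (replacement n S \<gamma>) (encoding V) | S \<gamma>.
      S \<subseteq> {0..<n} \<and> card S \<le> d \<and> density (2 ^ card S) \<gamma>}"
    proof (rule bdd_aboveI[of _ 1])
      fix x assume "x \<in> {qec_inacc n k (replacement n S \<gamma>) (encoding V) | S \<gamma>.
        S \<subseteq> {0..<n} \<and> card S \<le> d \<and> density (2 ^ card S) \<gamma>}"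
      then obtain S' \<gamma>' where x: "x = qec_inacc n k (replacement n S' \<gamma>') (encoding V)"
        and S': "S' \<subseteq> {0..<n}" and \<gamma>': "density (2 ^ card S') \<gamma>'" by blast
      \<comment> \<open>The identity is a harmless observable here; only the bounds
        \<open>0 \<le> P\<close> and \<open>P \<le> 1\<close> are taken from
        \<open>replacement_decoupling\<close>.\<close>
      have one: "supported n S' (1\<^sub>m (2^n))" by (rule supportedI) (auto simp: flip_less, metis flip_flip)
      have bd: "0 \<le> ?P S' \<gamma>' R" "?P S' \<gamma>' R \<le> 1" if "kraus_channel (2^n) (2^k) R" for R
        using replacement_decoupling(1,2)[OF V S' \<gamma>' that one unitary_one adj_one, of ?\<phi>] \<phi> by simp_all
      show "x \<le> 1" unfolding x qec_inacc_def
      proof (rule cInf_lower2)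
        show "?P S' \<gamma>' R0 \<in> {?P S' \<gamma>' R | R. kraus_channel (2^n) (2^k) R}" using R0 by blast
        show "?P S' \<gamma>' R0 \<le> 1" using bd R0 by blast
        show "bdd_below {?P S' \<gamma>' R | R. kraus_channel (2^n) (2^k) R}"
          by (rule bdd_belowI[of _ 0]) (use bd in blast)
      qed
    qed
  qed
  finally show ?thesis by simp
qed

text \<open>With \<open>c\<close> the adjoint of \<open>V\<close> applied to \<open>w\<close>, the
  squared norm of \<open>c\<close> is the overlap of \<open>w\<close> with \<open>V c\<close>, at
  most the product of the norms of \<open>w\<close> and \<open>c\<close>. This is the source of the
  bound \<open>1 / 2^k\<close> on outcome probabilities.\<close>

lemma isometry_adjoint_contraction:
  assumes V: "V \<in> carrier_mat N D" "adj V * V = 1\<^sub>m D"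
  shows "(\<Sum>l<D. (cmod (\<Sum>a<N. cnj (w a) * V $$ (a,l)))\<^sup>2) \<le> (\<Sum>a<N. (cmod (w a))\<^sup>2)"
proof -
  define c where "c = (\<lambda>l. \<Sum>a<N. w a * cnj (V $$ (a,l)))"
  define C where "C = (\<Sum>l<D. (cmod (c l))\<^sup>2)"
  define W where "W = (\<Sum>a<N. (cmod (w a))\<^sup>2)"
  let ?v = "vec D c"
  have vc: "?v \<in> carrier_vec D" by simp
  have sq: "complex_of_real ((cmod x)\<^sup>2) = cnj x * x" for x by (simp only: complex_norm_square mult.commute)
  have Vv: "(V *\<^sub>v ?v) $ a = (\<Sum>l<D. V $$ (a,l) * c l)" if "a < N" for a
    using mat_vec_sum[OF V(1) vc that] by simp
  have "complex_of_real (\<Sum>a<N. (cmod ((V *\<^sub>v ?v) $ a))\<^sup>2) = of_real C"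
    unfolding C_def of_real_sum sq using isometry_norm[OF V vc] by simp
  then have nV: "(\<Sum>a<N. (cmod ((V *\<^sub>v ?v) $ a))\<^sup>2) = C" by (simp only: of_real_eq_iff)
  have "complex_of_real C = (\<Sum>l<D. \<Sum>a<N. (w a * cnj (V $$ (a,l))) * cnj (c l))"
    unfolding C_def of_real_sum complex_norm_square by (subst c_def) (simp add: sum_distrib_right)
  also have "\<dots> = (\<Sum>a<N. \<Sum>l<D. (w a * cnj (V $$ (a,l))) * cnj (c l))" by (rule sum.swap)
  also have "\<dots> = (\<Sum>a<N. w a * cnj ((V *\<^sub>v ?v) $ a))"
    by (intro sum.cong refl) (simp add: Vv sum_distrib_left mult_ac)
  finally have "C = cmod (\<Sum>a<N. w a * cnj ((V *\<^sub>v ?v) $ a))"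
    using norm_of_real[of C, where 'a=complex] by (simp add: C_def sum_nonneg)
  also have "\<dots> \<le> sqrt W * sqrt C"
    using Cauchy_Schwarz_complex_sum[of w "\<lambda>a. cnj ((V *\<^sub>v ?v) $ a)" "{..<N}"] unfolding W_def by (simp add: nV)
  finally have le: "C \<le> sqrt W * sqrt C" .
  have "C \<ge> 0" "W \<ge> 0" unfolding C_def W_def by (auto intro: sum_nonneg)
  have "C \<le> W"
  proof (cases "C = 0")
    case False
    then have "0 < sqrt C" using \<open>C \<ge> 0\<close> by simp
    moreover have "sqrt C * sqrt C \<le> sqrt W * sqrt C" using le \<open>C \<ge> 0\<close> by simp
    ultimately have "sqrt C \<le> sqrt W" using mult_right_le_imp_le[of "sqrt C" "sqrt C" "sqrt W"] by blast
    then show ?thesis by simp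
  qed (use \<open>W \<ge> 0\<close> in simp)
  moreover have "(\<Sum>l<D. (cmod (\<Sum>a<N. cnj (w a) * V $$ (a,l)))\<^sup>2) = C"
    unfolding C_def
  proof (intro sum.cong refl)
    fix l
    have "(\<Sum>a<N. cnj (w a) * V $$ (a,l)) = cnj (c l)" by (simp add: c_def)
    then show "(cmod (\<Sum>a<N. cnj (w a) * V $$ (a,l)))\<^sup>2 = (cmod (c l))\<^sup>2" by simp
  qed
  ultimately show ?thesis unfolding W_def by simp
qed

section \<open>Computational-basis measurements as conjugated diagonal observables\<close>

definition diag_real :: "nat \<Rightarrow> (nat \<Rightarrow> real) \<Rightarrow> cmat" where
  "diag_real N z = mat N N (\<lambda>(a,b). if a = b then of_real (z a) else 0)"

lemma diag_real_carrier [simp]: "diag_real N z \<in> carrier_mat N N"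
  by (simp add: diag_real_def)

text \<open>The expectation is the average of \<open>z\<close> over outcomes of undoing
  \<open>U\<close> and measuring in the computational basis; outcome \<open>x\<close> is weighted by
  the form of \<open>\<rho>\<close> at column \<open>x\<close> of \<open>U\<close>.\<close>

lemma mtrace_conj_diag:
  assumes \<rho>: "\<rho> \<in> carrier_mat N N" and U: "U \<in> carrier_mat N N"
  shows "mtrace (\<rho> * conj_by U (diag_real N z)) = (\<Sum>x<N. of_real (z x) * quad_form N \<rho> (\<lambda>a. U $$ (a,x)))"
proof -
  let ?G = "conj_by U (diag_real N z)"
  have G: "?G \<in> carrier_mat N N" using U by simp
  have Gi: "?G $$ (b,a) = (\<Sum>x<N. of_real (z x) * (U $$ (b,x) * cnj (U $$ (a,x))))" if "a < N" "b < N" for a b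
  proof -
    have "?G $$ (b,a) = (\<Sum>x<N. \<Sum>y<N. U $$ (b,x) * diag_real N z $$ (x,y) * cnj (U $$ (a,y)))"
      unfolding conj_by_def by (rule sandwich_index[OF U diag_real_carrier that(2,1)])
    also have "\<dots> = (\<Sum>x<N. \<Sum>y<N. if y = x then of_real (z x) * (U $$ (b,x) * cnj (U $$ (a,x))) else 0)"
      by (intro sum.cong refl) (auto simp: diag_real_def)
    finally show ?thesis by simp
  qed
  have "mtrace (\<rho> * ?G) = (\<Sum>a<N. \<Sum>b<N. \<Sum>x<N. of_real (z x) * (cnj (U $$ (a,x)) * \<rho> $$ (a,b) * U $$ (b,x)))"
    unfolding mtrace_mult[OF \<rho> G] by (intro sum.cong refl) (simp add: Gi sum_distrib_left mult_ac)
  also have "\<dots> = (\<Sum>x<N. \<Sum>a<N. \<Sum>b<N. of_real (z x) * (cnj (U $$ (a,x)) * \<rho> $$ (a,b) * U $$ (b,x)))"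
    by (rule sum_rotate)
  finally show ?thesis unfolding quad_form_def sum_distrib_left .
qed

definition pauli_z :: "nat \<Rightarrow> nat \<Rightarrow> real" where
  "pauli_z i x = (if bit x i then -1 else 1)"

lemma pauli_z_supported: "supported n {i} (diag_real (2^n) (pauli_z i))"
proof (rule supportedI)
  fix q a b :: nat assume "q < n" "q \<notin> {i}" "a < 2^n" "b < 2^n" "bit a q \<noteq> bit b q"
  then show "diag_real (2^n) (pauli_z i) $$ (a,b) = 0" by (auto simp: diag_real_def)
next
  fix q a b :: nat assume q: "q < n" "q \<notin> {i}" and ab: "a < 2^n" "b < 2^n"
  have "flip_bit q a = flip_bit q b \<longleftrightarrow> a = b" by (metis flip_flip)
  then show "diag_real (2^n) (pauli_z i) $$ (flip_bit q a, flip_bit q b) = diag_real (2^n) (pauli_z i) $$ (a,b)"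
    using q ab flip_less[OF q(1)] by (simp add: diag_real_def pauli_z_def)
qed

lemma diag_real_adj [simp]: "adj (diag_real N z) = diag_real N z"
  by (rule eq_matI) (auto simp: diag_real_def)

lemma pauli_z_unitary: "unitary N (diag_real N (pauli_z i))"
proof -
  have "diag_real N (pauli_z i) * diag_real N (pauli_z i) = 1\<^sub>m N"
  proof (rule eq_matI)
    fix a b assume "a < dim_row (1\<^sub>m N :: cmat)" "b < dim_col (1\<^sub>m N :: cmat)"
    then have ab: "a < N" "b < N" by auto
    have "(diag_real N (pauli_z i) * diag_real N (pauli_z i)) $$ (a,b) = (\<Sum>c<N. if c = a then (if a = b then 1 else 0) else 0)"
      unfolding mat_mult_sum[OF diag_real_carrier diag_real_carrier ab]
      using ab by (intro sum.cong refl) (auto simp: diag_real_def pauli_z_def)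
    then show "(diag_real N (pauli_z i) * diag_real N (pauli_z i)) $$ (a,b) = 1\<^sub>m N $$ (a,b)" using ab by simp
  qed (auto simp: diag_real_def)
  then show ?thesis by (simp add: unitary_def)
qed

lemma conj_by_unitary: "unitary D U \<Longrightarrow> unitary D G \<Longrightarrow> unitary D (conj_by U G)"
  unfolding conj_by_def by (intro unitary_mult unitary_adj)

lemma conj_by_hermitian:
  assumes U: "U \<in> carrier_mat D D" and G: "G \<in> carrier_mat D D" "adj G = G"
  shows "adj (conj_by U G) = conj_by U G"
proof -
  have "adj (conj_by U G) = U * (G * adj U)"
    unfolding conj_by_def adj_mult[OF mult_carrier_mat[OF U G(1)] adj_carrier[OF U]] adj_mult[OF U G(1)] G(2) by simp
  also have "\<dots> = conj_by U G"
    unfolding conj_by_def by (rule assoc_mult_mat[OF U G(1) adj_carrier[OF U], symmetric])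
  finally show ?thesis .
qed

lemma H2_nonneg: "0 \<le> H2 p"
proof (cases "p \<le> 0 \<or> 1 \<le> p")
  case False
  then have "log 2 p \<le> 0" "log 2 (1 - p) \<le> 0" by auto
  then have "p * log 2 p \<le> 0" "(1 - p) * log 2 (1 - p) \<le> 0" using False by (auto intro: mult_nonneg_nonpos)
  then show ?thesis using False by (simp add: H2_def)
qed (simp add: H2_def)

text \<open>Both hypotheses of the theorem enter only through a bound \<open>e\<close> on how well
  observables on at most \<open>d\<close> qubits distinguish the code state from
  \<open>code_Gamma\<close>, so \<open>e\<close> is a parameter.\<close>

lemma shallow_circuit_entropy_bound:
  assumes V: "V \<in> carrier_mat (2^n) (2^k)" "adj V * V = 1\<^sub>m (2^k)" and n: "0 < n"
    and \<psi>: "\<psi> \<in> carrier_vec (2^n)" and \<psi>': "\<psi>' \<in> carrier_vec (2^n)" "trace_norm (outer \<psi>' - outer \<psi>) \<le> \<delta>"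
    and Ls: "\<forall>L\<in>set Ls. layer n L" "2 ^ length Ls \<le> d"
      "outer (foldr (*) Ls (1\<^sub>m (2^n)) *\<^sub>v unit_vec (2^n) 0) = outer \<psi>'"
    and e: "\<And>S G. S \<subseteq> {0..<n} \<Longrightarrow> card S \<le> d \<Longrightarrow> supported n S G \<Longrightarrow> unitary (2^n) G \<Longrightarrow> adj G = G \<Longrightarrow>
      cmod (mtrace (outer \<psi> * G) - mtrace (code_Gamma k V * G)) \<le> e"
    and t: "t = e / 2 + \<delta> / 2" "0 \<le> t" "t < 1/2"
  shows "real k \<le> real n * H2 t"
proof -
  define N where "N = (2::nat) ^ n"
  define U where "U = foldr (*) Ls (1\<^sub>m (2^n))"
  define \<Gamma> where "\<Gamma> = code_Gamma k V"
  have Uu: "unitary N U" unfolding N_def U_def by (rule circuit_unitary[OF Ls(1)])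
  have U: "U \<in> carrier_mat N N" using unitary_carrier[OF Uu] .
  have V': "V \<in> carrier_mat N (2^k)" using V by (simp add: N_def)
  have \<Gamma>: "\<Gamma> \<in> carrier_mat N N" unfolding \<Gamma>_def by (rule code_Gamma_carrier[OF V'])
  have Ucol: "(\<Sum>a<N. cnj (U $$ (a,x)) * U $$ (a,y)) = (if x = y then 1 else 0)" if "x < N" "y < N" for x y
    using isometry_columns[of U N N x y] Uu that by (simp add: unitary_def)
  \<comment> \<open>Outcome distribution of \<open>\<Gamma>\<close> after undoing the circuit:
    squared overlaps of column \<open>x\<close> of \<open>U\<close> with the columns of
    \<open>V\<close>, averaged over the latter.\<close>
  define p where "p = (\<lambda>x. (\<Sum>l<2^k. (cmod (\<Sum>a<N. cnj (U $$ (a,x)) * V $$ (a,l)))\<^sup>2) / 2^k)"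
  have qp: "quad_form N \<Gamma> (\<lambda>a. U $$ (a,x)) = of_real (p x)" for x
  proof -
    have s: "complex_of_real (1 / sqrt (2^k)) * of_real (1 / sqrt (2^k)) = 1 / 2^k"
    proof -
      have "1 / sqrt (2^k) * (1 / sqrt (2^k)) = (1 / 2^k :: real)" by simp
      then show ?thesis by (simp only: of_real_mult[symmetric]) simp
    qed
    have "quad_form N \<Gamma> (\<lambda>a. U $$ (a,x)) = of_real (\<Sum>l<2^k. (cmod (\<Sum>a<N. cnj (U $$ (a,x)) * (of_real (1 / sqrt (2^k)) * V $$ (a,l))))\<^sup>2)"
    proof (rule quad_form_gram)
      fix a b assume ab: "a < N" "b < N"
      have "(\<Sum>l<2^k. of_real (1 / sqrt (2^k)) * V $$ (a,l) * cnj (of_real (1 / sqrt (2^k)) * V $$ (b,l)))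
        = (\<Sum>l<2^k. (complex_of_real (1 / sqrt (2^k)) * of_real (1 / sqrt (2^k))) * (V $$ (a,l) * cnj (V $$ (b,l))))"
        by (intro sum.cong refl) (simp only: complex_cnj_mult complex_cnj_complex_of_real mult_ac)
      then show "\<Gamma> $$ (a,b) = (\<Sum>l<2^k. of_real (1 / sqrt (2^k)) * V $$ (a,l) * cnj (of_real (1 / sqrt (2^k)) * V $$ (b,l)))"
        unfolding \<Gamma>_def code_Gamma_index[OF V' ab] s by (simp only: sum_distrib_left)
    qed
    also have "(\<Sum>l<2^k. (cmod (\<Sum>a<N. cnj (U $$ (a,x)) * (of_real (1 / sqrt (2^k)) * V $$ (a,l))))\<^sup>2) = p x"
      unfolding p_def sum_divide_distrib
    proof (intro sum.cong refl)
      fix l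
      have "(\<Sum>a<N. cnj (U $$ (a,x)) * (of_real (1 / sqrt (2^k)) * V $$ (a,l))) = of_real (1 / sqrt (2^k)) * (\<Sum>a<N. cnj (U $$ (a,x)) * V $$ (a,l))"
        unfolding sum_distrib_left by (intro sum.cong refl) (simp only: mult.left_commute)
      then show "(cmod (\<Sum>a<N. cnj (U $$ (a,x)) * (of_real (1 / sqrt (2^k)) * V $$ (a,l))))\<^sup>2
        = (cmod (\<Sum>a<N. cnj (U $$ (a,x)) * V $$ (a,l)))\<^sup>2 / 2^k"
        by (simp add: norm_mult power_mult_distrib norm_divide power_divide norm_power)
    qed
    finally show ?thesis .
  qed
  have tr: "mtrace (\<Gamma> * conj_by U (diag_real N z)) = of_real (\<Sum>x<N. z x * p x)" for z
    unfolding mtrace_conj_diag[OF \<Gamma> U] qp by simp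
  have psum: "(\<Sum>x<N. p x) = 1"
  proof -
    have "diag_real N (\<lambda>_. 1) = 1\<^sub>m N" by (rule eq_matI) (auto simp: diag_real_def)
    moreover have "conj_by U (1\<^sub>m N) = 1\<^sub>m N" using unitary_adj_right[OF Uu] U by (simp add: conj_by_def)
    ultimately have "complex_of_real (\<Sum>x<N. p x) = mtrace (\<Gamma> * 1\<^sub>m N)" using tr[of "\<lambda>_. 1"] by simp
    also have "\<dots> = (\<Sum>l<2^k. quad_form N (1\<^sub>m N) (\<lambda>a. V $$ (a,l))) / 2^k"
      unfolding \<Gamma>_def by (rule code_Gamma_trace_mult[OF V' one_carrier_mat])
    also have "\<dots> = (\<Sum>l<(2::nat)^k. 1) / 2^k"
    proof -
      have "quad_form N (1\<^sub>m N) (\<lambda>a. V $$ (a,l)) = 1" if "l < 2^k" for l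
      proof -
        have "quad_form N (1\<^sub>m N) (\<lambda>a. V $$ (a,l)) = (\<Sum>a<N. \<Sum>b<N. if b = a then cnj (V $$ (a,l)) * V $$ (a,l) else 0)"
          unfolding quad_form_def by (intro sum.cong refl) auto
        also have "\<dots> = 1" using isometry_columns[OF V' V(2) that that] by simp
        finally show ?thesis .
      qed
      then show ?thesis by simp
    qed
    finally have "complex_of_real (\<Sum>x<N. p x) = 1" by simp
    then show ?thesis by (simp only: of_real_eq_1_iff)
  qed
  have p0: "0 \<le> p x" for x unfolding p_def by (simp add: sum_nonneg)
  have pk: "p x \<le> 1 / 2^k" if "x < N" for x
  proof -
    have "complex_of_real (\<Sum>a<N. (cmod (U $$ (a,x)))\<^sup>2) = 1"
      unfolding of_real_sum complex_norm_square using Ucol[OF that that] by (simp add: mult.commute)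
    then have "(\<Sum>a<N. (cmod (U $$ (a,x)))\<^sup>2) = 1" by (simp only: of_real_eq_1_iff)
    then show ?thesis unfolding p_def
      using isometry_adjoint_contraction[OF V' V(2), of "\<lambda>a. U $$ (a,x)"] by (intro divide_right_mono) auto
  qed
  have "(\<Sum>x<N. of_bool (bit x i) * p x) \<le> t" if i: "i < n" for i
  proof -
    define G where "G = conj_by U (diag_real N (pauli_z i))"
    have Gu: "unitary (2^n) G" using conj_by_unitary[OF Uu pauli_z_unitary] unfolding G_def N_def .
    have Gh: "adj G = G" unfolding G_def by (rule conj_by_hermitian[OF U diag_real_carrier diag_real_adj])
    have Gc: "G \<in> carrier_mat N N" using unitary_carrier[OF Gu] by (simp add: N_def)
    have si: "{i} \<subseteq> {0..<n}" using i by simp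
    obtain S where S: "S \<subseteq> {0..<n}" "card S \<le> 2 ^ length Ls * card {i}" "supported n S G"
      using circuit_light_cone[OF Ls(1) pauli_z_supported diag_real_carrier si] unfolding G_def U_def N_def by blast
    have "card S \<le> d" using S(2) Ls(2) by simp
    from e[OF S(1) this S(3) Gu Gh]
    have b1: "cmod (mtrace (outer \<psi> * G) - mtrace (\<Gamma> * G)) \<le> e" unfolding \<Gamma>_def .
    have dc: "outer \<psi>' - outer \<psi> \<in> carrier_mat (2^n) (2^n)"
      by (rule minus_carrier_mat[OF outer_carrier[OF \<psi>]])
    have dh: "adj (outer \<psi>' - outer \<psi>) = outer \<psi>' - outer \<psi>"
      unfolding adj_minus[OF outer_carrier[OF \<psi>'(1)] outer_carrier[OF \<psi>]] outer_hermitian ..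
    have b2: "cmod (mtrace (outer \<psi>' * G) - mtrace (outer \<psi> * G)) \<le> \<delta>"
      using trace_mult_unitary_le[OF dc dh Gu] \<psi>'(2) mtrace_minus_mult[OF outer_carrier[OF \<psi>'(1)] outer_carrier[OF \<psi>] unitary_carrier[OF Gu]]
      by simp
    \<comment> \<open>Bit \<open>i\<close> of the initial basis state is 0, so the conjugated Pauli
      observable stabilises the prepared state. That state is known only through its
      \<open>outer\<close>, which suffices.\<close>
    have b3: "mtrace (outer \<psi>' * G) = 1"
    proof -
      let ?v = "U *\<^sub>v unit_vec (2^n) 0"
      have N0: "0 < N" by (simp add: N_def)
      have vi: "?v $ a = U $$ (a,0)" if "a < N" for a
        using that U N0 by (simp add: N_def scalar_prod_right_unit)
      have vc: "?v \<in> carrier_vec N" using U by (auto simp: N_def)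
      have oi: "outer ?v $$ (a,b) = U $$ (a,0) * cnj (U $$ (b,0))" if "a < N" "b < N" for a b
        using outer_index[of a ?v b] carrier_vecD[OF vc] that vi[OF that(1)] vi[OF that(2)] by metis
      have "mtrace (outer \<psi>' * G) = mtrace (outer ?v * G)" using Ls(3) by (simp add: U_def)
      also have "\<dots> = (\<Sum>x<N. of_real (pauli_z i x) * quad_form N (outer ?v) (\<lambda>a. U $$ (a,x)))"
        unfolding G_def by (rule mtrace_conj_diag[OF outer_carrier[OF vc] U])
      also have "\<dots> = (\<Sum>x<N. if x = 0 then 1 else 0)"
      proof (intro sum.cong refl)
        fix x assume x: "x \<in> {..<N}"
        have "quad_form N (outer ?v) (\<lambda>a. U $$ (a,x)) = (\<Sum>a<N. \<Sum>b<N. (cnj (U $$ (a,x)) * U $$ (a,0)) * (cnj (U $$ (b,0)) * U $$ (b,x)))"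
          unfolding quad_form_def by (intro sum.cong refl) (simp add: oi mult_ac)
        also have "\<dots> = (\<Sum>a<N. cnj (U $$ (a,x)) * U $$ (a,0)) * (\<Sum>b<N. cnj (U $$ (b,0)) * U $$ (b,x))"
          unfolding sum_product ..
        also have "\<dots> = (if x = 0 then 1 else 0)" using Ucol[of x 0] Ucol[of 0 x] x N0 by simp
        finally show "of_real (pauli_z i x) * quad_form N (outer ?v) (\<lambda>a. U $$ (a,x)) = (if x = 0 then 1 else 0)"
          by (simp add: pauli_z_def)
      qed
      also have "\<dots> = 1" using N0 by simp
      finally show ?thesis .
    qed
    have "mtrace (\<Gamma> * G) = of_real (\<Sum>x<N. pauli_z i x * p x)" unfolding G_def by (rule tr)
    moreover have "cmod (1 - mtrace (\<Gamma> * G)) \<le> e + \<delta>"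
      using norm_triangle_ineq[of "mtrace (outer \<psi>' * G) - mtrace (outer \<psi> * G)" "mtrace (outer \<psi> * G) - mtrace (\<Gamma> * G)"]
        b1 b2 unfolding b3 by simp
    ultimately have "cmod (of_real (1 - (\<Sum>x<N. pauli_z i x * p x))) \<le> e + \<delta>" by simp
    then have "1 - (\<Sum>x<N. pauli_z i x * p x) \<le> e + \<delta>" unfolding norm_of_real by linarith
    then have "(1 - (\<Sum>x<N. pauli_z i x * p x)) / 2 \<le> (e + \<delta>) / 2" by (rule divide_right_mono) simp
    \<comment> \<open>The probability of a 1 is \<open>(1 - z) / 2\<close> for Pauli expectation
      \<open>z\<close>, whence the halves in \<open>t\<close>.\<close>
    moreover have "(\<Sum>x<N. of_bool (bit x i) * p x) = ((\<Sum>x<N. p x) - (\<Sum>x<N. pauli_z i x * p x)) / 2"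
      unfolding sum_subtractf[symmetric] sum_divide_distrib by (intro sum.cong refl) (auto simp: pauli_z_def)
    ultimately show ?thesis by (simp only: psum t(1) add_divide_distrib)
  qed
  then show ?thesis using p0 pk psum t n unfolding N_def by (intro min_entropy_le_binary_entropy[where p=p]) auto
qed

theorem theorem3:
  fixes n k d :: nat and \<delta> :: real and V :: "complex mat" and \<psi> :: "complex vec"
  assumes "k < n"
    and "V \<in> carrier_mat (2^n) (2^k)" and "adj V * V = 1\<^sub>m (2^k)"
    and "1 \<le> d" and "0 \<le> \<delta>"
    and "(eps_g_complete n k V d / 2 + \<delta> / 2 < 1/2 \<and>
            H2 (eps_g_complete n k V d / 2 + \<delta> / 2) < real k / real n)
       \<or> (2 * max_repl_inacc n k V d + \<delta> / 2 < 1/2 \<and>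
            H2 (2 * max_repl_inacc n k V d + \<delta> / 2) < real k / real n)"
    and "\<psi> \<in> code_space n k V" and "\<psi> \<bullet>c \<psi> = 1"
  shows "log 2 (real d) < real (circ_complexity n \<delta> \<psi>)"
proof (rule ccontr)
  note V = assms(2,3)
  assume neg: "\<not> log 2 (real d) < real (circ_complexity n \<delta> \<psi>)"
  \<comment> \<open>Nonnegativity of \<open>H2\<close> forces \<open>k > 0\<close>; with
    \<open>k < n\<close> this leaves at least two qubits, so two-qubit gates exist.\<close>
  have "0 < real k / real n" using assms(6) H2_nonneg order_le_less_trans by blast
  then have n2: "2 \<le> n" using assms(1) by (cases k) auto
  obtain \<phi> where \<phi>: "\<psi> = V *\<^sub>v \<phi>" "\<phi> \<in> carrier_vec (2^k)" using assms(7) by (auto simp: code_space_def)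
  have \<psi>: "\<psi> \<in> carrier_vec (2^n)" using \<phi> V(1) by auto
  have \<phi>1: "\<phi> \<bullet>c \<phi> = 1"
    using isometry_norm[OF V \<phi>(2)] assms(8) \<phi> cscalar_prod_sum[OF \<psi>, of \<psi>] cscalar_prod_sum[OF \<phi>(2), of \<phi>]
    by (simp add: mult.commute)
  \<comment> \<open>\<open>LeastI_ex\<close> asks for one admissible circuit; the code state itself,
    at distance 0, is preparable.\<close>
  have ex: "\<exists>D \<psi>' Ls. \<psi>' \<in> carrier_vec (2^n) \<and> \<psi>' \<bullet>c \<psi>' = 1 \<and>
      trace_norm (outer \<psi>' - outer \<psi>) \<le> \<delta> \<and> length Ls = D \<and> (\<forall>L\<in>set Ls. layer n L) \<and>
      outer (foldr (*) Ls (1\<^sub>m (2^n)) *\<^sub>v unit_vec (2^n) 0) = outer \<psi>'"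
  proof -
    have "outer \<psi> - outer \<psi> = 0\<^sub>m (2^n) (2^n)" by (rule minus_r_inv_mat[OF outer_carrier[OF \<psi>]])
    moreover have "trace_norm (0\<^sub>m (2^n) (2^n)) \<le> 0"
    proof -
      have "adj (0\<^sub>m (2^n) (2^n)) = 0\<^sub>m (2^n) (2^n)" by (intro eq_matI) auto
      from trace_norm_le_entries[OF zero_carrier_mat this] show ?thesis by simp
    qed
    ultimately have "trace_norm (outer \<psi> - outer \<psi>) \<le> \<delta>" using assms(5) by simp
    then show ?thesis using state_preparable[OF n2 \<psi> assms(8)] \<psi> assms(8) by blast
  qed
  define D where "D = circ_complexity n \<delta> \<psi>"
  obtain \<psi>' Ls where Ls: "\<psi>' \<in> carrier_vec (2^n)" "trace_norm (outer \<psi>' - outer \<psi>) \<le> \<delta>" "length Ls = D"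
    "\<forall>L\<in>set Ls. layer n L" "outer (foldr (*) Ls (1\<^sub>m (2^n)) *\<^sub>v unit_vec (2^n) 0) = outer \<psi>'"
    using LeastI_ex[OF ex] unfolding D_def circ_complexity_def by blast
  have "real D \<le> log 2 (real d)" using neg by (simp add: D_def)
  then have "2 powr real D \<le> 2 powr (log 2 (real d))" by simp
  then have "(2::real) ^ D \<le> real d" using assms(4) by (simp add: powr_realpow)
  then have "real (2 ^ D) \<le> real d" by simp
  then have Dd: "2 ^ length Ls \<le> d" unfolding Ls(3) by (simp only: of_nat_le_iff)
  have bound: False if e: "\<And>S G. S \<subseteq> {0..<n} \<Longrightarrow> card S \<le> d \<Longrightarrow> supported n S G \<Longrightarrow> unitary (2^n) G \<Longrightarrow> adj G = G \<Longrightarrow>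
      cmod (mtrace (outer \<psi> * G) - mtrace (code_Gamma k V * G)) \<le> e"
    and h: "e / 2 + \<delta> / 2 < 1/2" "H2 (e / 2 + \<delta> / 2) < real k / real n" for e
  proof -
    \<comment> \<open>The identity, supported on the empty set, is an admissible observable; it
      shows \<open>0 \<le> e\<close>, so the argument of \<open>H2\<close> is nonnegative.\<close>
    have one: "supported n {} (1\<^sub>m (2^n))" by (rule supportedI) (auto simp: flip_less, metis flip_flip)
    have "0 \<le> e" by (rule order_trans[OF norm_ge_zero e[OF _ _ one unitary_one adj_one]]) auto
    then have "real k \<le> real n * H2 (e / 2 + \<delta> / 2)"
      by (intro shallow_circuit_entropy_bound[OF V _ \<psi> Ls(1,2,4) Dd Ls(5) e refl _ h(1)]) (use n2 assms(5) in auto)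
    then show False using h(2) n2 by (simp add: field_simps)
  qed
  from assms(6) show False
  proof
    assume h: "eps_g_complete n k V d / 2 + \<delta> / 2 < 1/2 \<and> H2 (eps_g_complete n k V d / 2 + \<delta> / 2) < real k / real n"
    show False
    proof (rule bound[of "eps_g_complete n k V d"])
      fix S G assume S: "S \<subseteq> {0..<n}" "card S \<le> d" and G: "supported n S G" "unitary (2^n) G"
      show "cmod (mtrace (outer \<psi> * G) - mtrace (code_Gamma k V * G)) \<le> eps_g_complete n k V d"
        by (rule order_trans[OF supported_expectation_le[OF G S(1) outer_carrier[OF \<psi>] outer_hermitian
              code_Gamma_carrier[OF V(1)] code_Gamma_hermitian[OF V(1)]] eps_g_complete_upper[OF V(1) assms(7,8) S]])
    qed (use h in auto)
  next
    assume h: "2 * max_repl_inacc n k V d + \<delta> / 2 < 1/2 \<and> H2 (2 * max_repl_inacc n k V d + \<delta> / 2) < real k / real n"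
    show False
    proof (rule bound[of "4 * max_repl_inacc n k V d"])
      fix S G assume S: "S \<subseteq> {0..<n}" "card S \<le> d" and G: "supported n S G" "unitary (2^n) G" "adj G = G"
      have Gc: "G \<in> carrier_mat (2^n) (2^n)" using unitary_carrier[OF G(2)] .
      \<comment> \<open>\<open>code_Gamma k V\<close> is the uniform mixture of the encoded basis
        states, the columns of \<open>V\<close>, so comparing \<open>\<psi>\<close> with each column
        and averaging compares it with the mixture.\<close>
      define q where "q = (\<lambda>l. quad_form (2^n) G (\<lambda>a. V $$ (a,l)))"
      have "cmod (quad_form (2^n) G (\<lambda>a. \<psi> $ a) - q l) \<le> 4 * max_repl_inacc n k V d" if l: "l < 2^k" for l
      proof -
        have "(V *\<^sub>v unit_vec (2^k) l) $ a = V $$ (a,l)" if "a < 2^n" for a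
          using that V(1) l by (simp add: scalar_prod_right_unit)
        then have "quad_form (2^n) G (\<lambda>a. (V *\<^sub>v unit_vec (2^k) l) $ a) = q l"
          unfolding q_def quad_form_def by simp
        moreover have "unit_vec (2^k) l \<bullet>c (unit_vec (2^k) l :: complex vec) = 1"
          using l by (simp add: scalar_prod_left_unit)
        ultimately show ?thesis
          using max_repl_inacc_bounds[OF V S G \<phi>(2) \<phi>1 unit_vec_carrier, of l] \<phi>(1) by simp
      qed
      then have le: "cmod (\<Sum>l<2^k. quad_form (2^n) G (\<lambda>a. \<psi> $ a) - q l) \<le> (\<Sum>l<(2::nat)^k. 4 * max_repl_inacc n k V d)"
        by (intro order_trans[OF norm_sum] sum_mono) auto
      have "mtrace (outer \<psi> * G) - mtrace (code_Gamma k V * G) = (\<Sum>l<2^k. quad_form (2^n) G (\<lambda>a. \<psi> $ a) - q l) / 2^k"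
        unfolding mtrace_outer_mult[OF \<psi> Gc] code_Gamma_trace_mult[OF V(1) Gc] q_def
        by (simp add: sum_subtractf diff_divide_distrib)
      then have "cmod (mtrace (outer \<psi> * G) - mtrace (code_Gamma k V * G))
        = cmod (\<Sum>l<2^k. quad_form (2^n) G (\<lambda>a. \<psi> $ a) - q l) / 2^k"
        by (simp add: norm_divide norm_power)
      also have "\<dots> \<le> (\<Sum>l<(2::nat)^k. 4 * max_repl_inacc n k V d) / 2^k"
        using le by (rule divide_right_mono) simp
      also have "\<dots> = 4 * max_repl_inacc n k V d" by simp
      finally show "cmod (mtrace (outer \<psi> * G) - mtrace (code_Gamma k V * G)) \<le> 4 * max_repl_inacc n k V d" .
    qed (use h in auto)
  qed
qed

end
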